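(* Consider the extended Mei stopping rule $T_{\rm Mei}(p_0)$, $0<p_0\le1$, with threshold $b$. Let $u=\log[1+p_0(\lambda_M\xi-1)]$. If $\mathrm{ARL}(T_{\rm Mei}(p_0))=\gamma$, where $\gamma\ge1$, then $b\le Nu+\log(4\gamma)$. In addition, let $\gamma=\gamma_N$ satisfy $\log\gamma\sim N^{\zeta}$ for some $0<\zeta<1$, let $p=p_N\sim N^{-\beta}$ for some $0<\beta<1$, let $p_0=c[(\log\gamma)/N]^{1/2}$ for some constant $c>0$, and let $b=b_N$ be such that $\mathrm{ARL}(T_{\rm Mei}(p_0))=\gamma$. Then the following hold as $N\to\infty$. (a) If $\frac{1-\zeta}{2}<\beta\le\frac{3(1-\zeta)}{4}$ and $\mu_0=2\mu$, then $$\frac{D_{N,K_N}(T_{\rm Mei}(p_0))}{\log N}\to2\mu^{-2}\rho(\beta,\zeta)$$ for $K_N=2\mu^{-2}(1-\zeta-\beta)\log N$. (b) If $\frac{3(1-\zeta)}{4}<\beta<1-\zeta$ and $\mu_0=\mu\sqrt{\frac{1-\zeta}{\rho(\beta,\zeta)}}$, then $$\frac{D_{N,K_N}(T_{\rm Mei}(p_0))}{\log N}\to2\mu^{-2}\rho(\beta,\zeta)$$ for $K_N=2\mu^{-2}\rho(\beta,\zeta)\log N$.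
   Context: Model: there are $N$ data streams; $X_{nt}$ ($1\le n\le N$, $t\ge1$ integer) is the observation of stream $n$ at time $t$. The set $\mathcal N\subset\{1,\dots,N\}$ of affected streams is random, with $\mathbf 1_{\{1\in\mathcal N\}},\dots,\mathbf 1_{\{N\in\mathcal N\}}$ i.i.d. Bernoulli($p$), $0<p<1$. For a change-point $\nu\in\{1,2,\dots\}$, under $P_\nu$ (expectation $E_\nu$), conditionally on $\mathcal N$ the $X_{nt}$ are independent with $X_{nt}\sim N(\mu_{nt},1)$, where $\mu_{nt}=\mu\,\mathbf 1_{\{t\ge\nu,\ n\in\mathcal N\}}$ and $\mu>0$ is fixed. Under $P_\infty$ ($E_\infty$) all $X_{nt}$ are i.i.d. $N(0,1)$. For a stopping rule $T$, i.e. a stopping time with respect to the filtration generated by the observations of all streams, $\mathrm{ARL}(T)=E_\infty T$, and for real $k>0$ $$D_{N,k}(T)=\sup_{k\le\nu<\infty}E_\nu(T-\nu+1\mid T\ge\nu),$$ the supremum being over integers $\nu\geq 1$ with $\nu\ge k$ for which the conditioning event has positive probability. Extended Mei stopping rule: fix $\mu_0>0$ and $\lambda_M>0$. The CUSUM score of stream $n$ is defined by $R_{n0}=0$ and $R_{nt}=(R_{n,t-1}+\mu_0X_{nt}-\mu_0^2/2)^+$ for $t\ge1$, where $x^+=\max(x,0)$. Let $g_M(x)=\log[1+p_0(\lambda_Me^{x/2}-1)]$ and, for a threshold $b$, $$T_{\rm Mei}(p_0)=\inf\Big\{t\geq 1:\ \sum_{n=1}^Ng_M(R_{nt})\ge b\Big\}.$$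 Let $\xi=\lim_{t\to\infty}E_\infty e^{R_{nt}/2}$ (which does not depend on $n$). The constant $\rho(\beta,\zeta)$ is $$\rho(\beta,\zeta)=\begin{cases}\beta-\frac{1-\zeta}{2} & \text{if }\frac{1-\zeta}{2}<\beta\le\frac{3(1-\zeta)}{4},\\[2pt] \left(\sqrt{1-\zeta}-\sqrt{1-\zeta-\beta}\right)^2 & \text{if }\frac{3(1-\zeta)}{4}<\beta<1-\zeta.\end{cases}$$ Here $a_N\sim b_N$ means $a_N/b_N\to1$ as $N\to\infty$. *)

theory Defs
  imports "HOL-Probability.Probability"
begin

text \<open>
  A sample point \<open>\<omega>\<close> maps \<open>(n, t)\<close>, with \<open>1 \<le> n \<le> N\<close> and \<open>1 \<le> t\<close>, to the observation of
  stream \<open>n\<close> at time \<open>t\<close>. All quantities below depend only on the law of the observations, so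
  the probability measures live on the canonical space of all such arrays.
\<close>

definition obs_index :: "nat \<Rightarrow> (nat \<times> nat) set" where
  "obs_index N = {1..N} \<times> {1..}"

definition P_inf :: "nat \<Rightarrow> (nat \<times> nat \<Rightarrow> real) measure" where
  "P_inf N = Pi\<^sub>M (obs_index N) (\<lambda>_. density lborel (normal_density 0 1))"

definition affected_pmf :: "nat \<Rightarrow> real \<Rightarrow> nat set pmf" where
  "affected_pmf N p =
     map_pmf (\<lambda>a. {n \<in> {1..N}. a n}) (Pi_pmf {1..N} False (\<lambda>_. bernoulli_pmf p))"

definition obs_mean :: "real \<Rightarrow> nat \<Rightarrow> nat set \<Rightarrow> nat \<Rightarrow> nat \<Rightarrow> real" where
  "obs_mean \<mu> \<nu> A n t = (if \<nu> \<le> t \<and> n \<in> A then \<mu> else 0)"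

definition P_given :: "nat \<Rightarrow> real \<Rightarrow> nat \<Rightarrow> nat set \<Rightarrow> (nat \<times> nat \<Rightarrow> real) measure" where
  "P_given N \<mu> \<nu> A =
     Pi\<^sub>M (obs_index N) (\<lambda>(n, t). density lborel (normal_density (obs_mean \<mu> \<nu> A n t) 1))"

text \<open>The law of the observations for change-point \<open>\<nu>\<close>: the affected set is drawn first, then
  the observations given that set.\<close>

definition P_change :: "nat \<Rightarrow> real \<Rightarrow> real \<Rightarrow> nat \<Rightarrow> (nat \<times> nat \<Rightarrow> real) measure" where
  "P_change N \<mu> p \<nu> = measure_pmf (affected_pmf N p) \<bind> P_given N \<mu> \<nu>"

definition ARL :: "nat \<Rightarrow> ((nat \<times> nat \<Rightarrow> real) \<Rightarrow> enat) \<Rightarrow> ennreal" where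
  "ARL N T = (\<integral>\<^sup>+\<omega>. ennreal_of_enat (T \<omega>) \<partial>P_inf N)"

definition late_event ::
    "nat \<Rightarrow> real \<Rightarrow> real \<Rightarrow> ((nat \<times> nat \<Rightarrow> real) \<Rightarrow> enat) \<Rightarrow> nat \<Rightarrow> (nat \<times> nat \<Rightarrow> real) set" where
  "late_event N \<mu> p T \<nu> = {\<omega> \<in> space (P_change N \<mu> p \<nu>). enat \<nu> \<le> T \<omega>}"

text \<open>The elementary conditional expectation of \<open>T - \<nu> + 1\<close> given \<open>T \<ge> \<nu>\<close>; the truncated
  subtraction on \<open>enat\<close> is exact on the conditioning event.\<close>

definition cond_delay ::
    "nat \<Rightarrow> real \<Rightarrow> real \<Rightarrow> ((nat \<times> nat \<Rightarrow> real) \<Rightarrow> enat) \<Rightarrow> nat \<Rightarrow> ennreal" where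
  "cond_delay N \<mu> p T \<nu> =
     (\<integral>\<^sup>+\<omega>. ennreal_of_enat (T \<omega> - enat \<nu> + 1) * indicator (late_event N \<mu> p T \<nu>) \<omega>
        \<partial>P_change N \<mu> p \<nu>)
     / emeasure (P_change N \<mu> p \<nu>) (late_event N \<mu> p T \<nu>)"

definition detection_delay ::
    "nat \<Rightarrow> real \<Rightarrow> real \<Rightarrow> real \<Rightarrow> ((nat \<times> nat \<Rightarrow> real) \<Rightarrow> enat) \<Rightarrow> ennreal" where
  "detection_delay N \<mu> p k T =
     (SUP \<nu>\<in>{\<nu>. 1 \<le> \<nu> \<and> k \<le> real \<nu> \<and>
               0 < emeasure (P_change N \<mu> p \<nu>) (late_event N \<mu> p T \<nu>)}.
        cond_delay N \<mu> p T \<nu>)"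

fun cusum :: "real \<Rightarrow> (nat \<times> nat \<Rightarrow> real) \<Rightarrow> nat \<Rightarrow> nat \<Rightarrow> real" where
  "cusum \<mu>0 \<omega> n 0 = 0"
| "cusum \<mu>0 \<omega> n (Suc t) = max (cusum \<mu>0 \<omega> n t + \<mu>0 * \<omega> (n, Suc t) - \<mu>0\<^sup>2 / 2) 0"

definition g_Mei :: "real \<Rightarrow> real \<Rightarrow> real \<Rightarrow> real" where
  "g_Mei lamM p0 x = ln (1 + p0 * (lamM * exp (x / 2) - 1))"

text \<open>The infimum of the empty set is \<open>\<infinity>\<close> in \<open>enat\<close>.\<close>

definition T_Mei ::
    "nat \<Rightarrow> real \<Rightarrow> real \<Rightarrow> real \<Rightarrow> real \<Rightarrow> (nat \<times> nat \<Rightarrow> real) \<Rightarrow> enat" where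
  "T_Mei N \<mu>0 lamM p0 b \<omega> =
     (INF t\<in>{t. 1 \<le> t \<and> b \<le> (\<Sum>n=1..N. g_Mei lamM p0 (cusum \<mu>0 \<omega> n t))}. enat t)"

text \<open>The value is the same for all \<open>N\<close> and all streams \<open>1 \<le> n \<le> N\<close>. The limit exists: in law
  \<open>cusum \<mu>0 _ n t\<close> is stochastically increasing in \<open>t\<close>, with tails bounded by \<open>exp (- x)\<close>.\<close>

definition mei_xi :: "nat \<Rightarrow> real \<Rightarrow> nat \<Rightarrow> real" where
  "mei_xi N \<mu>0 n = lim (\<lambda>t. \<integral>\<omega>. exp (cusum \<mu>0 \<omega> n t / 2) \<partial>P_inf N)"

definition rho :: "real \<Rightarrow> real \<Rightarrow> real" where
  "rho \<beta> \<zeta> =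
     (if (1 - \<zeta>) / 2 < \<beta> \<and> \<beta> \<le> 3 * (1 - \<zeta>) / 4 then \<beta> - (1 - \<zeta>) / 2
      else if 3 * (1 - \<zeta>) / 4 < \<beta> \<and> \<beta> < 1 - \<zeta> then (sqrt (1 - \<zeta>) - sqrt (1 - \<zeta> - \<beta>))\<^sup>2
      else undefined)"

end

theory Submission
  imports Defs "HOL-Real_Asymp.Real_Asymp"
begin

text \<open>
  The pieces of the argument are restarted scores: a CUSUM restarted from zero never exceeds the
  original one, and scores restarted at different times use disjoint blocks of observations.

  \<^emph>\<open>Threshold.\<close> Under the null hypothesis \<open>E exp (\<Sum> g\<^sub>M) \<le> exp (N u)\<close> at each time, so an alarm by
  time \<open>t\<close> has probability at most \<open>t exp (N u - b)\<close>.

  \<^emph>\<open>Upper bound.\<close> Restart \<open>K\<^sub>N\<close> steps before the change. The probability that the restarted score is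
  still below \<open>b\<close> after \<open>(1 + \<epsilon>) 2 \<rho> \<mu>\<^sup>-\<^sup>2 log N\<close> post-change steps is at most
  \<open>exp b (E exp (- g\<^sub>M))\<^sup>N \<le> 1 / \<gamma>\<close>, while the delay that remains after such a miss has mean at most
  \<open>\<gamma>\<close>. Conditioning on \<open>T \<ge> \<nu>\<close> is harmless because Harris' inequality bounds
  \<open>P(T \<ge> \<nu>) / P(T \<ge> \<nu> - K\<^sub>N)\<close> from below, uniformly in \<open>\<nu>\<close>.

  \<^emph>\<open>Lower bound.\<close> As \<open>ARL = \<gamma>\<close>, some \<open>\<nu> \<ge> K\<^sub>N\<close> has \<open>P\<^sub>\<infinity>(T < \<nu> + w | T \<ge> \<nu>) \<le> 2 w / \<gamma>\<close>. Changing the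
  measure to \<open>P\<^sub>\<nu>\<close> costs the mixture likelihood ratio, which exceeds \<open>\<gamma>\<^sup>1\<^sup>/\<^sup>2\<close> with vanishing
  probability by a bound on its moment of order \<open>1 + s\<close>.

  Both regimes are instances of \<open>\<mu>\<^sub>0 = (1 + s) \<mu>\<close> with \<open>(1 + s) (\<beta> - s \<rho>) = 1 - \<zeta>\<close>: \<open>s = 1\<close> in (a) and
  \<open>(1 + s)\<^sup>2 = (1 - \<zeta>) / \<rho>\<close> in (b).
\<close>

section \<open>Products of identical probability spaces\<close>

text \<open>In the upper bound both \<open>exp b\<close> and the \<open>N\<close>-th power of the
  mean of exp (- g) are governed by \<open>N * p0\<close>, of order N^((1+\<zeta>)/2), while their
  product has to be as small as 1/\<gamma>, that is, on the scale exp (- N^\<zeta>). So the terms of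
  first order in \<open>p0\<close> have to cancel, and the work lies in what they leave behind. A
  restarted score has seen finitely many observations; its moment lies below \<xi> by a term that
  decays by exp (- m^2 / 8) per step. Times \<open>N * p0\<close> this is of order N^\<zeta> after 4
  (1-\<zeta>) m^-2 log N steps, and K_N is that number less the post-change steps. The quadratic
  remainder cannot be integrated as it stands: E exp (\<theta> R) is controlled uniformly in time
  only for \<theta> < 1, so the power 2 is lowered to 2 \<theta>. The decisive gain comes from the
  few affected streams whose observations after the change average \<open>m\<close> instead of
  \<mu>. The choice of \<open>s\<close> puts this gain, and in the lower bound \<open>N\<close>
  times the excess moment of order 1 + s, exactly on the scale N^\<zeta> at delay 2 \<rho> \<mu>^-2
  log N; a factor 1 + \<epsilon> or 1 - \<epsilon> in the delay then decides.\<close>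

lemma nn_integral_PiM_blocks:
  fixes f :: "'l \<Rightarrow> ('i \<Rightarrow> 'b) \<Rightarrow> ennreal"
  assumes D: "prob_space D" and L: "finite L" "disjoint_family_on K L"
    and K: "\<And>l. l \<in> L \<Longrightarrow> K l \<subseteq> I"
    and f: "\<And>l. l \<in> L \<Longrightarrow> f l \<in> borel_measurable (PiM (K l) (\<lambda>_. D))"
    and dep: "\<And>l \<omega>. l \<in> L \<Longrightarrow> f l (restrict \<omega> (K l)) = f l \<omega>"
  shows "(\<integral>\<^sup>+\<omega>. (\<Prod>l\<in>L. f l \<omega>) \<partial>PiM I (\<lambda>_. D)) = (\<Prod>l\<in>L. \<integral>\<^sup>+\<omega>. f l \<omega> \<partial>PiM I (\<lambda>_. D))"
proof -
  interpret prob_space "PiM I (\<lambda>_. D)" by (intro prob_space_PiM D)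
  have coord: "indep_vars (\<lambda>_. D) (\<lambda>i \<omega>. \<omega> i) I"
  proof (cases "I = {}")
    case False
    have "distr (PiM I (\<lambda>_. D)) (PiM I (\<lambda>_. D)) (\<lambda>x. \<lambda>i\<in>I. x i) = PiM I (\<lambda>i. distr (PiM I (\<lambda>_. D)) D (\<lambda>\<omega>. \<omega> i))"
    proof -
      have "distr (PiM I (\<lambda>_. D)) (PiM I (\<lambda>_. D)) (\<lambda>x. \<lambda>i\<in>I. x i)
            = distr (PiM I (\<lambda>_. D)) (PiM I (\<lambda>_. D)) (\<lambda>x. x)"
        by (intro distr_cong) (auto simp: space_PiM PiE_def extensional_restrict)
      also have "\<dots> = PiM I (\<lambda>_. D)" by (rule distr_id)
      also have "\<dots> = PiM I (\<lambda>i. distr (PiM I (\<lambda>_. D)) D (\<lambda>\<omega>. \<omega> i))"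
        by (intro PiM_cong refl) (simp add: distr_PiM_component[where M="\<lambda>_. D"] D)
      finally show ?thesis .
    qed
    then show ?thesis
      using False by (subst indep_vars_iff_distr_eq_PiM') auto
  qed (unfold indep_vars_def indep_sets_def, auto)
  have "indep_vars (\<lambda>l. PiM (K l) (\<lambda>_. D)) (\<lambda>l \<omega>. restrict (\<lambda>i. \<omega> i) (K l)) L"
    by (rule indep_vars_restrict[OF coord K L(2)])
  then have "indep_vars (\<lambda>_. borel) (\<lambda>l \<omega>. f l (restrict \<omega> (K l))) L"
    by (rule indep_vars_compose2) (use f in auto)
  then have "indep_vars (\<lambda>_. borel) f L"
    by (rule indep_vars_cong[THEN iffD1, rotated -1]) (auto simp: dep fun_eq_iff)
  then show ?thesis
    using indep_vars_nn_integral[OF L(1)] by auto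
qed

lemma nn_integral_PiM_indep2:
  fixes f g :: "('i \<Rightarrow> 'b) \<Rightarrow> ennreal"
  assumes D: "prob_space D" and K: "K \<inter> K' = {}" "K \<subseteq> I" "K' \<subseteq> I"
    and f: "f \<in> borel_measurable (PiM K (\<lambda>_. D))" "\<And>\<omega>. f (restrict \<omega> K) = f \<omega>"
    and g: "g \<in> borel_measurable (PiM K' (\<lambda>_. D))" "\<And>\<omega>. g (restrict \<omega> K') = g \<omega>"
  shows "(\<integral>\<^sup>+\<omega>. f \<omega> * g \<omega> \<partial>PiM I (\<lambda>_. D))
         = (\<integral>\<^sup>+\<omega>. f \<omega> \<partial>PiM I (\<lambda>_. D)) * (\<integral>\<^sup>+\<omega>. g \<omega> \<partial>PiM I (\<lambda>_. D))"
proof -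
  have "(\<integral>\<^sup>+\<omega>. (\<Prod>l\<in>UNIV. (if l then f else g) \<omega>) \<partial>PiM I (\<lambda>_. D))
        = (\<Prod>l\<in>UNIV. \<integral>\<^sup>+\<omega>. (if l then f else g) \<omega> \<partial>PiM I (\<lambda>_. D))"
    by (rule nn_integral_PiM_blocks[where K="\<lambda>l. if l then K else K'"])
       (use assms in \<open>auto simp: disjoint_family_on_def\<close>)
  then show ?thesis by (simp add: UNIV_bool mult.commute)
qed

lemma nn_integral_PiM_reindex:
  assumes D: "prob_space D" and \<phi>: "inj_on \<phi> J" "\<phi> \<in> J \<rightarrow> I"
    and f: "f \<in> borel_measurable (PiM J (\<lambda>_. D))"
  shows "(\<integral>\<^sup>+\<omega>. f (\<lambda>j\<in>J. \<omega> (\<phi> j)) \<partial>PiM I (\<lambda>_. D)) = (\<integral>\<^sup>+x. f x \<partial>PiM J (\<lambda>_. D))"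
proof -
  have "(\<integral>\<^sup>+x. f x \<partial>PiM J (\<lambda>_. D)) = (\<integral>\<^sup>+x. f x \<partial>distr (PiM I (\<lambda>_. D)) (PiM J (\<lambda>_. D)) (\<lambda>\<omega>. \<lambda>j\<in>J. \<omega> (\<phi> j)))"
    using distr_PiM_reindex[of I "\<lambda>_. D", OF D \<phi>] by simp
  also have "\<dots> = (\<integral>\<^sup>+\<omega>. f (\<lambda>j\<in>J. \<omega> (\<phi> j)) \<partial>PiM I (\<lambda>_. D))"
    using \<phi> f by (subst nn_integral_distr) (auto intro!: measurable_restrict measurable_component_singleton)
  finally show ?thesis ..
qed

lemma nn_integral_PiM_restrict:
  assumes D: "prob_space D" and K: "K \<subseteq> I" and f: "f \<in> borel_measurable (PiM K (\<lambda>_. D))"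
  shows "(\<integral>\<^sup>+\<omega>. f (restrict \<omega> K) \<partial>PiM I (\<lambda>_. D)) = (\<integral>\<^sup>+x. f x \<partial>PiM K (\<lambda>_. D))"
  using nn_integral_PiM_reindex[OF D, of "\<lambda>i. i" K I f] K f by (simp only: restrict_def) auto

lemma nn_integral_if_eq_emeasure:
  "Measurable.pred M Q \<Longrightarrow> (\<integral>\<^sup>+\<omega>. (if Q \<omega> then 1 else 0) \<partial>M) = emeasure M {\<omega> \<in> space M. Q \<omega>}"
  by (auto simp: indicator_def simp flip: nn_integral_indicator intro!: nn_integral_cong)

section \<open>Positive association: the inequalities of Chebyshev and Harris\<close>

lemma ennreal_rearrangement:
  fixes a b c d :: ennreal
  assumes "a \<le> b \<and> c \<le> d \<or> b \<le> a \<and> d \<le> c"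
  shows "a * d + b * c \<le> a * c + b * d"
proof -
  \<comment> \<open>This is (b - a) (d - c) \<ge> 0 multiplied out; writing \<open>d = c + e\<close>
    avoids the truncated subtraction of \<open>ennreal\<close>.\<close>
  have *: "a * d + b * c \<le> a * c + b * d" if "a \<le> b" "c \<le> d" for a b c d :: ennreal
  proof -
    obtain e where e: "d = c + e" using \<open>c \<le> d\<close> by (auto simp: le_iff_add)
    have "a * d + b * c = a * c + b * c + a * e" unfolding e by (simp add: algebra_simps)
    also have "\<dots> \<le> a * c + b * c + b * e" using \<open>a \<le> b\<close> by (intro add_left_mono mult_right_mono) auto
    also have "\<dots> = a * c + b * d" unfolding e by (simp add: algebra_simps)
    finally show ?thesis .
  qed
  from assms show ?thesis
    using *[of a b c d] *[of b a d c] by (auto simp: add.commute)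
qed

text \<open>Symmetrisation: with two independent copies x and y, similarly ordered functions satisfy
  the rearrangement inequality for every pair, and integrating it gives twice the claim. Finiteness
  is what allows the factor two to be cancelled in \<open>ennreal\<close>.\<close>

lemma (in prob_space) nn_integral_chebyshev:
  fixes f g :: "'a \<Rightarrow> ennreal"
  assumes [measurable]: "f \<in> borel_measurable M" "g \<in> borel_measurable M"
    and fin: "(\<integral>\<^sup>+x. f x * g x \<partial>M) < \<infinity>"
    and ord: "\<And>x y. f x \<le> f y \<and> g x \<le> g y \<or> f y \<le> f x \<and> g y \<le> g x"
  shows "(\<integral>\<^sup>+x. f x \<partial>M) * (\<integral>\<^sup>+x. g x \<partial>M) \<le> (\<integral>\<^sup>+x. f x * g x \<partial>M)"
proof -
  let ?I = "\<integral>\<^sup>+x. f x * g x \<partial>M"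
  have "(\<integral>\<^sup>+x. \<integral>\<^sup>+y. f x * g y + f y * g x \<partial>M \<partial>M) \<le> (\<integral>\<^sup>+x. \<integral>\<^sup>+y. f x * g x + f y * g y \<partial>M \<partial>M)"
    by (intro nn_integral_mono ennreal_rearrangement ord)
  then have "(\<integral>\<^sup>+x. f x \<partial>M) * (\<integral>\<^sup>+x. g x \<partial>M) + (\<integral>\<^sup>+x. f x \<partial>M) * (\<integral>\<^sup>+x. g x \<partial>M) \<le> ?I + ?I"
    by (simp add: nn_integral_add nn_integral_cmult nn_integral_multc emeasure_space_1)
  then show ?thesis
    using fin by (metis add_strict_mono le_less_linear linorder_not_less)
qed

text \<open>Induction on the coordinates. With coordinate \<open>i\<close> frozen at y, the
  induction hypothesis compares the integrals over the other coordinates; the averages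
  \<open>F\<close> and \<open>G\<close> are again decreasing in y, so the one-dimensional inequality
  of Chebyshev finishes. The bound by 1 keeps all integrals finite.\<close>

lemma harris_PiM:
  fixes f g :: "('i \<Rightarrow> real) \<Rightarrow> ennreal"
  assumes D: "prob_space D" and "finite J"
    and "f \<in> borel_measurable (PiM J (\<lambda>_. D))" "g \<in> borel_measurable (PiM J (\<lambda>_. D))"
    and "\<And>x. f x \<le> 1" "\<And>x. g x \<le> 1" and "antimono f" "antimono g"
  shows "(\<integral>\<^sup>+x. f x \<partial>PiM J (\<lambda>_. D)) * (\<integral>\<^sup>+x. g x \<partial>PiM J (\<lambda>_. D))
         \<le> (\<integral>\<^sup>+x. f x * g x \<partial>PiM J (\<lambda>_. D))"
  using assms(2-)
proof (induction J arbitrary: f g rule: finite_induct)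
  case empty
  then show ?case by (simp add: PiM_empty nn_integral_count_space_finite)
next
  case (insert i J)
  interpret D: prob_space D by fact
  interpret product_sigma_finite "\<lambda>_. D" by unfold_locales
  interpret PJ: prob_space "PiM J (\<lambda>_. D)" by (intro prob_space_PiM D)
  note [measurable] = insert.prems(1,2)
  have [measurable]: "(\<lambda>(x, y). x(i := y)) \<in> PiM J (\<lambda>_. D) \<Otimes>\<^sub>M D \<rightarrow>\<^sub>M PiM (insert i J) (\<lambda>_. D)"
    by (rule measurable_add_dim)
  have sec: "(\<lambda>x. h (x(i := y))) \<in> borel_measurable (PiM J (\<lambda>_. D))"
    if "h \<in> borel_measurable (PiM (insert i J) (\<lambda>_. D))" "y \<in> space D" for h :: "_ \<Rightarrow> ennreal" and y
    by (rule measurable_compose[OF _ that(1)]) (rule measurable_add_dim[THEN measurable_compose_rev, of "\<lambda>x. (x, y)", simplified], use that in auto)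
  define F where "F = (\<lambda>y. \<integral>\<^sup>+x. f (x(i := y)) \<partial>PiM J (\<lambda>_. D))"
  define G where "G = (\<lambda>y. \<integral>\<^sup>+x. g (x(i := y)) \<partial>PiM J (\<lambda>_. D))"
  have Fm[measurable]: "F \<in> borel_measurable D" unfolding F_def
    by (intro PJ.borel_measurable_nn_integral) measurable
  have Gm[measurable]: "G \<in> borel_measurable D" unfolding G_def
    by (intro PJ.borel_measurable_nn_integral) measurable
  have anti: "x(i := y) \<le> x(i := y')" if "y \<le> y'" for x :: "'i \<Rightarrow> real" and y y'
    using that by (auto simp: le_fun_def)
  have Fanti: "F y' \<le> F y" and Ganti: "G y' \<le> G y" if "y \<le> y'" for y y'
    unfolding F_def G_def
    by (intro nn_integral_mono antimonoD[OF insert.prems(5)] antimonoD[OF insert.prems(6)] anti that)+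
  have le1: "F y \<le> 1" "G y \<le> 1" for y
    using nn_integral_mono[of "PiM J (\<lambda>_. D)" "\<lambda>x. f (x(i := y))" "\<lambda>_. 1"]
          nn_integral_mono[of "PiM J (\<lambda>_. D)" "\<lambda>x. g (x(i := y))" "\<lambda>_. 1"] insert.prems(3,4)
    by (auto simp: F_def G_def PJ.emeasure_space_1)
  have "(\<integral>\<^sup>+y. F y * G y \<partial>D) \<le> (\<integral>\<^sup>+y. 1 \<partial>D)"
    by (intro nn_integral_mono) (metis le1 mult_mono mult_1 zero_le)
  then have fin: "(\<integral>\<^sup>+y. F y * G y \<partial>D) < \<infinity>"
    by (simp add: D.emeasure_space_1 order_le_less_trans)
  have "(\<integral>\<^sup>+x. f x \<partial>PiM (insert i J) (\<lambda>_. D)) * (\<integral>\<^sup>+x. g x \<partial>PiM (insert i J) (\<lambda>_. D))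
        = (\<integral>\<^sup>+y. F y \<partial>D) * (\<integral>\<^sup>+y. G y \<partial>D)"
    unfolding F_def G_def using insert.hyps by (subst (1 2) product_nn_integral_insert_rev) auto
  also have "\<dots> \<le> (\<integral>\<^sup>+y. F y * G y \<partial>D)"
    by (intro D.nn_integral_chebyshev Fm Gm fin) (metis Fanti Ganti linear)
  also have "\<dots> \<le> (\<integral>\<^sup>+y. (\<integral>\<^sup>+x. f (x(i := y)) * g (x(i := y)) \<partial>PiM J (\<lambda>_. D)) \<partial>D)"
  proof (intro nn_integral_mono)
    fix y assume y: "y \<in> space D"
    show "F y * G y \<le> (\<integral>\<^sup>+x. f (x(i := y)) * g (x(i := y)) \<partial>PiM J (\<lambda>_. D))"
      unfolding F_def G_def
    proof (rule insert.IH)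
      show "antimono (\<lambda>x. f (x(i := y)))" "antimono (\<lambda>x. g (x(i := y)))"
        by (intro antimonoI antimonoD[OF insert.prems(5)] antimonoD[OF insert.prems(6)]; auto simp: le_fun_def)+
    qed (rule sec[OF insert.prems(1) y] sec[OF insert.prems(2) y] insert.prems(3,4))+
  qed
  also have "\<dots> = (\<integral>\<^sup>+x. f x * g x \<partial>PiM (insert i J) (\<lambda>_. D))"
    using insert.hyps by (subst product_nn_integral_insert_rev) auto
  finally show ?case .
qed

section \<open>Standard normal observations\<close>

abbreviation stdn :: "real measure" where
  "stdn \<equiv> density lborel (normal_density 0 1)"

lemma prob_space_stdn: "prob_space stdn"
  by (rule prob_space_normal_density) simp

text \<open>Outside \<open>K\<close> every point of the product space has the value
  \<open>undefined\<close>, so the coordinate map is constant there. Without a side condition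
  \<open>i \<in> K\<close>, the automation can treat scores as functions on any product, be it a
  block or the whole array.\<close>

lemma measurable_component_stdn [measurable]:
  "(\<lambda>\<omega>. \<omega> i) \<in> borel_measurable (PiM K (\<lambda>_. stdn))"
proof (cases "i \<in> K")
  case True
  have "(\<lambda>\<omega>. \<omega> i) \<in> PiM K (\<lambda>_. stdn) \<rightarrow>\<^sub>M stdn"
    using True by (rule measurable_component_singleton)
  then show ?thesis by simp
next
  case False
  have "(\<lambda>\<omega>. \<omega> i) \<in> borel_measurable (PiM K (\<lambda>_. stdn)) \<longleftrightarrow>
        (\<lambda>\<omega>. undefined :: real) \<in> borel_measurable (PiM K (\<lambda>_. stdn))"
    using False by (intro measurable_cong) (auto simp: space_PiM PiE_def extensional_def)
  then show ?thesis by simp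
qed

lemma normal_density_tilt:
  "normal_density 0 1 x * exp (a * x) = exp (a\<^sup>2 / 2) * normal_density a 1 x"
  by (simp add: normal_density_def field_simps power2_eq_square flip: exp_add)

lemma nn_integral_stdn_exp:
  "(\<integral>\<^sup>+x. ennreal (exp (a * x + d)) \<partial>stdn) = ennreal (exp (a\<^sup>2 / 2 + d))"
proof -
  have "(\<integral>\<^sup>+x. ennreal (exp (a * x + d)) \<partial>stdn)
        = (\<integral>\<^sup>+x. ennreal (exp (a\<^sup>2 / 2 + d)) * ennreal (normal_density a 1 x) \<partial>lborel)"
  proof (subst nn_integral_density, simp, simp, intro nn_integral_cong)
    fix x :: real
    have "normal_density 0 1 x * exp (a * x + d) = exp d * (normal_density 0 1 x * exp (a * x))"
      by (simp add: exp_add)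
    also have "\<dots> = exp (a\<^sup>2 / 2 + d) * normal_density a 1 x"
      by (simp add: normal_density_tilt exp_add)
    finally show "ennreal (normal_density 0 1 x) * ennreal (exp (a * x + d))
        = ennreal (exp (a\<^sup>2 / 2 + d)) * ennreal (normal_density a 1 x)"
      by (simp add: ennreal_mult'[symmetric])
  qed
  also have "\<dots> = ennreal (exp (a\<^sup>2 / 2 + d)) * (\<integral>\<^sup>+x. ennreal (normal_density a 1 x) \<partial>lborel)"
    by (rule nn_integral_cmult) simp
  also have "(\<integral>\<^sup>+x. ennreal (normal_density a 1 x) \<partial>lborel) = 1"
    by (subst nn_integral_eq_integral) auto
  finally show ?thesis by simp
qed

text \<open>A shifted normal law is needed in two guises: as a translate, which couples changed and
  null observations on one space, and (in \<open>stdn_tilt\<close>) as a density, which yields the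
  likelihood ratio.\<close>

lemma stdn_shift: "distr stdn borel (\<lambda>x. x + a) = density lborel (normal_density a 1)"
proof -
  have "density lborel (normal_density a 1) = density (distr lborel borel (\<lambda>x. a + 1 * x)) (normal_density a 1)"
    by (subst lborel_real_affine[of 1 a]) (auto simp: one_ennreal_def[symmetric] density_1)
  also have "\<dots> = distr (density lborel (\<lambda>x. ennreal (normal_density a 1 (a + 1 * x)))) borel (\<lambda>x. a + 1 * x)"
    by (subst density_distr) auto
  also have "\<dots> = distr stdn borel (\<lambda>x. x + a)"
    by (intro distr_cong density_cong) (auto simp: normal_density_def add.commute)
  finally show ?thesis ..
qed

lemma stdn_tilt: "density stdn (\<lambda>x. ennreal (exp (a * x - a\<^sup>2 / 2))) = density lborel (normal_density a 1)"
proof (subst density_density_eq, simp, simp, intro density_cong)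
  show "AE x in lborel. ennreal (normal_density 0 1 x) * ennreal (exp (a * x - a\<^sup>2 / 2)) = ennreal (normal_density a 1 x)"
  proof (intro AE_I2)
    fix x :: real
    have "normal_density 0 1 x * exp (a * x - a\<^sup>2 / 2) = normal_density a 1 x"
    proof -
      have "normal_density 0 1 x * exp (a * x - a\<^sup>2 / 2) = (normal_density 0 1 x * exp (a * x)) * exp (- (a\<^sup>2 / 2))"
        by (simp flip: exp_add)
      also have "\<dots> = normal_density a 1 x * (exp (a\<^sup>2 / 2) * exp (- (a\<^sup>2 / 2)))"
        by (subst normal_density_tilt) (simp only: mult_ac)
      finally show ?thesis by (simp flip: exp_add)
    qed
    then show "ennreal (normal_density 0 1 x) * ennreal (exp (a * x - a\<^sup>2 / 2)) = ennreal (normal_density a 1 x)"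
      by (simp add: ennreal_mult'[symmetric])
  qed
qed auto

lemma nn_integral_coord_exp:
  assumes "finite F" "F \<subseteq> I"
  shows "(\<integral>\<^sup>+\<omega>. ennreal (\<Prod>i\<in>F. exp (a * \<omega> i + d)) \<partial>PiM I (\<lambda>_. stdn)) = ennreal (exp (a\<^sup>2 / 2 + d)) ^ card F"
proof -
  have "(\<integral>\<^sup>+\<omega>. ennreal (\<Prod>i\<in>F. exp (a * \<omega> i + d)) \<partial>PiM I (\<lambda>_. stdn))
        = (\<integral>\<^sup>+\<omega>. (\<Prod>i\<in>F. ennreal (exp (a * \<omega> i + d))) \<partial>PiM I (\<lambda>_. stdn))"
    by (simp add: prod_ennreal)
  also have "\<dots> = (\<Prod>i\<in>F. \<integral>\<^sup>+\<omega>. ennreal (exp (a * \<omega> i + d)) \<partial>PiM I (\<lambda>_. stdn))"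
    by (rule nn_integral_PiM_blocks[where K="\<lambda>i. {i}"])
       (use assms in \<open>auto simp: prob_space_stdn disjoint_family_on_def\<close>)
  also have "\<dots> = (\<Prod>i\<in>F. ennreal (exp (a\<^sup>2 / 2 + d)))"
  proof (intro prod.cong refl)
    fix i assume "i \<in> F"
    then have i: "i \<in> I" using assms by auto
    have "(\<integral>\<^sup>+x. ennreal (exp (a * x + d)) \<partial>distr (PiM I (\<lambda>_. stdn)) stdn (\<lambda>\<omega>. \<omega> i)) = ennreal (exp (a\<^sup>2 / 2 + d))"
      using distr_PiM_component[of I "\<lambda>_. stdn" i] i prob_space_stdn by (simp add: nn_integral_stdn_exp)
    then show "(\<integral>\<^sup>+\<omega>. ennreal (exp (a * \<omega> i + d)) \<partial>PiM I (\<lambda>_. stdn)) = ennreal (exp (a\<^sup>2 / 2 + d))"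
      using i by (subst (asm) nn_integral_distr) (auto intro: measurable_component_singleton)
  qed
  finally show ?thesis by simp
qed

text \<open>The normal density is bounded below by its value at the right end of an interval one
  standard deviation long. The price of a + 1 instead of a in the exponent is harmless: in the
  application a is of order sqrt (log N), so the loss is smaller than any power of
  \<open>N\<close>.\<close>

lemma prob_sum_coord_ge:
  fixes I :: "'i set"
  assumes F: "finite F" "F \<noteq> {}" "F \<subseteq> I"
  shows "exp (- (max a 0 + 1)\<^sup>2 / 2) / sqrt (2 * pi)
         \<le> measure (PiM I (\<lambda>_. stdn)) {\<omega> \<in> space (PiM I (\<lambda>_. stdn)). a * sqrt (card F) \<le> (\<Sum>i\<in>F. \<omega> i)}"
proof -
  let ?P = "PiM I (\<lambda>_. stdn)"
  interpret prob_space ?P by (intro prob_space_PiM prob_space_stdn)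
  have cF: "0 < sqrt (card F)" using F by (simp add: card_gt_0_iff)
  have "indep_vars (\<lambda>_. stdn) (\<lambda>i \<omega>. \<omega> i) F"
  proof (subst indep_vars_iff_distr_eq_PiM')
    have "distr ?P (PiM F (\<lambda>_. stdn)) (\<lambda>\<omega>. \<lambda>i\<in>F. \<omega> i) = PiM F (\<lambda>_. stdn)"
      using distr_PiM_reindex[of I "\<lambda>_. stdn" "\<lambda>i. i" F] F prob_space_stdn by auto
    also have "\<dots> = PiM F (\<lambda>i. distr ?P stdn (\<lambda>\<omega>. \<omega> i))"
      using F by (intro PiM_cong refl) (simp add: distr_PiM_component[where M="\<lambda>_. stdn"] prob_space_stdn subset_eq)
    finally show "distr ?P (PiM F (\<lambda>_. stdn)) (\<lambda>\<omega>. \<lambda>i\<in>F. \<omega> i) = PiM F (\<lambda>i. distr ?P stdn (\<lambda>\<omega>. \<omega> i))" .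
  qed (use F in \<open>auto\<close>)
  then have ind: "indep_vars (\<lambda>_. borel) (\<lambda>i \<omega>. \<omega> i) F"
    by (rule indep_vars_compose2[where Y="\<lambda>_ x. x", simplified]) simp
  have dist: "distributed ?P lborel (\<lambda>\<omega>. \<omega> i) (normal_density 0 1)" if "i \<in> F" for i
  proof -
    have "distr ?P lborel (\<lambda>\<omega>. \<omega> i) = distr ?P stdn (\<lambda>\<omega>. \<omega> i)"
      by (intro distr_cong) auto
    also have "\<dots> = stdn" using that F by (intro distr_PiM_component) (auto simp: prob_space_stdn)
    finally show ?thesis by (auto simp: distributed_def)
  qed
  have "distributed ?P lborel (\<lambda>\<omega>. \<Sum>i\<in>F. \<omega> i) (normal_density (\<Sum>i\<in>F. 0) (sqrt (\<Sum>i\<in>F. 1\<^sup>2)))"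
    by (rule sum_indep_normal) (use F ind dist in auto)
  then have S: "distributed ?P lborel (\<lambda>\<omega>. \<Sum>i\<in>F. \<omega> i) (normal_density 0 (sqrt (card F)))" by simp
  define c where "c = sqrt (card F)"
  \<comment> \<open>Cutting off at zero keeps the interval to the right of the mean, where the
    density decreases, and so covers negative \<open>a\<close> as well.\<close>
  define m where "m = max a 0"
  have "0 < c" unfolding c_def by (rule cF)
  have "m \<ge> 0" "a \<le> m" by (auto simp: m_def)
  have low: "exp (- (m + 1)\<^sup>2 / 2) / (sqrt (2 * pi) * c) \<le> normal_density 0 c x" if x: "x \<in> {m * c..(m + 1) * c}" for x
  proof -
    have "0 \<le> m * c" using \<open>0 < c\<close> \<open>m \<ge> 0\<close> by simp
    then have "0 \<le> x" using x by auto
    then have "x\<^sup>2 \<le> ((m + 1) * c)\<^sup>2" using x by (intro power_mono) auto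
    then have "x\<^sup>2 \<le> (m + 1)\<^sup>2 * c\<^sup>2" by (simp add: power_mult_distrib)
    then have "x\<^sup>2 / (2 * c\<^sup>2) \<le> (m + 1)\<^sup>2 / 2" using \<open>0 < c\<close> by (simp add: divide_simps)
    then have "exp (- (m + 1)\<^sup>2 / 2) \<le> exp (- (x - 0)\<^sup>2 / (2 * c\<^sup>2))" by simp
    moreover have "sqrt (2 * pi * c\<^sup>2) = sqrt (2 * pi) * c" using \<open>0 < c\<close> by (simp add: real_sqrt_mult)
    ultimately show ?thesis unfolding normal_density_def
      using \<open>0 < c\<close> by (simp add: field_simps)
  qed
  have "ennreal (exp (- (m + 1)\<^sup>2 / 2) / sqrt (2 * pi))
        = (\<integral>\<^sup>+x. ennreal (exp (- (m + 1)\<^sup>2 / 2) / (sqrt (2 * pi) * c)) * indicator {m * c..(m + 1) * c} x \<partial>lborel)"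
  proof -
    have e: "emeasure lborel {m * c..(m + 1) * c} = ennreal c"
      using \<open>0 < c\<close> by (subst emeasure_lborel_Icc) (auto simp: algebra_simps)
    show ?thesis
      using \<open>0 < c\<close> by (subst nn_integral_cmult_indicator) (simp_all add: e ennreal_mult'[symmetric])
  qed
  also have "\<dots> \<le> (\<integral>\<^sup>+x. ennreal (normal_density 0 c x) * indicator {a * c..} x \<partial>lborel)"
  proof (intro nn_integral_mono)
    fix x :: real
    show "ennreal (exp (- (m + 1)\<^sup>2 / 2) / (sqrt (2 * pi) * c)) * indicator {m * c..(m + 1) * c} x
        \<le> ennreal (normal_density 0 c x) * indicator {a * c..} x"
      using low[of x] order_trans[OF mult_right_mono[OF \<open>a \<le> m\<close>, of c], of x] \<open>0 < c\<close>
      by (auto simp: indicator_def intro!: ennreal_leI)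
  qed
  also have "\<dots> = emeasure ?P ((\<lambda>\<omega>. \<Sum>i\<in>F. \<omega> i) -` {a * c..} \<inter> space ?P)"
    using S unfolding c_def by (intro distributed_emeasure[symmetric]) auto
  also have "\<dots> = ennreal (prob {\<omega> \<in> space ?P. a * sqrt (card F) \<le> (\<Sum>i\<in>F. \<omega> i)})"
    by (subst emeasure_eq_measure) (simp add: c_def vimage_def Int_def conj_commute)
  finally show ?thesis by (simp add: m_def measure_nonneg)
qed

section \<open>The CUSUM recursion of a single stream\<close>

text \<open>An arbitrary initial value and inputs indexed from 0 make the family closed under
  continuation: running on from time a is again an \<open>rcus\<close>, started at the value reached
  (see \<open>rcus_add\<close>).\<close>

fun rcus :: "real \<Rightarrow> real \<Rightarrow> (nat \<Rightarrow> real) \<Rightarrow> nat \<Rightarrow> real" where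
  "rcus m z x 0 = z"
| "rcus m z x (Suc t) = max (rcus m z x t + m * x t - m\<^sup>2 / 2) 0"

lemma cusum_eq_rcus: "cusum m \<omega> n t = rcus m 0 (\<lambda>i. \<omega> (n, Suc i)) t"
  by (induction t) auto

lemma rcus_add: "rcus m z x (a + t) = rcus m (rcus m z x a) (\<lambda>i. x (a + i)) t"
  by (induction t) auto

lemma rcus_cong: "(\<And>i. i < t \<Longrightarrow> x i = y i) \<Longrightarrow> rcus m z x t = rcus m z y t"
  by (induction t) auto

lemma rcus_nonneg: "0 \<le> z \<Longrightarrow> 0 \<le> rcus m z x t"
  by (induction t) auto

lemma rcus_mono:
  assumes "0 \<le> m" "z \<le> z'" "\<And>i. i < t \<Longrightarrow> x i \<le> y i"
  shows "rcus m z x t \<le> rcus m z' y t"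
  using assms(3)
proof (induction t)
  case (Suc t)
  have "m * x t \<le> m * y t" using Suc.prems assms(1) by (intro mult_left_mono) auto
  with Suc show ?case by (auto simp: max_def)
qed (simp add: assms)

lemma rcus_restart_le: "0 \<le> m \<Longrightarrow> rcus m 0 (\<lambda>i. x (a + i)) t \<le> rcus m 0 x (a + t)"
  unfolding rcus_add by (intro rcus_mono) (auto simp: rcus_nonneg)

text \<open>The value at time h is nonnegative and reflection at zero only raises the path, so the
  score dominates the free random walk over the last k steps.\<close>

lemma rcus_ge_sum:
  assumes "0 \<le> m"
  shows "(\<Sum>i\<in>{h..<h + k}. m * x i - m\<^sup>2 / 2) \<le> rcus m 0 x (h + k)"
proof (induction k)
  case 0
  show ?case by (simp add: rcus_nonneg)
next
  case (Suc k)
  then show ?case by (simp add: algebra_simps)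
qed

lemma measurable_rcus [measurable]:
  assumes [measurable]: "\<And>i. (\<lambda>\<omega>. x \<omega> i) \<in> borel_measurable M" "z \<in> borel_measurable M"
  shows "(\<lambda>\<omega>. rcus m (z \<omega>) (x \<omega>) t) \<in> borel_measurable M"
  by (induction t) auto

text \<open>In terms of \<open>exp (R / 2)\<close> one CUSUM step is \<open>v \<mapsto> max (v * exp (Y / 2)) 1\<close>, which is
  Lipschitz with constant \<open>exp (Y / 2)\<close>.\<close>

lemma exp_rcus_diff_le:
  assumes "z \<le> z'"
  shows "exp (rcus m z' x t / 2) - exp (rcus m z x t / 2)
         \<le> (exp (z' / 2) - exp (z / 2)) * (\<Prod>i<t. exp (m / 2 * x i + - m\<^sup>2 / 4))"
proof (induction t)
  case (Suc t)
  define e where "e = exp (m / 2 * x t + - m\<^sup>2 / 4)"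
  have step: "exp (rcus m w x (Suc t) / 2) = max (exp (rcus m w x t / 2) * e) 1" for w
  proof -
    have "exp (max (rcus m w x t + m * x t - m\<^sup>2 / 2) 0 / 2)
          = max (exp ((rcus m w x t + m * x t - m\<^sup>2 / 2) / 2)) (exp 0)"
      by (auto simp: max_def)
    also have "exp ((rcus m w x t + m * x t - m\<^sup>2 / 2) / 2) = exp (rcus m w x t / 2) * e"
      unfolding e_def by (simp add: field_simps flip: exp_add)
    finally show ?thesis by simp
  qed
  have mono: "rcus m z x j \<le> rcus m z' x j" for j
    by (induction j) (use assms in \<open>auto simp: max_def\<close>)
  have "0 < e" by (simp add: e_def)
  have le: "exp (rcus m z x t / 2) * e \<le> exp (rcus m z' x t / 2) * e"
    using mono \<open>0 < e\<close> by (intro mult_right_mono) auto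
  then have "max (exp (rcus m z' x t / 2) * e) 1 - max (exp (rcus m z x t / 2) * e) 1
      \<le> exp (rcus m z' x t / 2) * e - exp (rcus m z x t / 2) * e"
    by (auto simp: max_def)
  also have "\<dots> = (exp (rcus m z' x t / 2) - exp (rcus m z x t / 2)) * e" by (simp add: algebra_simps)
  also have "\<dots> \<le> (exp (z' / 2) - exp (z / 2)) * (\<Prod>i<t. exp (m / 2 * x i + - m\<^sup>2 / 4)) * e"
    using Suc.IH \<open>0 < e\<close> by (intro mult_right_mono) auto
  finally show ?case unfolding step by (simp add: e_def mult.assoc)
qed simp

text \<open>Two CUSUM paths driven by the same observations coincide once the larger one has hit zero.\<close>

lemma rcus_neq_imp:
  assumes "0 \<le> z'" "z \<le> z'" "rcus m z x t \<noteq> rcus m z' x t"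
  shows "1 \<le> exp (z' / 2) * (\<Prod>i<t. exp (m / 2 * x i + - m\<^sup>2 / 4))"
proof -
  have mono: "rcus m z x t \<le> rcus m z' x t" for t
    by (induction t) (use assms in \<open>auto simp: max_def\<close>)
  \<comment> \<open>As long as the paths differ, the larger one has not been reflected and is still
    the free random walk started at \<open>z'\<close>. Its being nonnegative is the claim after
    exponentiation.\<close>
  have *: "rcus m z' x t = z' + (\<Sum>i<t. m * x i - m\<^sup>2 / 2)"
    if "rcus m z x t \<noteq> rcus m z' x t" for t
    using that
  proof (induction t)
    case (Suc t)
    then have ne: "rcus m z x t \<noteq> rcus m z' x t" by auto
    have "0 < rcus m z' x t + m * x t - m\<^sup>2 / 2"
      using Suc.prems mono[of t] by (auto simp: max_def split: if_splits)
    then show ?case using Suc.IH[OF ne] by auto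
  qed simp
  have "0 \<le> (z' + (\<Sum>i<t. m * x i - m\<^sup>2 / 2)) / 2" using *[OF assms(3)] assms(1,2) rcus_nonneg[of z' m x t] by auto
  then have "1 \<le> exp ((z' + (\<Sum>i<t. m * x i - m\<^sup>2 / 2)) / 2)" by simp
  also have "\<dots> = exp (z' / 2) * (\<Prod>i<t. exp (m / 2 * x i + - m\<^sup>2 / 4))"
    by (simp add: exp_sum[symmetric] exp_add[symmetric] add_divide_distrib sum_divide_distrib diff_divide_distrib)
  finally show ?thesis .
qed


subsection \<open>Moments under the null hypothesis\<close>

abbreviation stream :: "(nat \<Rightarrow> real) measure" where
  "stream \<equiv> PiM UNIV (\<lambda>_. stdn)"

lemma prob_space_stream: "prob_space stream"
  by (intro prob_space_PiM prob_space_stdn)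

lemma nn_integral_stream_shift:
  assumes "f \<in> borel_measurable stream"
  shows "(\<integral>\<^sup>+x. f (\<lambda>i. x (a + i)) \<partial>stream) = (\<integral>\<^sup>+x. f x \<partial>stream)"
  using nn_integral_PiM_reindex[OF prob_space_stdn, of "\<lambda>i. a + i" UNIV UNIV f] assms
  by (simp add: restrict_UNIV)

text \<open>A CUSUM increment Y = m x - m^2 / 2 is the log-likelihood ratio of N(m,1) against
  N(0,1), and E exp (Y / 2) = exp (- m^2 / 8) is the Hellinger affinity of the two laws. It is the
  rate at which a CUSUM forgets its past.\<close>

lemma nn_integral_prod_exp_stream:
  assumes "finite F"
  shows "(\<integral>\<^sup>+x. ennreal (\<Prod>i\<in>F. exp (m / 2 * x i + - m\<^sup>2 / 4)) \<partial>stream) = ennreal (exp (- m\<^sup>2 / 8) ^ card F)"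
proof -
  have "(m / 2)\<^sup>2 / 2 + - m\<^sup>2 / 4 = - m\<^sup>2 / 8" by (simp add: power2_eq_square field_simps)
  then show ?thesis
    using nn_integral_coord_exp[OF assms, of UNIV "m / 2" "- m\<^sup>2 / 4"] by (simp add: ennreal_power)
qed

text \<open>The fixed point of C = 1 + q C, where q = E exp (\<theta> Y) for one increment Y = m x -
  m^2 / 2 under the null hypothesis.\<close>

definition cusum_bound :: "real \<Rightarrow> real \<Rightarrow> real" where
  "cusum_bound m \<theta> = 1 / (1 - exp (- (\<theta> - \<theta>\<^sup>2) * m\<^sup>2 / 2))"

lemma cusum_bound_rate:
  fixes \<theta> m :: real
  assumes "0 < \<theta>" "\<theta> < 1" "m \<noteq> 0"
  shows "exp (- (\<theta> - \<theta>\<^sup>2) * m\<^sup>2 / 2) < 1"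
proof -
  have "\<theta> * \<theta> < \<theta>" using mult_strict_left_mono[of \<theta> 1 \<theta>] assms by simp
  then have "0 < \<theta> - \<theta>\<^sup>2" by (simp add: power2_eq_square)
  then have "0 < (\<theta> - \<theta>\<^sup>2) * m\<^sup>2" using assms by (intro mult_pos_pos) auto
  then have "- ((\<theta> - \<theta>\<^sup>2) * m\<^sup>2) / 2 < 0" by simp
  then show ?thesis by (simp only: minus_mult_left exp_less_one_iff)
qed

lemma cusum_bound_ge_1: "0 < \<theta> \<Longrightarrow> \<theta> < 1 \<Longrightarrow> m \<noteq> 0 \<Longrightarrow> 1 \<le> cusum_bound m \<theta>"
  using cusum_bound_rate[of \<theta> m] by (simp add: cusum_bound_def)

text \<open>Since exp (\<theta> max(y, 0)) \<le> 1 + exp (\<theta> y) and the new observation is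
  independent of the past, the moment after one more step is at most 1 + q times the old one, and
  \<open>cusum_bound\<close> is preserved. The restriction \<theta> < 1 is what makes q < 1: at
  \<theta> = 1 the likelihood ratio has mean one.\<close>

lemma cusum_exp_moment:
  assumes \<theta>: "0 < \<theta>" "\<theta> < 1" and m: "m \<noteq> 0"
  shows "(\<integral>\<^sup>+x. ennreal (exp (\<theta> * rcus m 0 x t)) \<partial>stream) \<le> ennreal (cusum_bound m \<theta>)"
proof (induction t)
  case 0
  interpret prob_space stream by (rule prob_space_stream)
  show ?case using cusum_bound_ge_1[OF assms] by (simp add: emeasure_space_1)
next
  case (Suc t)
  interpret prob_space stream by (rule prob_space_stream)
  define q where "q = exp (- (\<theta> - \<theta>\<^sup>2) * m\<^sup>2 / 2)"
  have q: "0 < q" "q < 1" using cusum_bound_rate[OF assms] by (auto simp: q_def)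
  let ?Y = "\<lambda>x. exp (\<theta> * m * x t + - \<theta> * m\<^sup>2 / 2)"
  have "(\<integral>\<^sup>+x. ennreal (exp (\<theta> * rcus m 0 x (Suc t))) \<partial>stream)
        \<le> (\<integral>\<^sup>+x. 1 + ennreal (exp (\<theta> * rcus m 0 x t)) * ennreal (?Y x) \<partial>stream)"
  proof (intro nn_integral_mono)
    fix x
    have "exp (\<theta> * rcus m 0 x (Suc t)) \<le> exp 0 + exp (\<theta> * (rcus m 0 x t + m * x t - m\<^sup>2 / 2))"
      by (auto simp: max_def)
    also have "\<theta> * (rcus m 0 x t + m * x t - m\<^sup>2 / 2) = \<theta> * rcus m 0 x t + (\<theta> * m * x t + - \<theta> * m\<^sup>2 / 2)"
      by (simp add: field_simps)
    finally show "ennreal (exp (\<theta> * rcus m 0 x (Suc t))) \<le> 1 + ennreal (exp (\<theta> * rcus m 0 x t)) * ennreal (?Y x)"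
      unfolding ennreal_1[symmetric]
      by (subst ennreal_mult'[symmetric], simp, subst ennreal_plus[symmetric], simp, simp)
         (intro ennreal_leI, simp add: exp_add)
  qed
  also have "\<dots> = 1 + (\<integral>\<^sup>+x. ennreal (exp (\<theta> * rcus m 0 x t)) * ennreal (?Y x) \<partial>stream)"
    by (subst nn_integral_add) (auto simp: emeasure_space_1)
  also have "(\<integral>\<^sup>+x. ennreal (exp (\<theta> * rcus m 0 x t)) * ennreal (?Y x) \<partial>stream)
      = (\<integral>\<^sup>+x. ennreal (exp (\<theta> * rcus m 0 x t)) \<partial>stream) * (\<integral>\<^sup>+x. ennreal (?Y x) \<partial>stream)"
  proof (rule nn_integral_PiM_indep2[OF prob_space_stdn, where K="{..<t}" and K'="{t}"])
    fix \<omega> :: "nat \<Rightarrow> real"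
    show "ennreal (exp (\<theta> * rcus m 0 (restrict \<omega> {..<t}) t)) = ennreal (exp (\<theta> * rcus m 0 \<omega> t))"
      by (subst rcus_cong[of t "restrict \<omega> {..<t}" \<omega>]) auto
  qed auto
  also have "(\<integral>\<^sup>+x. ennreal (?Y x) \<partial>stream) = ennreal q"
  proof -
    have "(\<theta> * m)\<^sup>2 / 2 + - \<theta> * m\<^sup>2 / 2 = - (\<theta> - \<theta>\<^sup>2) * m\<^sup>2 / 2"
      by (simp add: power2_eq_square field_simps)
    then show ?thesis
      using nn_integral_coord_exp[of "{t}" UNIV "\<theta> * m" "- \<theta> * m\<^sup>2 / 2"] by (simp add: q_def)
  qed
  also have "1 + (\<integral>\<^sup>+x. ennreal (exp (\<theta> * rcus m 0 x t)) \<partial>stream) * ennreal q \<le> 1 + ennreal (cusum_bound m \<theta>) * ennreal q"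
    using Suc.IH by (intro add_left_mono mult_right_mono) auto
  also have "\<dots> = ennreal (1 + cusum_bound m \<theta> * q)"
    using q cusum_bound_ge_1[OF assms] by (simp add: ennreal_mult'')
  also have "1 + cusum_bound m \<theta> * q = cusum_bound m \<theta>"
    using q unfolding cusum_bound_def q_def[symmetric] by (simp add: divide_simps)
  finally show ?case .
qed

lemma integrable_exp_rcus:
  assumes "0 < \<theta>" "\<theta> < 1" "m \<noteq> 0"
  shows "integrable stream (\<lambda>x. exp (\<theta> * rcus m 0 x t))"
    and "(\<integral>x. exp (\<theta> * rcus m 0 x t) \<partial>stream) \<le> cusum_bound m \<theta>"
proof -
  show i: "integrable stream (\<lambda>x. exp (\<theta> * rcus m 0 x t))"
    using cusum_exp_moment[OF assms, of t]
    by (intro integrableI_bounded) (auto simp: order_le_less_trans)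
  have "ennreal (\<integral>x. exp (\<theta> * rcus m 0 x t) \<partial>stream) \<le> ennreal (cusum_bound m \<theta>)"
    using cusum_exp_moment[OF assms, of t] by (subst nn_integral_eq_integral[symmetric, OF i]) auto
  then show "(\<integral>x. exp (\<theta> * rcus m 0 x t) \<partial>stream) \<le> cusum_bound m \<theta>"
    using cusum_bound_ge_1[OF assms] by (subst (asm) ennreal_le_iff) auto
qed

section \<open>The limiting moment \<xi> and the rate at which it is approached\<close>

definition xi_at :: "real \<Rightarrow> nat \<Rightarrow> real" where
  "xi_at m t = (\<integral>x. exp (rcus m 0 x t / 2) \<partial>stream)"

definition xi :: "real \<Rightarrow> real" where
  "xi m = lim (xi_at m)"

context
  fixes m :: real
  assumes m: "0 < m"
begin

lemma integrable_exp_half_rcus: "integrable stream (\<lambda>x. exp (rcus m 0 x t / 2))"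
  using integrable_exp_rcus(1)[of "1/2" m t] m by simp

lemma xi_at_shift: "xi_at m t = (\<integral>x. exp (rcus m 0 (\<lambda>i. x (a + i)) t / 2) \<partial>stream)"
  unfolding xi_at_def
  by (subst (1 2) integral_eq_nn_integral)
     (auto intro!: nn_integral_stream_shift[symmetric, of "\<lambda>x. ennreal (exp (rcus m 0 x t / 2))", THEN arg_cong[of _ _ enn2real]])

text \<open>A run of t + 1 steps is compared with the run that ignores the first observation; by
  stationarity the latter has moment \<open>xi_at m t\<close>. It is pointwise smaller, and the
  Lipschitz bound \<open>exp_rcus_diff_le\<close> limits the difference by a product of t + 1
  independent factors.\<close>

lemma xi_at_step: "xi_at m t \<le> xi_at m (Suc t)" "xi_at m (Suc t) \<le> xi_at m t + exp (- m\<^sup>2 / 8) ^ Suc t"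
proof -
  let ?p = "\<lambda>x::nat \<Rightarrow> real. \<Prod>i<Suc t. exp (m / 2 * x i + - m\<^sup>2 / 4)"
  have i1: "integrable stream (\<lambda>x. exp (rcus m 0 (\<lambda>i. x (1 + i)) t / 2))"
    using integrable_exp_half_rcus[of t]
    by (subst integrable_iff_bounded)
       (auto simp: integrable_iff_bounded nn_integral_stream_shift[of "\<lambda>x. ennreal (exp (rcus m 0 x t / 2))" 1, simplified])
  have i2: "integrable stream ?p"
    using nn_integral_prod_exp_stream[of "{..<Suc t}" m]
    by (intro integrableI_bounded) (auto simp: abs_of_nonneg prod_nonneg simp del: prod.lessThan_Suc)
  have pint: "(\<integral>x. ?p x \<partial>stream) = exp (- m\<^sup>2 / 8) ^ Suc t"
    using nn_integral_prod_exp_stream[of "{..<Suc t}" m]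
    by (subst integral_eq_nn_integral) (auto simp: prod_nonneg simp del: prod.lessThan_Suc power_Suc)
  have dec: "rcus m 0 x (Suc t) = rcus m (rcus m 0 x 1) (\<lambda>i. x (1 + i)) t" for x
    using rcus_add[of m 0 x 1 t] by simp
  have low: "rcus m 0 (\<lambda>i. x (1 + i)) t \<le> rcus m 0 x (Suc t)" for x
    using rcus_restart_le[of m x 1 t] m by simp
  show "xi_at m t \<le> xi_at m (Suc t)"
    unfolding xi_at_shift[of t 1] unfolding xi_at_def
    by (intro integral_mono i1 integrable_exp_half_rcus) (use low in auto)
  have up: "exp (rcus m 0 x (Suc t) / 2) \<le> exp (rcus m 0 (\<lambda>i. x (1 + i)) t / 2) + ?p x" for x
  proof -
    let ?z = "rcus m 0 x 1"
    have "exp (?z / 2) = max (exp (m / 2 * x 0 + - m\<^sup>2 / 4)) 1"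
      by (auto simp: max_def field_simps)
    then have "exp (?z / 2) - exp (0 / 2) \<le> exp (m / 2 * x 0 + - m\<^sup>2 / 4)"
      by (auto simp: max_def)
    then have "(exp (?z / 2) - exp (0 / 2)) * (\<Prod>i<t. exp (m / 2 * x (1 + i) + - m\<^sup>2 / 4))
        \<le> exp (m / 2 * x 0 + - m\<^sup>2 / 4) * (\<Prod>i<t. exp (m / 2 * x (1 + i) + - m\<^sup>2 / 4))"
      by (intro mult_right_mono) (auto intro: prod_nonneg)
    also have "\<dots> = ?p x" by (subst prod.lessThan_Suc_shift) simp
    finally show ?thesis
      using exp_rcus_diff_le[of 0 ?z m "\<lambda>i. x (1 + i)" t] by (simp only: dec) (simp add: rcus_nonneg)
  qed
  have "xi_at m (Suc t) \<le> (\<integral>x. exp (rcus m 0 (\<lambda>i. x (1 + i)) t / 2) + ?p x \<partial>stream)"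
    unfolding xi_at_def
    by (intro integral_mono integrable_exp_half_rcus Bochner_Integration.integrable_add i1 i2 up)
  also have "\<dots> = xi_at m t + exp (- m\<^sup>2 / 8) ^ Suc t"
    by (subst Bochner_Integration.integral_add[OF i1 i2]) (simp only: pint xi_at_shift[of t 1])
  finally show "xi_at m (Suc t) \<le> xi_at m t + exp (- m\<^sup>2 / 8) ^ Suc t" .
qed

lemma incseq_xi_at: "incseq (xi_at m)"
  by (intro incseq_SucI xi_at_step)

lemma xi_at_LIMSEQ: "xi_at m \<longlonglongrightarrow> xi m"
proof -
  have "xi_at m t \<le> cusum_bound m (1/2)" for t
    using integrable_exp_rcus(2)[of "1/2" m t] m by (simp add: xi_at_def)
  then show ?thesis
    unfolding xi_def using incseq_convergent[OF incseq_xi_at, of "cusum_bound m (1/2)"]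
    by (metis convergentI convergent_LIMSEQ_iff)
qed

lemma xi_at_le_xi: "xi_at m t \<le> xi m"
  by (rule incseq_le[OF incseq_xi_at xi_at_LIMSEQ])

lemma xi_at_ge_1: "1 \<le> xi_at m t"
proof -
  interpret prob_space stream by (rule prob_space_stream)
  have "xi_at m 0 = 1" by (simp add: xi_at_def prob_space)
  then show ?thesis using incseqD[OF incseq_xi_at, of 0 t] by simp
qed

lemma xi_ge_1: "1 \<le> xi m"
  using xi_at_ge_1[of 0] xi_at_le_xi[of 0] by simp

lemma exp_rate_less_1: "exp (- m\<^sup>2 / 8) < 1"
  using m by (subst exp_less_one_iff) simp

text \<open>The increments of \<open>xi_at\<close> are summed as a geometric series. This rate
  dictates how many observations a restarted score needs, and thereby the constant in K_N.\<close>

lemma xi_le_xi_at: "xi m \<le> xi_at m t + exp (- m\<^sup>2 / 8) ^ t / (1 - exp (- m\<^sup>2 / 8))"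
proof (rule LIMSEQ_le_const2[OF xi_at_LIMSEQ], intro exI allI impI)
  fix n assume "t \<le> n"
  define r where "r = exp (- m\<^sup>2 / 8)"
  have r: "0 < r" "r < 1" using exp_rate_less_1 by (auto simp: r_def)
  have "xi_at m (t + j) \<le> xi_at m t + r ^ t * (r * (\<Sum>i<j. r ^ i))" for j
  proof (induction j)
    case (Suc j)
    have "xi_at m (t + Suc j) \<le> xi_at m (t + j) + r ^ Suc (t + j)"
      using xi_at_step(2)[of "t + j"] by (simp add: r_def)
    with Suc show ?case by (simp add: algebra_simps power_add)
  qed simp
  from this[of "n - t"] \<open>t \<le> n\<close> have "xi_at m n \<le> xi_at m t + r ^ t * (r * (\<Sum>i<n - t. r ^ i))" by simp
  also have "r ^ t * (r * (\<Sum>i<n - t. r ^ i)) \<le> r ^ t * (1 / (1 - r))"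
  proof (rule mult_left_mono)
    have "(\<Sum>i<n - t. r ^ i) \<le> 1 / (1 - r)"
      using r by (subst sum_gp_strict) (auto simp: divide_simps)
    then have "r * (\<Sum>i<n - t. r ^ i) \<le> 1 * (1 / (1 - r))"
      using r by (intro mult_mono) (auto intro: sum_nonneg)
    then show "r * (\<Sum>i<n - t. r ^ i) \<le> 1 / (1 - r)" by simp
  qed (use r in simp)
  finally show "xi_at m n \<le> xi_at m t + exp (- m\<^sup>2 / 8) ^ t / (1 - exp (- m\<^sup>2 / 8))"
    using r unfolding r_def[symmetric] by (simp add: mult_left_mono)
qed

text \<open>Markov's inequality for the product in \<open>rcus_neq_imp\<close>: the half-exponential
  moment of the score at time a is bounded, and the next L increments contribute an independent,
  exponentially small factor. So a score is determined by its last L observations up to this error,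
  uniformly in a.\<close>

lemma prob_restart_neq:
  "measure stream {x \<in> space stream. rcus m 0 x (a + L) \<noteq> rcus m 0 (\<lambda>i. x (a + i)) L}
   \<le> cusum_bound m (1/2) * exp (- m\<^sup>2 / 8) ^ L"
proof -
  interpret prob_space stream by (rule prob_space_stream)
  let ?p = "\<lambda>x::nat \<Rightarrow> real. \<Prod>i\<in>{a..<a + L}. exp (m / 2 * x i + - m\<^sup>2 / 4)"
  let ?A = "{x \<in> space stream. rcus m 0 x (a + L) \<noteq> rcus m 0 (\<lambda>i. x (a + i)) L}"
  have "ennreal (prob ?A) = (\<integral>\<^sup>+x. indicator ?A x \<partial>stream)"
    by (subst nn_integral_indicator) (unfold neq_iff, measurable, simp add: emeasure_eq_measure)
  also have "\<dots> \<le> (\<integral>\<^sup>+x. ennreal (exp (1/2 * rcus m 0 x a)) * ennreal (?p x) \<partial>stream)"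
  proof (intro nn_integral_mono)
    fix x
    have "1 \<le> ennreal (exp (1/2 * rcus m 0 x a)) * ennreal (?p x)" if "x \<in> ?A"
    proof -
      have "1 \<le> exp (rcus m 0 x a / 2) * (\<Prod>i<L. exp (m / 2 * x (a + i) + - m\<^sup>2 / 4))"
        using that by (intro rcus_neq_imp[of _ 0]) (auto simp: rcus_add rcus_nonneg)
      also have "(\<Prod>i<L. exp (m / 2 * x (a + i) + - m\<^sup>2 / 4)) = ?p x"
        using prod.shift_bounds_nat_ivl[of "\<lambda>i. exp (m / 2 * x i + - m\<^sup>2 / 4)" 0 a L]
        by (simp add: atLeast0LessThan add.commute)
      finally have "ennreal 1 \<le> ennreal (exp (1/2 * rcus m 0 x a) * ?p x)" by (intro ennreal_leI) simp
      then show ?thesis by (simp add: ennreal_mult')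
    qed
    then show "indicator ?A x \<le> ennreal (exp (1/2 * rcus m 0 x a)) * ennreal (?p x)"
      by (cases "x \<in> ?A") (auto simp: indicator_def)
  qed
  also have "\<dots> = (\<integral>\<^sup>+x. ennreal (exp (1/2 * rcus m 0 x a)) \<partial>stream) * (\<integral>\<^sup>+x. ennreal (?p x) \<partial>stream)"
  proof (rule nn_integral_PiM_indep2[OF prob_space_stdn, where K="{..<a}" and K'="{a..<a+L}"])
    fix \<omega> :: "nat \<Rightarrow> real"
    show "ennreal (exp (1/2 * rcus m 0 (restrict \<omega> {..<a}) a)) = ennreal (exp (1/2 * rcus m 0 \<omega> a))"
      by (subst rcus_cong[of a "restrict \<omega> {..<a}" \<omega>]) auto
  qed (auto intro!: prod.cong arg_cong[where f=ennreal])
  also have "\<dots> \<le> ennreal (cusum_bound m (1/2)) * ennreal (exp (- m\<^sup>2 / 8) ^ L)"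
    using cusum_exp_moment[of "1/2" m a] m nn_integral_prod_exp_stream[of "{a..<a+L}" m]
    by (intro mult_mono) auto
  finally show ?thesis
    using cusum_bound_ge_1[of "1/2" m] m by (simp add: ennreal_mult'[symmetric])
qed


end

section \<open>Mean weights of a stream, without and with a change\<close>

text \<open>The function \<open>exp (- g\<^sub>M)\<close>.\<close>

definition weight :: "real \<Rightarrow> real \<Rightarrow> real \<Rightarrow> real" where
  "weight lam p0 R = 1 / (1 + p0 * (lam * exp (R / 2) - 1))"

lemma weight_denominator_pos:
  fixes lam p0 R :: real
  assumes "0 < lam" "0 < p0" "p0 \<le> 1"
  shows "0 < 1 + p0 * (lam * exp (R / 2) - 1)"
proof -
  have "0 < p0 * (lam * exp (R / 2))" using assms by simp
  then show ?thesis using assms unfolding right_diff_distrib mult_1_right by linarith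
qed

lemma weight_bounds:
  assumes "0 < lam" "0 < p0" "p0 \<le> 1/2"
  shows "0 \<le> weight lam p0 R" "weight lam p0 R \<le> 2"
proof -
  have "0 < p0 * (lam * exp (R / 2))" using assms by simp
  then have "1/2 \<le> 1 + p0 * (lam * exp (R / 2) - 1)"
    using assms unfolding right_diff_distrib mult_1_right by linarith
  then show "0 \<le> weight lam p0 R" "weight lam p0 R \<le> 2" by (auto simp: weight_def divide_simps)
qed

lemma measurable_weight [measurable]: "weight lam p0 \<in> borel_measurable borel"
  unfolding weight_def by measurable

text \<open>With y = p0 (lam exp (R / 2) - 1) the remainder of 1 / (1 + y) after the linear term is
  y^2 / (1 + y). It is at most 2 w^2 for small w = p0 (lam + 1) exp (R / 2) and at most w otherwise,
  hence in both cases at most 2 w^(2 \<theta>) because 1 < 2 \<theta> < 2. The power is lowered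
  since only exp (\<theta> R) with \<theta> < 1 has a bound uniform in time.\<close>

lemma weight_upper:
  assumes lam: "0 < lam" and p0: "0 < p0" "p0 \<le> 1/2" and \<theta>: "1/2 < \<theta>" "\<theta> < 1" and R: "0 \<le> R"
  shows "weight lam p0 R \<le> 1 - p0 * (lam * exp (R / 2) - 1) + 2 * (p0 * (lam + 1)) powr (2 * \<theta>) * exp (\<theta> * R)"
proof -
  define y where "y = p0 * (lam * exp (R / 2) - 1)"
  define w where "w = p0 * (lam + 1) * exp (R / 2)"
  have "0 < p0 * (lam * exp (R / 2))" using assms by simp
  then have y: "- 1/2 \<le> y" "- p0 \<le> y"
    using p0 unfolding y_def right_diff_distrib mult_1_right by linarith+
  have "1 \<le> exp (R / 2)" using R by simp
  then have "p0 * 1 \<le> p0 * exp (R / 2)" using p0 by (intro mult_left_mono) auto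
  then have "p0 \<le> w" using lam p0 by (simp add: w_def algebra_simps add_increasing2)
  moreover have "y \<le> w" using p0 by (simp add: y_def w_def algebra_simps add_increasing)
  ultimately have yw: "\<bar>y\<bar> \<le> w" using y by auto
  have w: "0 < w" using lam p0 by (simp add: w_def)
  have wpow: "w powr (2 * \<theta>) = (p0 * (lam + 1)) powr (2 * \<theta>) * exp (\<theta> * R)"
    using lam p0 by (simp add: w_def powr_mult) (simp add: powr_def)
  have "y\<^sup>2 / (1 + y) \<le> 2 * w powr (2 * \<theta>)"
  proof (cases "w \<le> 1")
    case True
    have "y\<^sup>2 / (1 + y) \<le> w\<^sup>2 / (1/2)"
      using y yw by (intro frac_le) (auto simp: abs_le_square_iff[symmetric])
    also have "\<dots> = 2 * w powr 2" using w by simp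
    also have "\<dots> \<le> 2 * w powr (2 * \<theta>)" using \<theta> w True by (intro mult_left_mono powr_mono') auto
    finally show ?thesis .
  next
    case False
    have "y\<^sup>2 / (1 + y) \<le> w"
    proof (cases "0 \<le> y")
      case True
      then have "y\<^sup>2 / (1 + y) \<le> y" by (simp add: divide_simps power2_eq_square algebra_simps)
      then show ?thesis using yw by auto
    next
      case neg: False
      have "y\<^sup>2 / (1 + y) \<le> (1/2)\<^sup>2 / (1/2)"
        using y neg by (intro frac_le) (auto simp: abs_le_square_iff[symmetric] simp del: power_divide)
      moreover have "(1/2)\<^sup>2 / (1/2) = (1/2 :: real)" by (simp add: power2_eq_square)
      ultimately show ?thesis using False by linarith
    qed
    also have "w = w powr 1" using w by simp
    also have "\<dots> \<le> w powr (2 * \<theta>)" using \<theta> False by (intro powr_mono) auto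
    finally show ?thesis using powr_ge_zero[of w "2 * \<theta>"] by linarith
  qed
  moreover have "1 / (1 + y) = 1 - y + y\<^sup>2 / (1 + y)"
    using y by (simp add: field_simps power2_eq_square)
  ultimately show ?thesis
    unfolding weight_def y_def[symmetric] wpow by simp
qed

text \<open>The tangent at 0 of the convex function y \<mapsto> 1 / (1 + y).\<close>

lemma weight_lower:
  assumes "0 < lam" "0 < p0" "p0 \<le> 1"
  shows "1 - p0 * (lam * exp (R / 2) - 1) \<le> weight lam p0 R"
proof -
  define y where "y = p0 * (lam * exp (R / 2) - 1)"
  have "0 < 1 + y" using weight_denominator_pos[OF assms, of R] by (simp add: y_def)
  have "(1 - y) * (1 + y) \<le> 1" by (simp add: algebra_simps)
  then show ?thesis unfolding weight_def y_def[symmetric] using \<open>0 < 1 + y\<close> by (simp add: pos_le_divide_eq)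
qed

lemma integrable_weight_rcus:
  assumes [measurable]: "\<And>i. (\<lambda>\<omega>. x \<omega> i) \<in> borel_measurable M" and "prob_space M"
    and "0 < lam" "0 < p0" "p0 \<le> 1/2"
  shows "integrable M (\<lambda>\<omega>. weight lam p0 (rcus m 0 (x \<omega>) t))"
proof -
  interpret prob_space M by fact
  show ?thesis
    by (rule integrable_const_bound[where B=2]) (use weight_bounds assms in auto)
qed

lemma null_weight_upper:
  assumes "0 < m" "0 < lam" "0 < p0" "p0 \<le> 1/2" "1/2 < \<theta>" "\<theta> < 1"
  shows "(\<integral>x. weight lam p0 (rcus m 0 x t) \<partial>stream)
         \<le> 1 - p0 * (lam * xi_at m t - 1) + 2 * (p0 * (lam + 1)) powr (2 * \<theta>) * cusum_bound m \<theta>"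
proof -
  interpret prob_space stream by (rule prob_space_stream)
  have i1: "integrable stream (\<lambda>x. exp (rcus m 0 x t / 2))" using assms by (intro integrable_exp_half_rcus)
  have i2: "integrable stream (\<lambda>x. exp (\<theta> * rcus m 0 x t))" using assms by (intro integrable_exp_rcus) auto
  have "(\<integral>x. weight lam p0 (rcus m 0 x t) \<partial>stream) \<le> (\<integral>x. 1 - p0 * (lam * exp (rcus m 0 x t / 2) - 1)
        + 2 * (p0 * (lam + 1)) powr (2 * \<theta>) * exp (\<theta> * rcus m 0 x t) \<partial>stream)"
    by (intro integral_mono integrable_weight_rcus weight_upper prob_space_stream)
       (use assms i1 i2 in \<open>auto simp: rcus_nonneg\<close>)
  also have "\<dots> = 1 - p0 * (lam * xi_at m t - 1) + 2 * (p0 * (lam + 1)) powr (2 * \<theta>) * (\<integral>x. exp (\<theta> * rcus m 0 x t) \<partial>stream)"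
    using i1 i2 by (simp add: prob_space xi_at_def)
  also have "\<dots> \<le> 1 - p0 * (lam * xi_at m t - 1) + 2 * (p0 * (lam + 1)) powr (2 * \<theta>) * cusum_bound m \<theta>"
    using assms by (intro add_left_mono mult_left_mono integrable_exp_rcus) auto
  finally show ?thesis .
qed

text \<open>A crude bound, uniform in t, is enough: it enters only through the difference between
  changed and null weights, which is multiplied by the small probability \<open>p\<close>.\<close>

lemma null_weight_lower:
  assumes "0 < m" "0 < lam" "0 < p0" "p0 \<le> 1/2"
  shows "1 - p0 * lam * xi m \<le> (\<integral>x. weight lam p0 (rcus m 0 x t) \<partial>stream)"
proof -
  interpret prob_space stream by (rule prob_space_stream)
  have i1: "integrable stream (\<lambda>x. exp (rcus m 0 x t / 2))" using assms by (intro integrable_exp_half_rcus)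
  have "1 - p0 * lam * xi m \<le> 1 - p0 * (lam * xi_at m t - 1)"
  proof -
    have "p0 * (lam * xi_at m t) \<le> p0 * (lam * xi m)" using assms by (intro mult_left_mono xi_at_le_xi) auto
    then show ?thesis using assms unfolding right_diff_distrib mult_1_right mult.assoc by linarith
  qed
  also have "\<dots> = (\<integral>x. 1 - p0 * (lam * exp (rcus m 0 x t / 2) - 1) \<partial>stream)"
    using i1 by (simp add: prob_space xi_at_def)
  also have "\<dots> \<le> (\<integral>x. weight lam p0 (rcus m 0 x t) \<partial>stream)"
    by (intro integral_mono integrable_weight_rcus weight_lower prob_space_stream) (use assms i1 in auto)
  finally show ?thesis .
qed

text \<open>The level \<open>d\<close> is free. If the last k observations carry the score to
  \<open>d\<close>, the weight falls from at most 1 / (1 - p0) to at most 1 / (1 - p0 + v), a saving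
  of at least v / (1 + v). Here \<open>a\<close> is the distance of \<open>d\<close> from the drift
  of the k post-change steps in standard deviations, so the probability of this event comes from
  \<open>prob_sum_coord_ge\<close>.\<close>

lemma changed_weight_upper:
  fixes h k :: nat and a d v m lam p0 \<mu> :: real
  assumes m: "0 < m" and lam: "0 < lam" and p0: "0 < p0" "p0 \<le> 1/2" and k: "1 \<le> k"
    and a: "a = (d + k * m\<^sup>2 / 2 - k * m * \<mu>) / (m * sqrt k)"
    and v: "v = p0 * (lam * exp (d / 2))"
  shows "(\<integral>x. weight lam p0 (rcus m 0 (\<lambda>i. x i + (if h \<le> i then \<mu> else 0)) (h + k)) \<partial>stream)
         \<le> 1 + 2 * p0 - exp (- (max a 0 + 1)\<^sup>2 / 2) / sqrt (2 * pi) * (v / (1 + v))"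
proof -
  interpret prob_space stream by (rule prob_space_stream)
  let ?R = "\<lambda>x. rcus m 0 (\<lambda>i. x i + (if h \<le> i then \<mu> else 0)) (h + k)"
  let ?E = "{x \<in> space stream. a * sqrt (card {h..<h+k}) \<le> (\<Sum>i\<in>{h..<h+k}. x i)}"
  have v0: "0 < v" using lam p0 by (simp add: v)
  have E: "?E \<in> sets stream" by measurable
  have pt: "weight lam p0 (?R x) \<le> 1 + 2 * p0 - (v / (1 + v)) * indicator ?E x" for x
  proof -
    have "0 < p0 * (lam * exp (?R x / 2))" using lam p0 by simp
    then have "weight lam p0 (?R x) \<le> 1 / (1 - p0)"
      unfolding weight_def using p0 by (intro divide_left_mono mult_pos_pos) (unfold right_diff_distrib mult_1_right, linarith+)
    also have one: "1 / (1 - p0) \<le> 1 + 2 * p0"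
    proof -
      have "0 \<le> p0 * (1 - 2 * p0)" using p0 by simp
      then show ?thesis using p0 by (simp add: divide_simps algebra_simps)
    qed
    finally have base: "weight lam p0 (?R x) \<le> 1 + 2 * p0" .
    have "weight lam p0 (?R x) \<le> 1 + 2 * p0 - v / (1 + v)" if "x \<in> ?E"
    proof -
      have "a * sqrt k = (d + k * m\<^sup>2 / 2 - k * m * \<mu>) / m" using a k m by simp
      then have "(d + k * m\<^sup>2 / 2 - k * m * \<mu>) / m \<le> (\<Sum>i\<in>{h..<h+k}. x i)" using that by simp
      then have "d + k * m\<^sup>2 / 2 - k * m * \<mu> \<le> m * (\<Sum>i\<in>{h..<h+k}. x i)"
        using m by (simp add: pos_divide_le_eq mult.commute)
      moreover have "(\<Sum>i\<in>{h..<h+k}. m * (x i + (if h \<le> i then \<mu> else 0)) - m\<^sup>2 / 2)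
          = m * (\<Sum>i\<in>{h..<h+k}. x i) + k * (m * \<mu> - m\<^sup>2 / 2)"
      proof -
        have "(\<Sum>i\<in>{h..<h+k}. m * (x i + (if h \<le> i then \<mu> else 0)) - m\<^sup>2 / 2)
            = (\<Sum>i\<in>{h..<h+k}. m * x i + (m * \<mu> - m\<^sup>2 / 2))"
          by (intro sum.cong) (auto simp: algebra_simps)
        then show ?thesis by (simp add: sum.distrib sum_distrib_left)
      qed
      ultimately have "d \<le> (\<Sum>i\<in>{h..<h+k}. m * (x i + (if h \<le> i then \<mu> else 0)) - m\<^sup>2 / 2)"
        by (simp add: algebra_simps)
      also have "\<dots> \<le> ?R x" using m by (intro rcus_ge_sum) auto
      finally have "d \<le> ?R x" .
      then have "v \<le> p0 * (lam * exp (?R x / 2))" unfolding v using lam p0 by (intro mult_left_mono) auto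
      then have "weight lam p0 (?R x) \<le> 1 / (1 - p0 + v)"
        unfolding weight_def using p0 v0 by (intro divide_left_mono mult_pos_pos) (unfold right_diff_distrib mult_1_right, linarith+)
      also have "\<dots> = 1 / (1 - p0) - v / ((1 - p0) * (1 - p0 + v))"
        using p0 v0 by (simp add: divide_simps)
      also have "\<dots> \<le> 1 / (1 - p0) - v / (1 + v)"
      proof -
        have "(1 - p0) * (1 - p0 + v) \<le> 1 * (1 + v)" using p0 v0 by (intro mult_mono) auto
        then have "v / (1 + v) \<le> v / ((1 - p0) * (1 - p0 + v))"
          using p0 v0 by (intro divide_left_mono mult_pos_pos) auto
        then show ?thesis by simp
      qed
      finally show ?thesis using one by simp
    qed
    with base show ?thesis by (auto simp: indicator_def)
  qed
  have "(\<integral>x. weight lam p0 (?R x) \<partial>stream) \<le> (\<integral>x. 1 + 2 * p0 - (v / (1 + v)) * indicator ?E x \<partial>stream)"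
    by (intro integral_mono integrable_weight_rcus prob_space_stream pt)
       (use lam p0 E in \<open>auto intro!: Bochner_Integration.integrable_diff integrable_mult_right integrable_real_indicator simp: emeasure_eq_measure\<close>)
  also have "\<dots> = 1 + 2 * p0 - (v / (1 + v)) * prob ?E"
    using E by (subst Bochner_Integration.integral_diff) (auto simp: prob_space emeasure_eq_measure)
  also have "\<dots> \<le> 1 + 2 * p0 - (v / (1 + v)) * (exp (- (max a 0 + 1)\<^sup>2 / 2) / sqrt (2 * pi))"
    using v0 k by (intro diff_left_mono mult_left_mono prob_sum_coord_ge) auto
  finally show ?thesis by (simp add: mult.commute)
qed

section \<open>The multi-stream model\<close>

lemma prob_space_P_inf: "prob_space (P_inf N)"
  unfolding P_inf_def by (intro prob_space_PiM prob_space_stdn)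

lemma nn_integral_P_inf_stream:
  assumes "n \<in> {1..N}" "f \<in> borel_measurable stream"
  shows "(\<integral>\<^sup>+\<omega>. f (\<lambda>i. \<omega> (n, s + Suc i)) \<partial>P_inf N) = (\<integral>\<^sup>+x. f x \<partial>stream)"
  unfolding P_inf_def
  using nn_integral_PiM_reindex[OF prob_space_stdn, of "\<lambda>i. (n, s + Suc i)" UNIV "obs_index N" f] assms
  by (simp add: restrict_UNIV obs_index_def inj_on_def Pi_def)

text \<open>Coupling of the changed model with the null model: the same noise with means added. For
  \<mu> \<ge> 0 it is pointwise above the null array, which makes monotonicity arguments
  available.\<close>

definition add_mean :: "real \<Rightarrow> nat \<Rightarrow> nat set \<Rightarrow> (nat \<times> nat \<Rightarrow> real) \<Rightarrow> nat \<times> nat \<Rightarrow> real" where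
  "add_mean \<mu> \<nu> A \<omega> = (\<lambda>(n, t). \<omega> (n, t) + obs_mean \<mu> \<nu> A n t)"

lemma measurable_add_mean [measurable]:
  "(\<lambda>\<omega>. add_mean \<mu> \<nu> A \<omega> i) \<in> borel_measurable (PiM K (\<lambda>_. stdn))"
  unfolding add_mean_def by (cases i) simp

lemma sets_P_given: "sets (P_given N \<mu> \<nu> A) = sets (P_inf N)"
  unfolding P_given_def P_inf_def by (intro sets_PiM_cong) (auto split: prod.splits)

text \<open>Both measures are determined by finite-dimensional boxes, where the claim is
  \<open>stdn_shift\<close> in each coordinate. The \<open>restrict\<close> is there because adding
  a mean to the \<open>undefined\<close> values outside the index set could leave the product
  space.\<close>

lemma P_given_eq_distr:
  "P_given N \<mu> \<nu> A = distr (P_inf N) (P_inf N) (\<lambda>\<omega>. restrict (add_mean \<mu> \<nu> A \<omega>) (obs_index N))"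
proof -
  let ?D = "\<lambda>(n, t). density lborel (normal_density (obs_mean \<mu> \<nu> A n t) 1) :: real measure"
  let ?I = "obs_index N"
  have pD: "prob_space (?D i)" for i
    by (cases i) (auto intro: prob_space_normal_density)
  interpret PS: prob_space "?D i" for i by (rule pD)
  interpret product_prob_space ?D ?I by unfold_locales
  have meas: "(\<lambda>\<omega>. restrict (add_mean \<mu> \<nu> A \<omega>) ?I) \<in> PiM ?I (\<lambda>_. stdn) \<rightarrow>\<^sub>M PiM ?I (\<lambda>_. stdn)"
    by (intro measurable_restrict) simp
  have "distr (P_inf N) (P_inf N) (\<lambda>\<omega>. restrict (add_mean \<mu> \<nu> A \<omega>) ?I) = PiM ?I ?D"
  proof (rule PiM_eq)
    show "sets (distr (P_inf N) (P_inf N) (\<lambda>\<omega>. restrict (add_mean \<mu> \<nu> A \<omega>) ?I)) = sets (PiM ?I ?D)"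
      using sets_P_given[of N \<mu> \<nu> A] by (simp add: P_given_def)
  next
    fix J F assume J: "finite J" "J \<subseteq> ?I" and F: "\<And>j. j \<in> J \<Longrightarrow> F j \<in> sets (?D j)"
    have Fb: "F j \<in> sets borel" if "j \<in> J" for j using F[OF that] by (cases j) auto
    define F' where "F' j = (\<lambda>x. x + obs_mean \<mu> \<nu> A (fst j) (snd j)) -` F j" for j
    have F': "F' j \<in> sets borel" if "j \<in> J" for j
      unfolding F'_def using Fb[OF that] by (intro measurable_sets_borel) auto
    have emb: "prod_emb ?I ?D J (PiE J F) \<in> sets (PiM ?I (\<lambda>_. stdn))"
    proof -
      have "prod_emb ?I ?D J (PiE J F) = prod_emb ?I (\<lambda>_. stdn) J (PiE J F)"
        by (auto simp: prod_emb_def split: prod.splits)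
      also have "\<dots> \<in> sets (PiM ?I (\<lambda>_. stdn))" using J Fb by (intro sets_PiM_I) auto
      finally show ?thesis .
    qed
    have "emeasure (distr (P_inf N) (P_inf N) (\<lambda>\<omega>. restrict (add_mean \<mu> \<nu> A \<omega>) ?I)) (prod_emb ?I ?D J (PiE J F))
        = emeasure (PiM ?I (\<lambda>_. stdn)) ((\<lambda>\<omega>. restrict (add_mean \<mu> \<nu> A \<omega>) ?I) -` prod_emb ?I ?D J (PiE J F) \<inter> space (PiM ?I (\<lambda>_. stdn)))"
      unfolding P_inf_def by (intro emeasure_distr meas emb)
    also have "(\<lambda>\<omega>. restrict (add_mean \<mu> \<nu> A \<omega>) ?I) -` prod_emb ?I ?D J (PiE J F) \<inter> space (PiM ?I (\<lambda>_. stdn))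
        = prod_emb ?I (\<lambda>_. stdn) J (PiE J F')"
      using J by (auto simp: prod_emb_def F'_def add_mean_def space_PiM PiE_iff split: prod.splits; fastforce)
    also have "emeasure (PiM ?I (\<lambda>_. stdn)) \<dots> = (\<Prod>j\<in>J. emeasure stdn (F' j))"
      using J F' by (intro Infinite_Product_Measure.emeasure_PiM_emb prob_space_stdn) auto
    also have "\<dots> = (\<Prod>j\<in>J. emeasure (?D j) (F j))"
    proof (intro prod.cong refl)
      fix j assume j: "j \<in> J"
      obtain n t where jnt: "j = (n, t)" by (cases j)
      have "emeasure (?D j) (F j) = emeasure (distr stdn borel (\<lambda>x. x + obs_mean \<mu> \<nu> A n t)) (F j)"
        by (simp add: jnt stdn_shift)
      also have "\<dots> = emeasure stdn (F' j)"
        using Fb[OF j] by (subst emeasure_distr) (auto simp: F'_def jnt)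
      finally show "emeasure stdn (F' j) = emeasure (?D j) (F j)" ..
    qed
    finally show "emeasure (distr (P_inf N) (P_inf N) (\<lambda>\<omega>. restrict (add_mean \<mu> \<nu> A \<omega>) ?I)) (prod_emb ?I ?D J (PiE J F))
        = (\<Prod>j\<in>J. emeasure (?D j) (F j))" .
  qed
  then show ?thesis by (simp add: P_given_def)
qed

lemma prob_space_P_given: "prob_space (P_given N \<mu> \<nu> A)"
  unfolding P_given_def by (intro prob_space_PiM) (auto intro: prob_space_normal_density)

lemma nn_integral_P_given:
  assumes f: "f \<in> borel_measurable (P_inf N)" and dep: "\<And>\<omega>. f (restrict \<omega> (obs_index N)) = f \<omega>"
  shows "(\<integral>\<^sup>+\<omega>. f \<omega> \<partial>P_given N \<mu> \<nu> A) = (\<integral>\<^sup>+\<omega>. f (add_mean \<mu> \<nu> A \<omega>) \<partial>P_inf N)"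
proof -
  have "(\<lambda>\<omega>. restrict (add_mean \<mu> \<nu> A \<omega>) (obs_index N)) \<in> P_inf N \<rightarrow>\<^sub>M P_inf N"
    unfolding P_inf_def by (intro measurable_restrict) simp
  then show ?thesis
    unfolding P_given_eq_distr using f by (subst nn_integral_distr) (auto simp: dep)
qed

lemma measurable_P_given: "P_given N \<mu> \<nu> \<in> measure_pmf q \<rightarrow>\<^sub>M subprob_algebra (P_inf N)"
  using prob_space_P_given[of N \<mu> \<nu>] sets_P_given[of N \<mu> \<nu>]
  by (auto simp: space_subprob_algebra intro: prob_space_imp_subprob_space)

lemma sets_P_change: "sets (P_change N \<mu> p \<nu>) = sets (P_inf N)"
  unfolding P_change_def by (intro sets_bind) (auto simp: sets_P_given)

lemma nn_integral_P_change:
  assumes f: "f \<in> borel_measurable (P_inf N)" and dep: "\<And>\<omega>. f (restrict \<omega> (obs_index N)) = f \<omega>"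
  shows "(\<integral>\<^sup>+\<omega>. f \<omega> \<partial>P_change N \<mu> p \<nu>)
         = (\<integral>\<^sup>+A. \<integral>\<^sup>+\<omega>. f (add_mean \<mu> \<nu> A \<omega>) \<partial>P_inf N \<partial>measure_pmf (affected_pmf N p))"
  unfolding P_change_def nn_integral_P_given[OF assms, symmetric]
  by (rule nn_integral_bind[OF f measurable_P_given])

text \<open>Independence of the memberships turns an average over affected sets into one mixture per
  stream. It is applied to the weights in the upper bound and to the likelihood ratios in the lower
  bound.\<close>

lemma nn_integral_affected_prod:
  assumes "0 \<le> p" "p \<le> 1" "\<And>n. 0 \<le> e0 n" "\<And>n. 0 \<le> e1 n"
  shows "(\<integral>\<^sup>+A. (\<Prod>n\<in>{1..N}. ennreal (if n \<in> A then e1 n else e0 n)) \<partial>measure_pmf (affected_pmf N p))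
         = ennreal (\<Prod>n\<in>{1..N}. (1 - p) * e0 n + p * e1 n)"
proof -
  have "(\<integral>\<^sup>+A. (\<Prod>n\<in>{1..N}. ennreal (if n \<in> A then e1 n else e0 n)) \<partial>measure_pmf (affected_pmf N p))
    = (\<integral>\<^sup>+a. (\<Prod>n\<in>{1..N}. ennreal (if a n then e1 n else e0 n)) \<partial>measure_pmf (Pi_pmf {1..N} False (\<lambda>_. bernoulli_pmf p)))"
    unfolding affected_pmf_def by (auto simp: nn_integral_map_pmf intro!: nn_integral_cong prod.cong)
  also have "\<dots> = (\<Prod>n\<in>{1..N}. \<integral>\<^sup>+x. ennreal (if x then e1 n else e0 n) \<partial>measure_pmf (bernoulli_pmf p))"
    by (rule nn_integral_prod_Pi_pmf) simp
  also have "\<dots> = (\<Prod>n\<in>{1..N}. ennreal ((1 - p) * e0 n + p * e1 n))"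
    using assms by (intro prod.cong refl)
      (simp add: nn_integral_bernoulli_pmf ennreal_mult'[symmetric] ennreal_plus[symmetric] add.commute mult.commute del: ennreal_plus)
  finally show ?thesis using assms by (simp add: prod_ennreal del: ennreal_plus)
qed

lemma finite_set_affected_pmf: "finite (set_pmf (affected_pmf N p))"
  by (rule finite_subset[of _ "Pow {1..N}"]) (auto simp: affected_pmf_def)

section \<open>Likelihood ratios on finite blocks of observations\<close>

lemma PiM_tilt:
  assumes K: "finite K" "G \<subseteq> K"
  shows "density (PiM K (\<lambda>_. stdn)) (\<lambda>\<omega>. \<Prod>i\<in>G. ennreal (exp (a * \<omega> i - a\<^sup>2 / 2)))
         = PiM K (\<lambda>i. density lborel (normal_density (if i \<in> G then a else 0) 1))"
proof -
  let ?D = "\<lambda>i. density lborel (normal_density (if i \<in> G then a else 0) 1) :: real measure"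
  let ?e = "\<lambda>x. ennreal (exp (a * x - a\<^sup>2 / 2))"
  interpret D: prob_space "?D i" for i by (rule prob_space_normal_density) simp
  interpret S: prob_space stdn by (rule prob_space_stdn)
  interpret PD: product_sigma_finite ?D by unfold_locales
  interpret PS: product_sigma_finite "\<lambda>_. stdn" by unfold_locales
  show ?thesis
  proof (rule PD.PiM_eqI)
    fix F assume F: "\<And>i. i \<in> K \<Longrightarrow> F i \<in> sets (?D i)"
    have [measurable]: "i \<in> K \<Longrightarrow> F i \<in> sets borel" for i using F[of i] by simp
    have "PiE K F \<in> sets (PiM K (\<lambda>_. stdn))" using K by (intro sets_PiM_I_finite) auto
    then have "emeasure (density (PiM K (\<lambda>_. stdn)) (\<lambda>\<omega>. \<Prod>i\<in>G. ?e (\<omega> i))) (PiE K F)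
        = (\<integral>\<^sup>+\<omega>. (\<Prod>i\<in>G. ?e (\<omega> i)) * indicator (PiE K F) \<omega> \<partial>PiM K (\<lambda>_. stdn))"
      by (intro emeasure_density) auto
    also have "\<dots> = (\<integral>\<^sup>+\<omega>. (\<Prod>i\<in>K. (if i \<in> G then ?e (\<omega> i) else 1) * indicator (F i) (\<omega> i)) \<partial>PiM K (\<lambda>_. stdn))"
    proof (intro nn_integral_cong)
      fix \<omega> assume \<omega>: "\<omega> \<in> space (PiM K (\<lambda>_. stdn))"
      have "(\<Prod>i\<in>K. (if i \<in> G then ?e (\<omega> i) else 1)) = (\<Prod>i\<in>G. ?e (\<omega> i))"
        using K by (simp add: prod.If_cases Int_absorb1)
      moreover have "(\<Prod>i\<in>K. indicator (F i) (\<omega> i)) = (indicator (PiE K F) \<omega> :: ennreal)"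
        using \<omega> K by (auto simp: indicator_def space_PiM PiE_iff prod_zero_iff)
      ultimately show "(\<Prod>i\<in>G. ?e (\<omega> i)) * indicator (PiE K F) \<omega>
          = (\<Prod>i\<in>K. (if i \<in> G then ?e (\<omega> i) else 1) * indicator (F i) (\<omega> i))"
        by (simp add: prod.distrib)
    qed
    also have "\<dots> = (\<Prod>i\<in>K. \<integral>\<^sup>+x. (if i \<in> G then ?e x else 1) * indicator (F i) x \<partial>stdn)"
      using K by (intro PS.product_nn_integral_prod) auto
    also have "\<dots> = (\<Prod>i\<in>K. emeasure (?D i) (F i))"
    proof (intro prod.cong refl)
      fix i assume i: "i \<in> K"
      show "(\<integral>\<^sup>+x. (if i \<in> G then ?e x else 1) * indicator (F i) x \<partial>stdn) = emeasure (?D i) (F i)"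
      proof (cases "i \<in> G")
        case True
        then have "emeasure (?D i) (F i) = emeasure (density stdn ?e) (F i)" by (simp add: stdn_tilt)
        also have "\<dots> = (\<integral>\<^sup>+x. ?e x * indicator (F i) x \<partial>stdn)" using i by (intro emeasure_density) auto
        finally show ?thesis using True by simp
      next
        case False
        then show ?thesis using i by simp
      qed
    qed
    finally show "emeasure (density (PiM K (\<lambda>_. stdn)) (\<lambda>\<omega>. \<Prod>i\<in>G. ?e (\<omega> i))) (PiE K F) = (\<Prod>i\<in>K. emeasure (?D i) (F i))" .
  qed (use K in \<open>auto intro!: sets_PiM_cong\<close>)
qed

text \<open>A permanent nonzero shift of a stream makes the law of the whole array singular to the
  null law, so a density exists only on finite horizons. Hence \<open>f\<close> has to depend on the
  observations before \<nu> + w alone; the computation restricts to that block, tilts there and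
  returns to \<open>P_inf\<close>.\<close>

lemma nn_integral_P_given_likelihood:
  fixes f :: "(nat \<times> nat \<Rightarrow> real) \<Rightarrow> ennreal"
  assumes \<nu>: "1 \<le> \<nu>"
    and f: "\<And>K. f \<in> borel_measurable (PiM K (\<lambda>_. stdn))"
    and dep: "\<And>\<omega>. f (restrict \<omega> ({1..N} \<times> {1..<\<nu> + w})) = f \<omega>"
  shows "(\<integral>\<^sup>+\<omega>. f \<omega> \<partial>P_given N \<mu> \<nu> A)
     = (\<integral>\<^sup>+\<omega>. f \<omega> * (\<Prod>n\<in>{1..N}. ennreal (if n \<in> A then \<Prod>t\<in>{\<nu>..<\<nu> + w}. exp (\<mu> * \<omega> (n, t) + - \<mu>\<^sup>2 / 2) else 1)) \<partial>P_inf N)"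
proof -
  let ?K = "{1..N} \<times> {1..<\<nu> + w}"
  let ?G = "({1..N} \<inter> A) \<times> {\<nu>..<\<nu> + w}"
  let ?D = "\<lambda>(n, t). density lborel (normal_density (obs_mean \<mu> \<nu> A n t) 1) :: real measure"
  let ?L = "\<lambda>\<omega>. \<Prod>i\<in>?G. ennreal (exp (\<mu> * \<omega> i - \<mu>\<^sup>2 / 2))"
  have K: "?K \<subseteq> obs_index N" by (auto simp: obs_index_def)
  have pD: "prob_space (?D i)" for i by (cases i) (auto intro: prob_space_normal_density)
  have L: "(\<Prod>n\<in>{1..N}. ennreal (if n \<in> A then \<Prod>t\<in>{\<nu>..<\<nu> + w}. exp (\<mu> * \<omega> (n, t) + - \<mu>\<^sup>2 / 2) else 1)) = ?L \<omega>" for \<omega>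
  proof -
    have "(\<Prod>n\<in>{1..N}. ennreal (if n \<in> A then \<Prod>t\<in>{\<nu>..<\<nu> + w}. exp (\<mu> * \<omega> (n, t) + - \<mu>\<^sup>2 / 2) else 1))
        = (\<Prod>n\<in>{1..N}. if n \<in> A then \<Prod>t\<in>{\<nu>..<\<nu> + w}. ennreal (exp (\<mu> * \<omega> (n, t) - \<mu>\<^sup>2 / 2)) else 1)"
      by (intro prod.cong refl) (auto simp: prod_ennreal)
    also have "\<dots> = (\<Prod>n\<in>{1..N} \<inter> A. \<Prod>t\<in>{\<nu>..<\<nu> + w}. ennreal (exp (\<mu> * \<omega> (n, t) - \<mu>\<^sup>2 / 2)))"
      by (simp add: prod.If_cases)
    also have "\<dots> = ?L \<omega>" by (simp add: prod.cartesian_product split_def)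
    finally show ?thesis .
  qed
  have Lm: "?L \<in> borel_measurable (PiM J (\<lambda>_. stdn))" for J by measurable
  have "(\<integral>\<^sup>+\<omega>. f \<omega> \<partial>P_given N \<mu> \<nu> A) = (\<integral>\<^sup>+\<omega>. f (restrict \<omega> ?K) \<partial>PiM (obs_index N) ?D)"
    by (simp only: dep P_given_def)
  also have "\<dots> = (\<integral>\<^sup>+\<omega>. f \<omega> \<partial>distr (PiM (obs_index N) ?D) (PiM ?K ?D) (\<lambda>\<omega>. restrict \<omega> ?K))"
  proof -
    have "sets (PiM ?K ?D) = sets (PiM ?K (\<lambda>_. stdn))" by (intro sets_PiM_cong) (auto split: prod.splits)
    then have "f \<in> borel_measurable (PiM ?K ?D)" using f[of ?K] by (simp cong: measurable_cong_sets)
    then show ?thesis by (subst nn_integral_distr[OF measurable_restrict_subset[OF K]]) simp_all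
  qed
  also have "distr (PiM (obs_index N) ?D) (PiM ?K ?D) (\<lambda>\<omega>. restrict \<omega> ?K) = PiM ?K ?D"
    using distr_PiM_reindex[of "obs_index N" ?D "\<lambda>i. i" ?K] pD K by auto
  also have "PiM ?K ?D = PiM ?K (\<lambda>i. density lborel (normal_density (if i \<in> ?G then \<mu> else 0) 1))"
  proof (intro PiM_cong refl)
    fix i assume i: "i \<in> ?K"
    obtain n t where nt: "i = (n, t)" by (cases i)
    have "obs_mean \<mu> \<nu> A n t = (if i \<in> ?G then \<mu> else 0)" using i by (auto simp: nt obs_mean_def)
    then show "?D i = density lborel (normal_density (if i \<in> ?G then \<mu> else 0) 1)" by (simp only: nt prod.case)
  qed
  also have "\<dots> = density (PiM ?K (\<lambda>_. stdn)) ?L"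
    by (rule PiM_tilt[symmetric]) (use \<nu> in auto)
  also have "(\<integral>\<^sup>+\<omega>. f \<omega> \<partial>density (PiM ?K (\<lambda>_. stdn)) ?L) = (\<integral>\<^sup>+\<omega>. f \<omega> * ?L \<omega> \<partial>PiM ?K (\<lambda>_. stdn))"
    using f[of ?K] Lm[of ?K] by (subst nn_integral_density) (auto simp: mult.commute)
  also have "\<dots> = (\<integral>\<^sup>+\<omega>. f (restrict \<omega> ?K) * ?L (restrict \<omega> ?K) \<partial>P_inf N)"
    unfolding P_inf_def
    by (rule nn_integral_PiM_restrict[OF prob_space_stdn K, symmetric]) (use f[of ?K] in measurable)
  also have "\<dots> = (\<integral>\<^sup>+\<omega>. f \<omega> * ?L \<omega> \<partial>P_inf N)"
    by (intro nn_integral_cong arg_cong2[where f="(*)"] prod.cong dep) (use \<nu> in auto)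
  finally show ?thesis unfolding L .
qed

section \<open>Restarted scores\<close>

locale mei_rule =
  fixes N :: nat and m lam p0 b :: real
  assumes m: "0 < m" and lam: "0 < lam" and p0: "0 < p0" "p0 \<le> 1"
begin

text \<open>The score of stream n restarted at time s and run for t steps. Input i is the
  observation at time s + i + 1, as observation times begin at 1; start 0 gives the original
  CUSUM.\<close>

definition sc :: "(nat \<times> nat \<Rightarrow> real) \<Rightarrow> nat \<Rightarrow> nat \<Rightarrow> nat \<Rightarrow> real" where
  "sc \<omega> n s t = rcus m 0 (\<lambda>i. \<omega> (n, s + Suc i)) t"

definition score :: "(nat \<times> nat \<Rightarrow> real) \<Rightarrow> nat \<Rightarrow> nat \<Rightarrow> real" where
  "score \<omega> s t = (\<Sum>n=1..N. g_Mei lam p0 (sc \<omega> n s t))"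

definition quiet :: "(nat \<times> nat \<Rightarrow> real) \<Rightarrow> nat \<Rightarrow> nat \<Rightarrow> bool" where
  "quiet \<omega> s j \<longleftrightarrow> (\<forall>t\<in>{1..j}. score \<omega> s t < b)"

definition block :: "nat \<Rightarrow> nat \<Rightarrow> (nat \<times> nat) set" where
  "block s j = {1..N} \<times> {s<..s + j}"

abbreviation T :: "(nat \<times> nat \<Rightarrow> real) \<Rightarrow> enat" where
  "T \<equiv> T_Mei N m lam p0 b"

text \<open>By \<open>quiet_iff_less_T\<close> this is the null survival function P(T > j), and the
  ARL is its sum over j \<ge> 0.\<close>

definition tail :: "nat \<Rightarrow> real" where
  "tail j = measure (P_inf N) {\<omega> \<in> space (P_inf N). quiet \<omega> 0 j}"

lemma finite_block: "finite (block s j)" by (simp add: block_def)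
lemma block_subset: "block s j \<subseteq> obs_index N" by (auto simp: block_def obs_index_def)
lemma block_mono: "s' \<le> s \<Longrightarrow> s + j \<le> s' + j' \<Longrightarrow> block s j \<subseteq> block s' j'" by (auto simp: block_def)
lemma block_disjoint: "s + j \<le> s' \<Longrightarrow> block s j \<inter> block s' j' = {}" by (auto simp: block_def)

lemma quiet_iff_less_T: "quiet \<omega> 0 j \<longleftrightarrow> enat j < T \<omega>"
proof -
  have sc0: "score \<omega> 0 t = (\<Sum>n=1..N. g_Mei lam p0 (cusum m \<omega> n t))" for t
    by (simp add: score_def sc_def cusum_eq_rcus)
  let ?S = "{t. 1 \<le> t \<and> b \<le> (\<Sum>n=1..N. g_Mei lam p0 (cusum m \<omega> n t))}"
  have "enat j < T \<omega> \<longleftrightarrow> (\<forall>t\<in>?S. j < t)"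
  proof
    assume *: "enat j < T \<omega>"
    show "\<forall>t\<in>?S. j < t"
    proof
      fix t assume "t \<in> ?S"
      then have "T \<omega> \<le> enat t" unfolding T_Mei_def by (rule INF_lower)
      with * show "j < t" by (metis enat_ord_simps(2) order_less_le_trans)
    qed
  next
    assume "\<forall>t\<in>?S. j < t"
    then have "enat (Suc j) \<le> T \<omega>" unfolding T_Mei_def by (intro INF_greatest) (auto simp: Suc_le_eq)
    then show "enat j < T \<omega>" by (metis Suc_ile_eq)
  qed
  also have "\<dots> \<longleftrightarrow> quiet \<omega> 0 j"
    unfolding quiet_def sc0 by (auto simp: not_le[symmetric])
  finally show ?thesis ..
qed

lemma sc_cong: "(\<And>i. s < i \<Longrightarrow> i \<le> s + t \<Longrightarrow> \<omega> (n, i) = \<omega>' (n, i)) \<Longrightarrow> sc \<omega> n s t = sc \<omega>' n s t"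
  unfolding sc_def by (intro rcus_cong) auto

lemma score_cong: "(\<And>i. i \<in> block s t \<Longrightarrow> \<omega> i = \<omega>' i) \<Longrightarrow> score \<omega> s t = score \<omega>' s t"
  unfolding score_def by (intro sum.cong arg_cong[where f="g_Mei lam p0"] sc_cong) (auto simp: block_def)

lemma quiet_cong:
  assumes "\<And>i. i \<in> block s j \<Longrightarrow> \<omega> i = \<omega>' i"
  shows "quiet \<omega> s j = quiet \<omega>' s j"
  unfolding quiet_def using assms
  by (intro ball_cong refl arg_cong2[where f="(<)"] score_cong) (auto simp: block_def)

lemma measurable_sc [measurable]:
  assumes [measurable]: "\<And>i. (\<lambda>x. f x i) \<in> borel_measurable M"
  shows "(\<lambda>x. sc (f x) n s t) \<in> borel_measurable M"
  unfolding sc_def by measurable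

lemma measurable_score [measurable]:
  assumes [measurable]: "\<And>i. (\<lambda>x. f x i) \<in> borel_measurable M"
  shows "(\<lambda>x. score (f x) s t) \<in> borel_measurable M"
  unfolding score_def g_Mei_def by measurable

lemma measurable_quiet [measurable]:
  assumes [measurable]: "\<And>i. (\<lambda>x. f x i) \<in> borel_measurable M"
  shows "Measurable.pred M (\<lambda>x. quiet (f x) s j)"
  unfolding quiet_def by measurable

lemma measurable_component_P_inf [measurable]: "(\<lambda>\<omega>. \<omega> i) \<in> borel_measurable (P_inf N)"
  unfolding P_inf_def by (rule measurable_component_stdn)

lemma g_Mei_mono: "x \<le> y \<Longrightarrow> g_Mei lam p0 x \<le> g_Mei lam p0 y"
  unfolding g_Mei_def using lam p0 weight_denominator_pos[OF lam p0, of x]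
  by (subst ln_le_cancel_iff) (auto intro!: weight_denominator_pos mult_left_mono)

lemma score_mono: "(\<And>i. \<omega> i \<le> \<omega>' i) \<Longrightarrow> score \<omega> s t \<le> score \<omega>' s t"
  unfolding score_def sc_def using m by (intro sum_mono g_Mei_mono rcus_mono) auto

lemma quiet_antimono: "(\<And>i. \<omega> i \<le> \<omega>' i) \<Longrightarrow> quiet \<omega>' s j \<Longrightarrow> quiet \<omega> s j"
  unfolding quiet_def using score_mono[of \<omega> \<omega>' s] by (meson order_le_less_trans)

lemma score_restart: "score \<omega> (s + a) t \<le> score \<omega> s (a + t)"
  unfolding score_def sc_def
  using m rcus_restart_le[of m "\<lambda>i. \<omega> (_, s + Suc i)" a t]
  by (intro sum_mono g_Mei_mono) (simp add: add.assoc)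

lemma quiet_split:
  assumes "quiet \<omega> s (a + j)"
  shows "quiet \<omega> s a" "quiet \<omega> (s + a) j"
proof -
  show "quiet \<omega> s a" using assms by (auto simp: quiet_def)
  show "quiet \<omega> (s + a) j" unfolding quiet_def
  proof
    fix t assume "t \<in> {1..j}"
    then have "score \<omega> s (a + t) < b" using assms by (auto simp: quiet_def)
    then show "score \<omega> (s + a) t < b" using score_restart[of \<omega> s a t] by simp
  qed
qed

lemma tail_shift: "measure (P_inf N) {\<omega> \<in> space (P_inf N). quiet \<omega> s j} = tail j"
proof -
  let ?f = "\<lambda>\<omega>. if quiet \<omega> 0 j then 1 else 0 :: ennreal"
  have "(\<integral>\<^sup>+\<omega>. ?f (\<lambda>i\<in>obs_index N. \<omega> (fst i, s + snd i)) \<partial>P_inf N) = (\<integral>\<^sup>+\<omega>. ?f \<omega> \<partial>P_inf N)"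
    unfolding P_inf_def
    by (rule nn_integral_PiM_reindex[OF prob_space_stdn]) (auto simp: obs_index_def inj_on_def)
  moreover have "quiet (\<lambda>i\<in>obs_index N. \<omega> (fst i, s + snd i)) 0 j = quiet \<omega> s j" for \<omega>
    unfolding quiet_def score_def sc_def
    by (intro ball_cong refl arg_cong2[where f="(<)"] sum.cong arg_cong[where f="g_Mei lam p0"] rcus_cong)
       (auto simp: obs_index_def)
  ultimately have "emeasure (P_inf N) {\<omega> \<in> space (P_inf N). quiet \<omega> s j} = emeasure (P_inf N) {\<omega> \<in> space (P_inf N). quiet \<omega> 0 j}"
    by (simp add: nn_integral_if_eq_emeasure[symmetric])
  then show ?thesis by (simp add: tail_def measure_def)
qed

lemma emeasure_quiet: "emeasure (P_inf N) {\<omega> \<in> space (P_inf N). quiet \<omega> s j} = ennreal (tail j)"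
proof -
  interpret prob_space "P_inf N" by (rule prob_space_P_inf)
  show ?thesis by (simp add: emeasure_eq_measure tail_shift)
qed

lemma tail_nonneg: "0 \<le> tail j" by (simp add: tail_def)

lemma tail_le_1: "tail j \<le> 1"
proof -
  interpret prob_space "P_inf N" by (rule prob_space_P_inf)
  show ?thesis by (simp add: tail_def)
qed

lemma tail_antimono: "i \<le> j \<Longrightarrow> tail j \<le> tail i"
proof -
  interpret prob_space "P_inf N" by (rule prob_space_P_inf)
  show "i \<le> j \<Longrightarrow> tail j \<le> tail i"
    unfolding tail_def by (intro finite_measure_mono) (auto simp: quiet_def)
qed

lemma measurable_T [measurable]:
  assumes [measurable]: "\<And>i. (\<lambda>x. f x i) \<in> borel_measurable M"
  shows "(\<lambda>x. T (f x)) \<in> M \<rightarrow>\<^sub>M count_space UNIV"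
proof -
  \<comment> \<open>In \<open>T_Mei\<close> the index set of the infimum depends on the sample
    point. With \<infinity> as default value the infimum runs over a fixed countable set, which is
    measurable by the standard rules.\<close>
  have eq: "T \<omega> = (INF t\<in>{1..}. if b \<le> score \<omega> 0 t then enat t else \<infinity>)" for \<omega>
    unfolding T_Mei_def score_def sc_def cusum_eq_rcus
  proof (intro antisym INF_greatest)
    fix t :: nat assume "t \<in> {1..}"
    then show "(INF t\<in>{t. 1 \<le> t \<and> b \<le> (\<Sum>n=1..N. g_Mei lam p0 (rcus m 0 (\<lambda>i. \<omega> (n, Suc i)) t))}. enat t)
        \<le> (if b \<le> (\<Sum>n=1..N. g_Mei lam p0 (rcus m 0 (\<lambda>i. \<omega> (n, 0 + Suc i)) t)) then enat t else \<infinity>)"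
      by (cases "b \<le> (\<Sum>n=1..N. g_Mei lam p0 (rcus m 0 (\<lambda>i. \<omega> (n, Suc i)) t))") (auto intro: INF_lower)
  qed (rule INF_lower2, auto)
  show ?thesis unfolding eq by measurable
qed

lemma ARL_eq: "ARL N T = (\<Sum>j. ennreal (tail j))"
proof -
  have "(\<lambda>\<omega>. T \<omega>) \<in> P_inf N \<rightarrow>\<^sub>M count_space UNIV" by (rule measurable_T) measurable
  then show ?thesis
    unfolding ARL_def by (simp add: nn_integral_enat_function quiet_iff_less_T[symmetric] emeasure_quiet)
qed

end

context mei_rule
begin

section \<open>The false alarm bound\<close>

text \<open>Since exp of \<open>g_Mei\<close> is affine in exp (R / 2), this moment is exact. It is
  the reason why \<xi> appears in the threshold.\<close>

lemma integral_exp_g_Mei: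
  assumes n: "n \<in> {1..N}"
  shows "(\<integral>\<^sup>+\<omega>. ennreal (exp (g_Mei lam p0 (sc \<omega> n s t))) \<partial>P_inf N) = ennreal (1 + p0 * (lam * xi_at m t - 1))"
proof -
  interpret prob_space stream by (rule prob_space_stream)
  have "(\<integral>\<^sup>+\<omega>. ennreal (exp (g_Mei lam p0 (sc \<omega> n s t))) \<partial>P_inf N)
      = (\<integral>\<^sup>+x. ennreal (exp (g_Mei lam p0 (rcus m 0 x t))) \<partial>stream)"
    unfolding sc_def using n
    by (intro nn_integral_P_inf_stream[where f="\<lambda>x. ennreal (exp (g_Mei lam p0 (rcus m 0 x t)))"])
       (auto simp: g_Mei_def)
  also have "\<dots> = (\<integral>\<^sup>+x. ennreal (1 + p0 * (lam * exp (rcus m 0 x t / 2) - 1)) \<partial>stream)"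
    by (simp add: g_Mei_def weight_denominator_pos[OF lam p0])
  also have "\<dots> = ennreal (\<integral>x. 1 + p0 * (lam * exp (rcus m 0 x t / 2) - 1) \<partial>stream)"
    using integrable_exp_half_rcus[OF m, of t] weight_denominator_pos[OF lam p0]
    by (intro nn_integral_eq_integral) (auto intro: less_imp_le)
  also have "(\<integral>x. 1 + p0 * (lam * exp (rcus m 0 x t / 2) - 1) \<partial>stream) = 1 + p0 * (lam * xi_at m t - 1)"
    using integrable_exp_half_rcus[OF m, of t] by (simp add: prob_space xi_at_def)
  finally show ?thesis .
qed

abbreviation u :: real where
  "u \<equiv> ln (1 + p0 * (lam * xi m - 1))"

lemma u_arg_pos: "0 < 1 + p0 * (lam * xi m - 1)"
proof -
  have "0 < p0 * (lam * xi m)" using p0 lam xi_ge_1[OF m] by simp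
  then show ?thesis using p0 unfolding right_diff_distrib mult_1_right by linarith
qed

lemma prob_score_ge: "measure (P_inf N) {\<omega> \<in> space (P_inf N). b \<le> score \<omega> s t} \<le> exp (N * u - b)"
proof -
  interpret prob_space "P_inf N" by (rule prob_space_P_inf)
  have "ennreal (prob {\<omega> \<in> space (P_inf N). b \<le> score \<omega> s t}) = (\<integral>\<^sup>+\<omega>. (if b \<le> score \<omega> s t then 1 else 0) \<partial>P_inf N)"
    by (simp add: nn_integral_if_eq_emeasure emeasure_eq_measure)
  also have "\<dots> \<le> (\<integral>\<^sup>+\<omega>. ennreal (exp (- b)) * (\<Prod>n\<in>{1..N}. ennreal (exp (g_Mei lam p0 (sc \<omega> n s t)))) \<partial>P_inf N)"
  proof (intro nn_integral_mono)
    fix \<omega>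
    have "ennreal (exp (- b)) * (\<Prod>n\<in>{1..N}. ennreal (exp (g_Mei lam p0 (sc \<omega> n s t)))) = ennreal (exp (score \<omega> s t - b))"
      by (simp add: prod_ennreal exp_sum[symmetric] score_def ennreal_mult'[symmetric] flip: exp_add)
    moreover have "1 \<le> ennreal (exp (score \<omega> s t - b))" if "b \<le> score \<omega> s t"
      using that by simp
    ultimately show "(if b \<le> score \<omega> s t then 1 else 0) \<le> ennreal (exp (- b)) * (\<Prod>n\<in>{1..N}. ennreal (exp (g_Mei lam p0 (sc \<omega> n s t))))"
      by auto
  qed
  also have "\<dots> = ennreal (exp (- b)) * (\<integral>\<^sup>+\<omega>. (\<Prod>n\<in>{1..N}. ennreal (exp (g_Mei lam p0 (sc \<omega> n s t)))) \<partial>P_inf N)"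
    by (rule nn_integral_cmult) (auto simp: g_Mei_def)
  also have "(\<integral>\<^sup>+\<omega>. (\<Prod>n\<in>{1..N}. ennreal (exp (g_Mei lam p0 (sc \<omega> n s t)))) \<partial>P_inf N)
      = (\<Prod>n\<in>{1..N}. \<integral>\<^sup>+\<omega>. ennreal (exp (g_Mei lam p0 (sc \<omega> n s t))) \<partial>P_inf N)"
    unfolding P_inf_def
  proof (rule nn_integral_PiM_blocks[OF prob_space_stdn, where K="\<lambda>n. {n} \<times> {s<..s+t}"])
    fix n \<omega>
    show "ennreal (exp (g_Mei lam p0 (sc (restrict \<omega> ({n} \<times> {s<..s + t})) n s t))) = ennreal (exp (g_Mei lam p0 (sc \<omega> n s t)))"
      by (intro arg_cong[where f="\<lambda>x. ennreal (exp (g_Mei lam p0 x))"] sc_cong) auto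
  qed (auto simp: disjoint_family_on_def obs_index_def g_Mei_def)
  also have "\<dots> = ennreal (1 + p0 * (lam * xi_at m t - 1)) ^ N"
    by (simp add: integral_exp_g_Mei)
  also have "\<dots> \<le> ennreal (exp u) ^ N"
    using p0 lam xi_at_le_xi[OF m, of t] u_arg_pos
    by (intro power_mono ennreal_leI) (auto intro!: mult_left_mono)
  finally have "ennreal (prob {\<omega> \<in> space (P_inf N). b \<le> score \<omega> s t}) \<le> ennreal (exp (- b) * exp u ^ N)"
    using u_arg_pos by (simp add: ennreal_mult' ennreal_power mult_left_mono)
  then have "prob {\<omega> \<in> space (P_inf N). b \<le> score \<omega> s t} \<le> exp (- b) * exp u ^ N"
    by (subst (asm) ennreal_le_iff) (simp_all del: exp_ln_iff)
  also have "\<dots> = exp (N * u - b)"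
    by (simp only: exp_of_nat_mult[symmetric] exp_add[symmetric]) (simp add: algebra_simps)
  finally show ?thesis .
qed

lemma tail_ge: "1 - j * exp (N * u - b) \<le> tail j"
proof -
  interpret prob_space "P_inf N" by (rule prob_space_P_inf)
  have "1 - tail j = prob {\<omega> \<in> space (P_inf N). \<not> quiet \<omega> 0 j}"
    unfolding tail_def by (subst prob_neg) auto
  also have "{\<omega> \<in> space (P_inf N). \<not> quiet \<omega> 0 j} = (\<Union>t\<in>{1..j}. {\<omega> \<in> space (P_inf N). b \<le> score \<omega> 0 t})"
    by (auto simp: quiet_def not_less)
  also have "prob \<dots> \<le> (\<Sum>t\<in>{1..j}. prob {\<omega> \<in> space (P_inf N). b \<le> score \<omega> 0 t})"
    by (intro finite_measure_subadditive_finite) auto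
  also have "\<dots> \<le> (\<Sum>t\<in>{1..j}. exp (N * u - b))"
    by (intro sum_mono prob_score_ge)
  finally show ?thesis by simp
qed

text \<open>Were \<open>b\<close> larger, an alarm by time j would have null probability at most j /
  (4 \<gamma>). Survival probabilities of at least 1 - j / (4 \<gamma>) then add up to more than
  \<gamma> before time 2 \<gamma>, contradicting the ARL.\<close>

lemma threshold_le:
  assumes \<gamma>: "1 \<le> \<gamma>" and arl: "ARL N T = ennreal \<gamma>"
  shows "b \<le> N * u + ln (4 * \<gamma>)"
proof (rule ccontr)
  assume "\<not> b \<le> N * u + ln (4 * \<gamma>)"
  then have *: "N * u - b < - ln (4 * \<gamma>)" by simp
  then have q: "exp (N * u - b) < 1 / (4 * \<gamma>)"
  proof -
    have "exp (N * u - b) < exp (- ln (4 * \<gamma>))" using * by (simp only: exp_less_cancel_iff)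
    also have "\<dots> = 1 / (4 * \<gamma>)" using \<gamma> by (simp add: exp_minus inverse_eq_divide)
    finally show ?thesis .
  qed
  \<comment> \<open>More than 2 \<gamma> terms, of average 1 - k / (8 \<gamma>) \<ge> 3/4, have a
    sum above 3 \<gamma> / 2.\<close>
  define k where "k = nat \<lfloor>2 * \<gamma>\<rfloor>"
  have k: "real k \<le> 2 * \<gamma>" "2 * \<gamma> < real k + 1" using \<gamma> unfolding k_def by linarith+
  have "ennreal (\<Sum>j\<le>k. tail j) = (\<Sum>j<Suc k. ennreal (tail j))"
    by (simp add: sum_ennreal tail_nonneg lessThan_Suc_atMost)
  also have "\<dots> \<le> ennreal \<gamma>" unfolding arl[symmetric] ARL_eq by (rule sum_le_suminf) auto
  finally have le: "(\<Sum>j\<le>k. tail j) \<le> \<gamma>" using \<gamma> by (subst (asm) ennreal_le_iff) auto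
  have "(\<Sum>j\<le>k. 1 - real j * (1 / (4 * \<gamma>))) \<le> (\<Sum>j\<le>k. tail j)"
  proof (intro sum_mono)
    fix j
    have "real j * exp (N * u - b) \<le> real j * (1 / (4 * \<gamma>))" using q by (intro mult_left_mono) auto
    then show "1 - real j * (1 / (4 * \<gamma>)) \<le> tail j" using tail_ge[of j] by linarith
  qed
  also have "(\<Sum>j\<le>k. 1 - real j * (1 / (4 * \<gamma>))) = (real k + 1) - (\<Sum>j\<le>k. real j) / (4 * \<gamma>)"
    by (simp add: sum_subtractf sum_divide_distrib)
  also have "(\<Sum>j\<le>k. real j) = real k * (real k + 1) / 2"
    using gauss_sum_nat[of k] by (induction k) (auto simp: algebra_simps)
  finally have *: "(real k + 1) - real k * (real k + 1) / 2 / (4 * \<gamma>) \<le> \<gamma>" using le by simp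
  have "real k * (real k + 1) / 2 / (4 * \<gamma>) = (real k / (8 * \<gamma>)) * (real k + 1)" by simp
  also have "\<dots> \<le> (1/4) * (real k + 1)"
    using k \<gamma> by (intro mult_right_mono) (auto simp: divide_simps)
  finally have "3 * (real k + 1) \<le> 4 * \<gamma>" using * by simp
  moreover have "6 * \<gamma> < 3 * (real k + 1)" using k(2) by simp
  ultimately have "6 * \<gamma> < 4 * \<gamma>" by (rule order_less_le_trans[rotated])
  then show False using \<gamma> by simp
qed

section \<open>Run lengths under the null hypothesis\<close>

lemma tail_add_le: "tail (i + j) \<le> tail i * tail j"
proof -
  interpret prob_space "P_inf N" by (rule prob_space_P_inf)
  let ?f = "\<lambda>\<omega>. if quiet \<omega> 0 i then 1 else 0 :: ennreal"
  let ?g = "\<lambda>\<omega>. if quiet \<omega> i j then 1 else 0 :: ennreal"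
  have "ennreal (tail (i + j)) = (\<integral>\<^sup>+\<omega>. (if quiet \<omega> 0 (i + j) then 1 else 0) \<partial>P_inf N)"
    by (simp add: nn_integral_if_eq_emeasure emeasure_quiet)
  also have "\<dots> \<le> (\<integral>\<^sup>+\<omega>. ?f \<omega> * ?g \<omega> \<partial>P_inf N)"
    using quiet_split[of _ 0 i j] by (intro nn_integral_mono) auto
  also have "\<dots> = (\<integral>\<^sup>+\<omega>. ?f \<omega> \<partial>P_inf N) * (\<integral>\<^sup>+\<omega>. ?g \<omega> \<partial>P_inf N)"
    unfolding P_inf_def
  proof (rule nn_integral_PiM_indep2[OF prob_space_stdn, where K="block 0 i" and K'="block i j"])
    fix \<omega>
    show "?f (restrict \<omega> (block 0 i)) = ?f \<omega>" "?g (restrict \<omega> (block i j)) = ?g \<omega>"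
      using quiet_cong[of 0 i "restrict \<omega> (block 0 i)" \<omega>] quiet_cong[of i j "restrict \<omega> (block i j)" \<omega>] by auto
  qed (auto simp: block_disjoint block_subset)
  also have "\<dots> = ennreal (tail i * tail j)"
    by (simp add: nn_integral_if_eq_emeasure emeasure_quiet ennreal_mult' tail_nonneg)
  finally show ?thesis by (subst (asm) ennreal_le_iff) (auto simp: tail_nonneg)
qed

text \<open>By \<open>tail_add_le\<close> the run length is new better than used: given survival for
  j steps, the mean remaining run is at most \<gamma>. So \<gamma> \<le> j + \<gamma> * tail
  j.\<close>

lemma tail_ge_ARL:
  assumes arl: "ARL N T = ennreal \<gamma>" and \<gamma>: "1 \<le> \<gamma>"
  shows "1 - j / \<gamma> \<le> tail j"
proof -
  have sm: "summable tail" and sum: "suminf tail = \<gamma>"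
    using suminf_ennreal2[of tail] arl \<gamma> unfolding ARL_eq
    by (auto simp: tail_nonneg summable_suminf_not_top suminf_nonneg intro: summable_suminf_not_top)
  have "\<gamma> = (\<Sum>i. tail (i + j)) + (\<Sum>i<j. tail i)"
    using suminf_split_initial_segment[OF sm, of j] sum by simp
  also have "(\<Sum>i<j. tail i) \<le> j" using sum_mono[of "{..<j}" tail "\<lambda>_. 1"] tail_le_1 by simp
  also have "(\<Sum>i. tail (i + j)) \<le> (\<Sum>i. tail i * tail j)"
    by (intro suminf_le tail_add_le summable_ignore_initial_segment sm summable_mult2)
  also have "\<dots> = \<gamma> * tail j" using suminf_mult2[OF sm, of "tail j"] sum by simp
  finally show ?thesis using \<gamma> by (simp add: field_simps)
qed

lemma prob_window_quiet:
  "tail (L + h) - N * (cusum_bound m (1/2) * exp (- m\<^sup>2 / 8) ^ L)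
   \<le> measure (P_inf N) {\<omega> \<in> space (P_inf N). \<forall>t\<in>{s<..s + h}. score \<omega> 0 t < b}"
proof (cases "s \<le> L")
  case True
  interpret prob_space "P_inf N" by (rule prob_space_P_inf)
  have "0 \<le> N * (cusum_bound m (1/2) * exp (- m\<^sup>2 / 8) ^ L)"
    using cusum_bound_ge_1[of "1/2" m] m by (intro mult_nonneg_nonneg) auto
  moreover have "tail (L + h) \<le> prob {\<omega> \<in> space (P_inf N). \<forall>t\<in>{s<..s + h}. score \<omega> 0 t < b}"
    unfolding tail_def using True by (intro finite_measure_mono) (auto simp: quiet_def)
  ultimately show ?thesis by linarith
next
  case False
  interpret prob_space "P_inf N" by (rule prob_space_P_inf)
  define a where "a = s - L"
  have s: "s = a + L" using False by (simp add: a_def)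
  let ?S = "space (P_inf N)"
  let ?B = "\<lambda>n. {\<omega> \<in> ?S. sc \<omega> n 0 s \<noteq> sc \<omega> n a L}"
  let ?W = "{\<omega> \<in> ?S. \<forall>t\<in>{s<..s + h}. score \<omega> 0 t < b}"
  have "measure (P_inf N) (?B n) \<le> cusum_bound m (1/2) * exp (- m\<^sup>2 / 8) ^ L" if n: "n \<in> {1..N}" for n
  proof -
    interpret S: prob_space stream by (rule prob_space_stream)
    have [measurable]: "Measurable.pred stream (\<lambda>x. rcus m 0 x s \<noteq> rcus m 0 (\<lambda>i. x (a + i)) L)"
      unfolding neq_iff by measurable
    have "emeasure (P_inf N) (?B n) = (\<integral>\<^sup>+\<omega>. (if sc \<omega> n 0 s \<noteq> sc \<omega> n a L then 1 else 0) \<partial>P_inf N)"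
      by (subst nn_integral_if_eq_emeasure) (unfold neq_iff, measurable)
    also have "\<dots> = (\<integral>\<^sup>+x. (if rcus m 0 x s \<noteq> rcus m 0 (\<lambda>i. x (a + i)) L then 1 else 0) \<partial>stream)"
      using nn_integral_P_inf_stream[OF n, of "\<lambda>x. if rcus m 0 x s \<noteq> rcus m 0 (\<lambda>i. x (a + i)) L then 1 else 0" 0]
      by (simp add: sc_def)
    also have "\<dots> = emeasure stream {x \<in> space stream. rcus m 0 x s \<noteq> rcus m 0 (\<lambda>i. x (a + i)) L}"
      by (subst nn_integral_if_eq_emeasure) auto
    also have "\<dots> \<le> ennreal (cusum_bound m (1/2) * exp (- m\<^sup>2 / 8) ^ L)"
      unfolding s S.emeasure_eq_measure by (intro ennreal_leI prob_restart_neq m)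
    finally show ?thesis
      using cusum_bound_ge_1[of "1/2" m] m by (simp add: emeasure_eq_measure)
  qed
  note B = this
  have Bm: "?B n \<in> sets (P_inf N)" for n unfolding neq_iff by measurable
  have "tail (L + h) = prob {\<omega> \<in> ?S. quiet \<omega> a (L + h)}" by (simp add: tail_shift)
  also have "\<dots> \<le> prob (?W \<union> (\<Union>n\<in>{1..N}. ?B n))"
  proof (intro finite_measure_mono)
    show "{\<omega> \<in> ?S. quiet \<omega> a (L + h)} \<subseteq> ?W \<union> (\<Union>n\<in>{1..N}. ?B n)"
    proof
      fix \<omega> assume \<omega>: "\<omega> \<in> {\<omega> \<in> ?S. quiet \<omega> a (L + h)}"
      show "\<omega> \<in> ?W \<union> (\<Union>n\<in>{1..N}. ?B n)"
      proof (cases "\<exists>n\<in>{1..N}. sc \<omega> n 0 s \<noteq> sc \<omega> n a L")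
        case False
        have "score \<omega> 0 t < b" if t: "t \<in> {s<..s + h}" for t
        proof -
          define d where "d = t - s"
          have t': "t = s + d" "t = a + (L + d)" using t by (auto simp: d_def s)
          have "sc \<omega> n 0 (s + d) = sc \<omega> n a (L + d)" if "n \<in> {1..N}" for n
          proof -
            have "sc \<omega> n 0 s = sc \<omega> n a L" using False that by auto
            then show ?thesis
              unfolding sc_def by (simp add: rcus_add[of m 0 _ s d] rcus_add[of m 0 _ L d]) (simp add: s add_ac)
          qed
          then have eq: "score \<omega> 0 t = score \<omega> a (L + d)" unfolding score_def t'(1) by simp
          have "L + d \<in> {1..L + h}" using t by (auto simp: d_def)
          then have "score \<omega> a (L + d) < b" using \<omega> unfolding quiet_def by blast
          then show ?thesis by (simp only: eq)
        qed
        then show ?thesis using \<omega> by auto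
      qed (use \<omega> in auto)
    qed
    show "?W \<union> (\<Union>n\<in>{1..N}. ?B n) \<in> sets (P_inf N)" using Bm by (intro sets.Un sets.finite_UN) auto
  qed
  also have "\<dots> \<le> prob ?W + prob (\<Union>n\<in>{1..N}. ?B n)"
    using Bm by (intro measure_Un_le sets.finite_UN) auto
  also have "prob (\<Union>n\<in>{1..N}. ?B n) \<le> (\<Sum>n\<in>{1..N}. prob (?B n))"
    using Bm by (intro finite_measure_subadditive_finite) auto
  also have "\<dots> \<le> (\<Sum>n\<in>{1..N}. cusum_bound m (1/2) * exp (- m\<^sup>2 / 8) ^ L)"
    by (intro sum_mono B) auto
  finally show ?thesis by simp
qed

text \<open>The converse direction to \<open>tail_add_le\<close>. Staying quiet up to s and staying
  below the threshold in the window after s are both decreasing in the observations, hence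
  positively correlated.\<close>

lemma tail_add_ge:
  "tail s * (tail (L + h) - N * (cusum_bound m (1/2) * exp (- m\<^sup>2 / 8) ^ L)) \<le> tail (s + h)"
proof -
  interpret prob_space "P_inf N" by (rule prob_space_P_inf)
  let ?W = "\<lambda>\<omega>. \<forall>t\<in>{s<..s + h}. score \<omega> 0 t < b"
  let ?J = "block 0 (s + h)"
  let ?f = "\<lambda>\<omega>. if quiet \<omega> 0 s then 1 else 0 :: ennreal"
  let ?g = "\<lambda>\<omega>. if ?W \<omega> then 1 else 0 :: ennreal"
  have Wm: "?g \<in> borel_measurable (PiM K (\<lambda>_. stdn))" for K by measurable
  \<comment> \<open>Harris' inequality is available for finite products, and both events depend only
    on the finite block up to time s + h.\<close>
  have red: "(\<integral>\<^sup>+\<omega>. F \<omega> \<partial>P_inf N) = (\<integral>\<^sup>+\<omega>. F \<omega> \<partial>PiM ?J (\<lambda>_. stdn))"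
    if "F \<in> borel_measurable (PiM ?J (\<lambda>_. stdn))" "\<And>\<omega>. F (restrict \<omega> ?J) = F \<omega>" for F :: "_ \<Rightarrow> ennreal"
    using nn_integral_PiM_restrict[OF prob_space_stdn block_subset that(1)] that(2) by (simp add: P_inf_def)
  have fd: "?f (restrict \<omega> ?J) = ?f \<omega>" for \<omega>
    using quiet_cong[of 0 s "restrict \<omega> ?J" \<omega>] block_mono[of 0 0 s "s + h"] by (auto simp: subset_eq)
  have gd: "?g (restrict \<omega> ?J) = ?g \<omega>" for \<omega>
  proof -
    have "score (restrict \<omega> ?J) 0 t = score \<omega> 0 t" if "t \<in> {s<..s + h}" for t
      using that block_mono[of 0 0 t "s + h"] by (intro score_cong) (auto simp: subset_eq)
    then show ?thesis by simp
  qed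
  have "ennreal (tail s) * ennreal (prob {\<omega> \<in> space (P_inf N). ?W \<omega>}) = (\<integral>\<^sup>+\<omega>. ?f \<omega> \<partial>P_inf N) * (\<integral>\<^sup>+\<omega>. ?g \<omega> \<partial>P_inf N)"
    by (simp add: nn_integral_if_eq_emeasure emeasure_quiet emeasure_eq_measure[symmetric])
  also have "\<dots> = (\<integral>\<^sup>+\<omega>. ?f \<omega> \<partial>PiM ?J (\<lambda>_. stdn)) * (\<integral>\<^sup>+\<omega>. ?g \<omega> \<partial>PiM ?J (\<lambda>_. stdn))"
    by (intro arg_cong2[where f="(*)"] red fd gd Wm) measurable
  also have "\<dots> \<le> (\<integral>\<^sup>+\<omega>. ?f \<omega> * ?g \<omega> \<partial>PiM ?J (\<lambda>_. stdn))"
  proof (rule harris_PiM[OF prob_space_stdn finite_block])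
    show "antimono ?f"
      using quiet_antimono by (intro antimonoI) (auto simp: le_fun_def)
    have "?W x" if "x \<le> y" "?W y" for x y
      using that(2) order_le_less_trans[OF score_mono[of x y 0]] le_funD[OF that(1)] by blast
    then show "antimono ?g" by (intro antimonoI) auto
  qed (use Wm in \<open>auto\<close>)
  also have "\<dots> = (\<integral>\<^sup>+\<omega>. ?f \<omega> * ?g \<omega> \<partial>P_inf N)"
    by (rule red[symmetric]) (use Wm in \<open>auto simp: fd gd\<close>)
  also have "\<dots> = (\<integral>\<^sup>+\<omega>. (if quiet \<omega> 0 (s + h) then 1 else 0) \<partial>P_inf N)"
    by (intro nn_integral_cong) (auto simp: quiet_def)
  also have "\<dots> = ennreal (tail (s + h))" by (simp add: nn_integral_if_eq_emeasure emeasure_quiet)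
  finally have "tail s * prob {\<omega> \<in> space (P_inf N). ?W \<omega>} \<le> tail (s + h)"
    by (simp add: ennreal_mult'[symmetric] tail_nonneg)
  moreover have "tail s * (tail (L + h) - N * (cusum_bound m (1/2) * exp (- m\<^sup>2 / 8) ^ L)) \<le> tail s * prob {\<omega> \<in> space (P_inf N). ?W \<omega>}"
    by (intro mult_left_mono prob_window_quiet tail_nonneg)
  ultimately show ?thesis by linarith
qed

end

section \<open>A power inequality\<close>

text \<open>After division by x + y the summands lie in [0, 1], where t \<le> t powr c.\<close>

lemma powr_add_le_add_powr:
  fixes x y c :: real
  assumes "0 \<le> x" "0 \<le> y" "0 < c" "c \<le> 1"
  shows "(x + y) powr c \<le> x powr c + y powr c"
proof (cases "x + y = 0")
  case False
  then have s: "0 < x + y" using assms by simp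
  have *: "t \<le> t powr c" if "0 \<le> t" "t \<le> 1" for t :: real
    using powr_mono'[of c 1 t] that assms by (cases "t = 0") auto
  have "1 = x / (x + y) + y / (x + y)" using s by (simp add: add_divide_distrib[symmetric])
  also have "\<dots> \<le> (x / (x + y)) powr c + (y / (x + y)) powr c"
    using assms s by (intro add_mono *) auto
  also have "\<dots> = (x powr c + y powr c) / (x + y) powr c"
    using assms s by (simp add: powr_divide add_divide_distrib)
  finally show ?thesis using s by (simp add: pos_le_divide_eq)
qed simp

text \<open>A Taylor bound of fractional order for exponents in (1, 2]. The linear term is kept
  exactly because it will have mean zero; the error is |y|^a rather than y^2 because only the moment
  of order a = 1 + s has the right size. The difference of the two sides vanishes at 0, and its
  derivative has the right sign by subadditivity of the power a - 1.\<close>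

lemma powr_one_plus_le:
  fixes y a :: real
  assumes a: "1 < a" "a \<le> 2" and y: "- 1 \<le> y"
  shows "(1 + y) powr a \<le> 1 + a * y + \<bar>y\<bar> powr a"
proof (cases "0 \<le> y")
  case True
  define h where "h y = 1 + a * y + y powr a - (1 + y) powr a" for y
  have "h 0 \<le> h y"
  proof (rule DERIV_nonneg_imp_increasing_open[OF True])
    fix x assume x: "0 < x" "x < y"
    have "(h has_real_derivative a + a * x powr (a - 1) - a * (1 + x) powr (a - 1)) (at x)"
      unfolding h_def using x by (auto intro!: derivative_eq_intros)
    moreover have "a * (1 + x) powr (a - 1) \<le> a * (1 powr (a - 1) + x powr (a - 1))"
      using a x by (intro mult_left_mono powr_add_le_add_powr) auto
    ultimately show "\<exists>d. (h has_real_derivative d) (at x) \<and> 0 \<le> d"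
      using a by (intro exI conjI) (auto simp: algebra_simps)
  next
    show "continuous_on {0..y} h"
      unfolding h_def using a by (intro continuous_intros continuous_on_powr') auto
  qed
  then show ?thesis using True a by (simp add: h_def)
next
  case False
  define h where "h w = 1 - a * w + w powr a - (1 - w) powr a" for w
  have "h 0 \<le> h (- y)"
  proof (rule DERIV_nonneg_imp_increasing_open[of 0 "- y" h])
    fix x assume x: "0 < x" "x < - y"
    have "(h has_real_derivative - a + a * x powr (a - 1) + a * (1 - x) powr (a - 1)) (at x)"
      unfolding h_def using x y by (auto intro!: derivative_eq_intros)
    moreover have "a * (x + (1 - x)) powr (a - 1) \<le> a * (x powr (a - 1) + (1 - x) powr (a - 1))"
      using a x y by (intro mult_left_mono powr_add_le_add_powr) auto
    ultimately show "\<exists>d. (h has_real_derivative d) (at x) \<and> 0 \<le> d"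
      using a by (intro exI conjI) (auto simp: algebra_simps)
  next
    show "continuous_on {0..- y} h"
      unfolding h_def using a y by (intro continuous_intros continuous_on_powr') auto
  qed (use False in auto)
  then show ?thesis using False a by (simp add: h_def)
qed

section \<open>The detection delay\<close>

context mei_rule
begin

definition late_prob :: "real \<Rightarrow> real \<Rightarrow> nat \<Rightarrow> nat \<Rightarrow> ennreal" where
  "late_prob \<mu> p \<nu> j = emeasure (P_change N \<mu> p \<nu>) {\<omega> \<in> space (P_change N \<mu> p \<nu>). quiet \<omega> 0 j}"

lemma measurable_P_change_cong: "f \<in> borel_measurable (P_inf N) \<Longrightarrow> f \<in> borel_measurable (P_change N \<mu> p \<nu>)"
  using measurable_cong_sets[OF sets_P_change refl] by blast

lemma measurable_component_P_change [measurable]: "(\<lambda>\<omega>. \<omega> i) \<in> borel_measurable (P_change N \<mu> p \<nu>)"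
  by (rule measurable_P_change_cong) measurable

lemma quiet_restrict: "quiet (restrict \<omega> (obs_index N)) s j = quiet \<omega> s j"
  using block_subset[of s j] by (intro quiet_cong) auto

lemma measurable_add_mean_P_inf [measurable]: "(\<lambda>\<omega>. add_mean \<mu> \<nu> A \<omega> i) \<in> borel_measurable (P_inf N)"
  unfolding P_inf_def by measurable

lemma late_prob_eq:
  "late_prob \<mu> p \<nu> j = (\<integral>\<^sup>+A. \<integral>\<^sup>+\<omega>. (if quiet (add_mean \<mu> \<nu> A \<omega>) 0 j then 1 else 0) \<partial>P_inf N \<partial>measure_pmf (affected_pmf N p))"
proof -
  have "late_prob \<mu> p \<nu> j = (\<integral>\<^sup>+\<omega>. (if quiet \<omega> 0 j then 1 else 0) \<partial>P_change N \<mu> p \<nu>)"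
    unfolding late_prob_def by (subst nn_integral_if_eq_emeasure) auto
  also have "\<dots> = (\<integral>\<^sup>+A. \<integral>\<^sup>+\<omega>. (if quiet (add_mean \<mu> \<nu> A \<omega>) 0 j then 1 else 0) \<partial>P_inf N \<partial>measure_pmf (affected_pmf N p))"
    by (rule nn_integral_P_change) (auto simp: quiet_restrict)
  finally show ?thesis .
qed

lemma quiet_add_mean_pre: "s + j < \<nu> \<Longrightarrow> quiet (add_mean \<mu> \<nu> A \<omega>) s j = quiet \<omega> s j"
  by (rule quiet_cong) (auto simp: block_def add_mean_def obs_mean_def)

lemma late_prob_pre: "j < \<nu> \<Longrightarrow> late_prob \<mu> p \<nu> j = ennreal (tail j)"
  unfolding late_prob_eq
  by (simp add: quiet_add_mean_pre nn_integral_if_eq_emeasure emeasure_quiet measure_pmf.emeasure_space_1)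

lemma emeasure_late_event: "1 \<le> \<nu> \<Longrightarrow> emeasure (P_change N \<mu> p \<nu>) (late_event N \<mu> p T \<nu>) = ennreal (tail (\<nu> - 1))"
proof -
  assume \<nu>: "1 \<le> \<nu>"
  have "late_event N \<mu> p T \<nu> = {\<omega> \<in> space (P_change N \<mu> p \<nu>). quiet \<omega> 0 (\<nu> - 1)}"
    unfolding late_event_def quiet_iff_less_T using \<nu> Suc_ile_eq[of "\<nu> - 1"] by simp
  then show ?thesis using late_prob_pre[of "\<nu> - 1" \<nu> \<mu> p] \<nu> by (simp add: late_prob_def)
qed

text \<open>Summation of survival probabilities: on T \<ge> \<nu> the delay T - \<nu> + 1 exceeds j
  exactly when T > \<nu> - 1 + j.\<close>

lemma cond_delay_eq:
  assumes \<nu>: "1 \<le> \<nu>"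
  shows "cond_delay N \<mu> p T \<nu> = (\<Sum>j. late_prob \<mu> p \<nu> (\<nu> - 1 + j)) / ennreal (tail (\<nu> - 1))"
proof -
  let ?P = "P_change N \<mu> p \<nu>"
  \<comment> \<open>The value 0 off the conditioning event absorbs the indicator, so that
    \<open>D\<close> exceeding j is a single event for every j.\<close>
  define D where "D \<omega> = (if quiet \<omega> 0 (\<nu> - 1) then T \<omega> - enat \<nu> + 1 else 0)" for \<omega>
  have less: "enat j < D \<omega> \<longleftrightarrow> quiet \<omega> 0 (\<nu> - 1 + j)" for \<omega> j
  proof (cases "T \<omega>")
    case (enat t)
    then show ?thesis using \<nu> by (auto simp: D_def quiet_iff_less_T one_enat_def zero_enat_def)
  next
    case infinity
    then show ?thesis by (simp add: D_def quiet_iff_less_T)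
  qed
  have "D \<in> ?P \<rightarrow>\<^sub>M count_space UNIV" unfolding D_def by measurable
  then have "(\<integral>\<^sup>+\<omega>. ennreal_of_enat (D \<omega>) \<partial>?P) = (\<Sum>j. late_prob \<mu> p \<nu> (\<nu> - 1 + j))"
    by (simp add: nn_integral_enat_function less late_prob_def)
  moreover have "(\<integral>\<^sup>+\<omega>. ennreal_of_enat (T \<omega> - enat \<nu> + 1) * indicator (late_event N \<mu> p T \<nu>) \<omega> \<partial>?P)
      = (\<integral>\<^sup>+\<omega>. ennreal_of_enat (D \<omega>) \<partial>?P)"
    by (intro nn_integral_cong)
       (use \<nu> Suc_ile_eq[of "\<nu> - 1"] in \<open>auto simp: D_def late_event_def indicator_def quiet_iff_less_T\<close>)
  ultimately show ?thesis unfolding cond_delay_def emeasure_late_event[OF \<nu>] by simp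
qed

definition miss_prob :: "real \<Rightarrow> real \<Rightarrow> nat \<Rightarrow> nat \<Rightarrow> nat \<Rightarrow> ennreal" where
  "miss_prob \<mu> p \<nu> s t = (\<integral>\<^sup>+A. \<integral>\<^sup>+\<omega>. (if score (add_mean \<mu> \<nu> A \<omega>) s t < b then 1 else 0) \<partial>P_inf N
     \<partial>measure_pmf (affected_pmf N p))"

text \<open>Restarting the scores at times \<open>s\<close> and \<open>s + M\<close> only delays the alarm and makes the three
  stretches of observations independent.\<close>

lemma late_prob_le:
  assumes \<mu>: "0 \<le> \<mu>" and s: "s < \<nu>" and M: "1 \<le> M"
  shows "late_prob \<mu> p \<nu> (s + M + i) \<le> ennreal (tail s) * miss_prob \<mu> p \<nu> s M * ennreal (tail i)"
proof -
  have one: "(\<integral>\<^sup>+\<omega>. (if quiet (add_mean \<mu> \<nu> A \<omega>) 0 (s + M + i) then 1 else 0) \<partial>P_inf N)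
      \<le> ennreal (tail s) * (\<integral>\<^sup>+\<omega>. (if score (add_mean \<mu> \<nu> A \<omega>) s M < b then 1 else 0) \<partial>P_inf N) * ennreal (tail i)" for A
  proof -
    let ?f = "\<lambda>\<omega>. if quiet (add_mean \<mu> \<nu> A \<omega>) 0 s then 1 else 0 :: ennreal"
    let ?g = "\<lambda>\<omega>. if score (add_mean \<mu> \<nu> A \<omega>) s M < b then 1 else 0 :: ennreal"
    let ?k = "\<lambda>\<omega>. if quiet (add_mean \<mu> \<nu> A \<omega>) (s + M) i then 1 else 0 :: ennreal"
    have am: "j \<in> J \<Longrightarrow> add_mean \<mu> \<nu> A (restrict \<omega> J) j = add_mean \<mu> \<nu> A \<omega> j" for J \<omega> j
      by (cases j) (simp add: add_mean_def)
    have fd: "?f (restrict \<omega> (block 0 s)) = ?f \<omega>" for \<omega>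
      using quiet_cong[of 0 s "add_mean \<mu> \<nu> A (restrict \<omega> (block 0 s))" "add_mean \<mu> \<nu> A \<omega>"] am by auto
    have gd: "?g (restrict \<omega> J) = ?g \<omega>" if "block s M \<subseteq> J" for \<omega> J
    proof -
      have "score (add_mean \<mu> \<nu> A (restrict \<omega> J)) s M = score (add_mean \<mu> \<nu> A \<omega>) s M"
        by (intro score_cong am) (use that in blast)
      then show ?thesis by (simp only:)
    qed
    have kd: "?k (restrict \<omega> J) = ?k \<omega>" if "block (s + M) i \<subseteq> J" for \<omega> J
    proof -
      have "quiet (add_mean \<mu> \<nu> A (restrict \<omega> J)) (s + M) i = quiet (add_mean \<mu> \<nu> A \<omega>) (s + M) i"
        by (intro quiet_cong am) (use that in blast)
      then show ?thesis by (simp only:)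
    qed
    have gkd: "?g (restrict \<omega> (block s (M + i))) * ?k (restrict \<omega> (block s (M + i))) = ?g \<omega> * ?k \<omega>" for \<omega>
      by (intro arg_cong2[where f="(*)"] gd kd block_mono) auto
    have "(\<integral>\<^sup>+\<omega>. (if quiet (add_mean \<mu> \<nu> A \<omega>) 0 (s + M + i) then 1 else 0) \<partial>P_inf N) \<le> (\<integral>\<^sup>+\<omega>. ?f \<omega> * (?g \<omega> * ?k \<omega>) \<partial>P_inf N)"
    proof (intro nn_integral_mono)
      fix \<omega>
      have "quiet \<omega>' 0 s \<and> score \<omega>' s M < b \<and> quiet \<omega>' (s + M) i" if "quiet \<omega>' 0 (s + M + i)" for \<omega>'
      proof -
        have "quiet \<omega>' 0 (s + (M + i))" using that by (simp add: add.assoc)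
        then have "quiet \<omega>' 0 s" "quiet \<omega>' (0 + s) (M + i)" by (rule quiet_split)+
        moreover from this(2) have "quiet \<omega>' s M" "quiet \<omega>' (s + M) i" using quiet_split[of \<omega>' s M i] by simp_all
        moreover have "M \<in> {1..M}" using M by simp
        ultimately show ?thesis unfolding quiet_def[of \<omega>' s M] by blast
      qed
      then show "(if quiet (add_mean \<mu> \<nu> A \<omega>) 0 (s + M + i) then 1 else 0) \<le> ?f \<omega> * (?g \<omega> * ?k \<omega>)"
        by auto
    qed
    also have "\<dots> = (\<integral>\<^sup>+\<omega>. ?f \<omega> \<partial>P_inf N) * (\<integral>\<^sup>+\<omega>. ?g \<omega> * ?k \<omega> \<partial>P_inf N)"
      unfolding P_inf_def
      by (rule nn_integral_PiM_indep2[OF prob_space_stdn, where K="block 0 s" and K'="block s (M + i)"])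
         (use fd gkd in \<open>simp_all add: block_disjoint block_subset\<close>)
    also have "(\<integral>\<^sup>+\<omega>. ?g \<omega> * ?k \<omega> \<partial>P_inf N) = (\<integral>\<^sup>+\<omega>. ?g \<omega> \<partial>P_inf N) * (\<integral>\<^sup>+\<omega>. ?k \<omega> \<partial>P_inf N)"
      unfolding P_inf_def
    proof (rule nn_integral_PiM_indep2[OF prob_space_stdn, where K="block s M" and K'="block (s + M) i"])
      fix \<omega>
      show "?g (restrict \<omega> (block s M)) = ?g \<omega>" by (rule gd) simp
      show "?k (restrict \<omega> (block (s + M) i)) = ?k \<omega>" by (rule kd) simp
    qed (simp_all add: block_disjoint block_subset)
    also have "(\<integral>\<^sup>+\<omega>. ?f \<omega> \<partial>P_inf N) = ennreal (tail s)"
      using s by (simp add: quiet_add_mean_pre nn_integral_if_eq_emeasure emeasure_quiet)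
    \<comment> \<open>Shifted observations only hasten an alarm, so the last stretch is compared
      with the null hypothesis. This loses little: its total contribution is a mean run length of
      \<gamma>, matched by the smallness of the middle factor.\<close>
    also have "(\<integral>\<^sup>+\<omega>. ?k \<omega> \<partial>P_inf N) \<le> (\<integral>\<^sup>+\<omega>. (if quiet \<omega> (s + M) i then 1 else 0) \<partial>P_inf N)"
    proof (intro nn_integral_mono)
      fix \<omega>
      have "\<omega> j \<le> add_mean \<mu> \<nu> A \<omega> j" for j
        using \<mu> by (cases j) (simp add: add_mean_def obs_mean_def)
      then show "?k \<omega> \<le> (if quiet \<omega> (s + M) i then 1 else 0)" using quiet_antimono[of \<omega> "add_mean \<mu> \<nu> A \<omega>"] by auto
    qed
    also have "\<dots> = ennreal (tail i)" by (simp add: nn_integral_if_eq_emeasure emeasure_quiet)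
    finally show ?thesis by (simp add: mult.assoc mult_left_mono)
  qed
  have "late_prob \<mu> p \<nu> (s + M + i) \<le> (\<integral>\<^sup>+A. ennreal (tail s) * (\<integral>\<^sup>+\<omega>. (if score (add_mean \<mu> \<nu> A \<omega>) s M < b then 1 else 0) \<partial>P_inf N) * ennreal (tail i) \<partial>measure_pmf (affected_pmf N p))"
    unfolding late_prob_eq by (intro nn_integral_mono one)
  also have "\<dots> = ennreal (tail s) * miss_prob \<mu> p \<nu> s M * ennreal (tail i)"
    unfolding miss_prob_def by (simp add: nn_integral_cmult nn_integral_multc)
  finally show ?thesis .
qed

text \<open>An exponential Markov inequality with exponent -1: P(score < b) is at most exp b times
  the mean of exp (- score), which factorises over streams and then over memberships.\<close>

lemma miss_prob_le:
  assumes p: "0 \<le> p" "p \<le> 1" and s: "s + h = \<nu> - 1" "1 \<le> \<nu>" and p0': "p0 \<le> 1/2"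
  shows "miss_prob \<mu> p \<nu> s M \<le> ennreal (exp b *
    ((1 - p) * (\<integral>x. weight lam p0 (rcus m 0 x M) \<partial>stream)
     + p * (\<integral>x. weight lam p0 (rcus m 0 (\<lambda>i. x i + (if h \<le> i then \<mu> else 0)) M) \<partial>stream)) ^ N)"
proof -
  let ?e0 = "\<integral>x. weight lam p0 (rcus m 0 x M) \<partial>stream"
  let ?e1 = "\<integral>x. weight lam p0 (rcus m 0 (\<lambda>i. x i + (if h \<le> i then \<mu> else 0)) M) \<partial>stream"
  have e0: "0 \<le> ?e0" and e1: "0 \<le> ?e1"
    using weight_bounds[OF lam p0(1) p0'] by (auto intro!: Bochner_Integration.integral_nonneg)
  have wexp: "weight lam p0 R = exp (- g_Mei lam p0 R)" for R
    using weight_denominator_pos[OF lam p0, of R] by (simp add: weight_def g_Mei_def exp_minus inverse_eq_divide)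
  have one: "(\<integral>\<^sup>+\<omega>. (if score (add_mean \<mu> \<nu> A \<omega>) s M < b then 1 else 0) \<partial>P_inf N)
      \<le> ennreal (exp b) * (\<Prod>n\<in>{1..N}. ennreal (if n \<in> A then ?e1 else ?e0))" for A
  proof -
    let ?w = "\<lambda>n \<omega>. ennreal (weight lam p0 (sc (add_mean \<mu> \<nu> A \<omega>) n s M))"
    have "(\<integral>\<^sup>+\<omega>. (if score (add_mean \<mu> \<nu> A \<omega>) s M < b then 1 else 0) \<partial>P_inf N)
        \<le> (\<integral>\<^sup>+\<omega>. ennreal (exp b) * (\<Prod>n\<in>{1..N}. ?w n \<omega>) \<partial>P_inf N)"
    proof (intro nn_integral_mono)
      fix \<omega>
      have "ennreal (exp b) * (\<Prod>n\<in>{1..N}. ?w n \<omega>) = ennreal (exp (b - score (add_mean \<mu> \<nu> A \<omega>) s M))"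
        by (simp add: wexp prod_ennreal exp_sum[symmetric] score_def ennreal_mult'[symmetric] sum_negf flip: exp_add)
      moreover have "1 \<le> ennreal (exp (b - score (add_mean \<mu> \<nu> A \<omega>) s M))" if "score (add_mean \<mu> \<nu> A \<omega>) s M < b"
        using that by simp
      ultimately show "(if score (add_mean \<mu> \<nu> A \<omega>) s M < b then 1 else 0) \<le> ennreal (exp b) * (\<Prod>n\<in>{1..N}. ?w n \<omega>)"
        by auto
    qed
    also have "\<dots> = ennreal (exp b) * (\<integral>\<^sup>+\<omega>. (\<Prod>n\<in>{1..N}. ?w n \<omega>) \<partial>P_inf N)"
      by (rule nn_integral_cmult) auto
    also have "(\<integral>\<^sup>+\<omega>. (\<Prod>n\<in>{1..N}. ?w n \<omega>) \<partial>P_inf N) = (\<Prod>n\<in>{1..N}. \<integral>\<^sup>+\<omega>. ?w n \<omega> \<partial>P_inf N)"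
      unfolding P_inf_def
    proof (rule nn_integral_PiM_blocks[OF prob_space_stdn, where K="\<lambda>n. {n} \<times> {s<..s+M}"])
      fix n \<omega>
      show "?w n (restrict \<omega> ({n} \<times> {s<..s + M})) = ?w n \<omega>"
        by (intro arg_cong[where f="\<lambda>x. ennreal (weight lam p0 x)"] sc_cong) (auto simp: add_mean_def)
    qed (auto simp: disjoint_family_on_def obs_index_def)
    also have "\<dots> = (\<Prod>n\<in>{1..N}. ennreal (if n \<in> A then ?e1 else ?e0))"
    proof (intro prod.cong refl)
      fix n assume n: "n \<in> {1..N}"
      let ?x = "\<lambda>x i. x i + (if n \<in> A \<and> h \<le> i then \<mu> else 0)"
      \<comment> \<open>Input i is observed at time s + i + 1, and s + h = \<nu> - 1; so exactly the
        inputs with h \<le> i are post-change.\<close>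
      have "sc (add_mean \<mu> \<nu> A \<omega>) n s M = rcus m 0 (?x (\<lambda>i. \<omega> (n, s + Suc i))) M" for \<omega>
        unfolding sc_def using s by (intro rcus_cong) (auto simp: add_mean_def obs_mean_def)
      then have "(\<integral>\<^sup>+\<omega>. ?w n \<omega> \<partial>P_inf N) = (\<integral>\<^sup>+x. ennreal (weight lam p0 (rcus m 0 (?x x) M)) \<partial>stream)"
        using nn_integral_P_inf_stream[OF n, of "\<lambda>x. ennreal (weight lam p0 (rcus m 0 (?x x) M))" s] by simp
      also have "\<dots> = ennreal (\<integral>x. weight lam p0 (rcus m 0 (?x x) M) \<partial>stream)"
        using lam p0 p0' weight_bounds[OF lam p0(1) p0']
        by (intro nn_integral_eq_integral integrable_weight_rcus prob_space_stream) auto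
      also have "\<dots> = ennreal (if n \<in> A then ?e1 else ?e0)" by auto
      finally show "(\<integral>\<^sup>+\<omega>. ?w n \<omega> \<partial>P_inf N) = ennreal (if n \<in> A then ?e1 else ?e0)" .
    qed
    finally show ?thesis .
  qed
  have "miss_prob \<mu> p \<nu> s M \<le> (\<integral>\<^sup>+A. ennreal (exp b) * (\<Prod>n\<in>{1..N}. ennreal (if n \<in> A then ?e1 else ?e0)) \<partial>measure_pmf (affected_pmf N p))"
    unfolding miss_prob_def by (intro nn_integral_mono one)
  also have "\<dots> = ennreal (exp b) * ennreal (\<Prod>n\<in>{1..N}. (1 - p) * ?e0 + p * ?e1)"
    using nn_integral_affected_prod[of p "\<lambda>_. ?e0" "\<lambda>_. ?e1" N] p e0 e1 by (simp add: nn_integral_cmult)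
  also have "\<dots> = ennreal (exp b * ((1 - p) * ?e0 + p * ?e1) ^ N)"
    by (simp add: ennreal_mult')
  finally show ?thesis .
qed

text \<open>The survival probabilities are split at k. Each of the first k is at most
  \<open>tail (\<nu> - 1)\<close>; the others are at most \<open>tail s * q * tail i\<close> and add
  up to \<open>tail s * q * \<gamma>\<close>. The window hypothesis gives
  \<open>tail s \<le> 2 * tail (\<nu> - 1)\<close>, the origin of the factor 2.\<close>

lemma cond_delay_le:
  assumes \<mu>: "0 \<le> \<mu>" and \<nu>: "1 \<le> \<nu>" "h \<le> \<nu> - 1" and k: "1 \<le> k"
    and arl: "ARL N T = ennreal \<gamma>" and \<gamma>: "1 \<le> \<gamma>"
    and window: "1/2 \<le> tail (L + h) - N * (cusum_bound m (1/2) * exp (- m\<^sup>2 / 8) ^ L)"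
    and miss: "miss_prob \<mu> p \<nu> (\<nu> - 1 - h) (h + k) \<le> ennreal q" and q: "0 \<le> q"
    and pos: "0 < tail (\<nu> - 1)"
  shows "cond_delay N \<mu> p T \<nu> \<le> ennreal (k + 2 * \<gamma> * q)"
proof -
  define s where "s = \<nu> - 1 - h"
  have s: "s + h = \<nu> - 1" "s < \<nu>" using \<nu> by (auto simp: s_def)
  have "tail s * (1/2) \<le> tail s * (tail (L + h) - N * (cusum_bound m (1/2) * exp (- m\<^sup>2 / 8) ^ L))"
    by (intro mult_left_mono window tail_nonneg)
  also have "\<dots> \<le> tail (\<nu> - 1)" using tail_add_ge[of s L h] s by simp
  finally have half: "tail s \<le> 2 * tail (\<nu> - 1)" by simp
  have early: "late_prob \<mu> p \<nu> (\<nu> - 1 + j) \<le> ennreal (tail (\<nu> - 1))" for j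
  proof -
    have "late_prob \<mu> p \<nu> (\<nu> - 1 + j) \<le> late_prob \<mu> p \<nu> (\<nu> - 1)"
      unfolding late_prob_def by (intro emeasure_mono) (auto simp: quiet_def)
    then show ?thesis using \<nu> by (simp add: late_prob_pre)
  qed
  have late: "late_prob \<mu> p \<nu> (\<nu> - 1 + (k + i)) \<le> ennreal (tail s * q) * ennreal (tail i)" for i
  proof -
    have "late_prob \<mu> p \<nu> (s + (h + k) + i) \<le> ennreal (tail s) * miss_prob \<mu> p \<nu> s (h + k) * ennreal (tail i)"
      using k by (intro late_prob_le \<mu> s) auto
    also have "\<dots> \<le> ennreal (tail s) * ennreal q * ennreal (tail i)"
      using miss by (intro mult_right_mono mult_left_mono) (auto simp: s_def)
    also have "s + (h + k) + i = \<nu> - 1 + (k + i)" using s by simp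
    finally show ?thesis using q by (simp add: ennreal_mult tail_nonneg)
  qed
  have "(\<Sum>j. late_prob \<mu> p \<nu> (\<nu> - 1 + j)) = (\<Sum>i. late_prob \<mu> p \<nu> (\<nu> - 1 + (i + k))) + (\<Sum>j<k. late_prob \<mu> p \<nu> (\<nu> - 1 + j))"
    by (rule suminf_offset) auto
  also have "\<dots> \<le> (\<Sum>i. ennreal (tail s * q) * ennreal (tail i)) + (\<Sum>j<k. ennreal (tail (\<nu> - 1)))"
    using late by (intro add_mono suminf_le sum_mono early) (auto simp: add.commute)
  also have "(\<Sum>i. ennreal (tail s * q) * ennreal (tail i)) = ennreal (tail s * q) * ennreal \<gamma>"
    by (simp add: arl[symmetric] ARL_eq)
  also have "ennreal (tail s * q) * ennreal \<gamma> + (\<Sum>j<k. ennreal (tail (\<nu> - 1))) = ennreal (tail s * q * \<gamma> + k * tail (\<nu> - 1))"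
    using \<gamma> q by (simp add: ennreal_mult' tail_nonneg ennreal_of_nat_eq_real_of_nat)
  also have "\<dots> \<le> ennreal ((k + 2 * \<gamma> * q) * tail (\<nu> - 1))"
  proof (intro ennreal_leI)
    have "tail s * (q * \<gamma>) \<le> 2 * tail (\<nu> - 1) * (q * \<gamma>)" using half \<gamma> q by (intro mult_right_mono) auto
    then show "tail s * q * \<gamma> + k * tail (\<nu> - 1) \<le> (k + 2 * \<gamma> * q) * tail (\<nu> - 1)" by (simp add: algebra_simps)
  qed
  also have "\<dots> = ennreal (k + 2 * \<gamma> * q) * ennreal (tail (\<nu> - 1))"
    using pos by (intro ennreal_mult'') auto
  finally have "(\<Sum>j. late_prob \<mu> p \<nu> (\<nu> - 1 + j)) / ennreal (tail (\<nu> - 1)) \<le> ennreal (k + 2 * \<gamma> * q) * ennreal (tail (\<nu> - 1)) / ennreal (tail (\<nu> - 1))"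
    by (rule divide_right_mono_ennreal)
  also have "\<dots> = ennreal (k + 2 * \<gamma> * q)"
    using pos by (subst ennreal_mult_divide_eq) auto
  finally show ?thesis unfolding cond_delay_eq[OF \<nu>(1)] .
qed


section \<open>The likelihood ratio of the mixture\<close>

definition lik :: "real \<Rightarrow> nat \<Rightarrow> nat \<Rightarrow> nat \<Rightarrow> (nat \<times> nat \<Rightarrow> real) \<Rightarrow> real" where
  "lik \<mu> \<nu> w n \<omega> = (\<Prod>t\<in>{\<nu>..<\<nu> + w}. exp (\<mu> * \<omega> (n, t) + - \<mu>\<^sup>2 / 2))"

text \<open>The likelihood ratio of one stream with its membership averaged out. The factor 1 is
  kept so that the term matches \<open>nn_integral_affected_prod\<close>, with 1 as the likelihood
  ratio of an unaffected stream.\<close>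

definition mix :: "real \<Rightarrow> real \<Rightarrow> nat \<Rightarrow> nat \<Rightarrow> nat \<Rightarrow> (nat \<times> nat \<Rightarrow> real) \<Rightarrow> real" where
  "mix \<mu> p \<nu> w n \<omega> = (1 - p) * 1 + p * lik \<mu> \<nu> w n \<omega>"

lemma lik_pos: "0 < lik \<mu> \<nu> w n \<omega>"
  unfolding lik_def by (intro prod_pos) auto

lemma measurable_lik [measurable]:
  assumes [measurable]: "\<And>i. (\<lambda>\<omega>. \<omega> i) \<in> borel_measurable M"
  shows "lik \<mu> \<nu> w n \<in> borel_measurable M"
  unfolding lik_def by measurable

lemma measurable_mix [measurable]:
  assumes [measurable]: "\<And>i. (\<lambda>\<omega>. \<omega> i) \<in> borel_measurable M"
  shows "mix \<mu> p \<nu> w n \<in> borel_measurable M"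
  unfolding mix_def by measurable

lemma nn_integral_lik_powr:
  assumes n: "n \<in> {1..N}" and \<nu>: "1 \<le> \<nu>"
  shows "(\<integral>\<^sup>+\<omega>. ennreal (lik \<mu> \<nu> w n \<omega> powr a) \<partial>P_inf N) = ennreal (exp (a * (a - 1) * (w * \<mu>\<^sup>2 / 2)))"
proof -
  have "lik \<mu> \<nu> w n \<omega> powr a = (\<Prod>i\<in>{n} \<times> {\<nu>..<\<nu> + w}. exp (a * \<mu> * \<omega> i + - a * \<mu>\<^sup>2 / 2))" for \<omega>
  proof -
    have "lik \<mu> \<nu> w n \<omega> powr a = (\<Prod>t\<in>{\<nu>..<\<nu> + w}. exp (\<mu> * \<omega> (n, t) + - \<mu>\<^sup>2 / 2) powr a)"
      unfolding lik_def by (rule prod_powr_distrib)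
    also have "\<dots> = (\<Prod>t\<in>{\<nu>..<\<nu> + w}. exp (a * \<mu> * \<omega> (n, t) + - a * \<mu>\<^sup>2 / 2))"
      by (intro prod.cong refl) (simp add: powr_def algebra_simps)
    also have "\<dots> = (\<Prod>i\<in>{n} \<times> {\<nu>..<\<nu> + w}. exp (a * \<mu> * \<omega> i + - a * \<mu>\<^sup>2 / 2))"
    proof -
      have "{n} \<times> {\<nu>..<\<nu> + w} = (\<lambda>t. (n, t)) ` {\<nu>..<\<nu> + w}" by auto
      then show ?thesis by (simp add: prod.reindex inj_on_def)
    qed
    finally show ?thesis .
  qed
  moreover have "{n} \<times> {\<nu>..<\<nu> + w} \<subseteq> obs_index N" using n \<nu> by (auto simp: obs_index_def)
  ultimately have "(\<integral>\<^sup>+\<omega>. ennreal (lik \<mu> \<nu> w n \<omega> powr a) \<partial>P_inf N) = ennreal (exp ((a * \<mu>)\<^sup>2 / 2 + - a * \<mu>\<^sup>2 / 2)) ^ w"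
    unfolding P_inf_def using nn_integral_coord_exp[of "{n} \<times> {\<nu>..<\<nu> + w}" "obs_index N" "a * \<mu>" "- a * \<mu>\<^sup>2 / 2"]
    by (simp add: card_cartesian_product)
  also have "\<dots> = ennreal (exp (real w * ((a * \<mu>)\<^sup>2 / 2 + - a * \<mu>\<^sup>2 / 2)))"
    by (simp add: ennreal_power exp_of_nat_mult)
  also have "real w * ((a * \<mu>)\<^sup>2 / 2 + - a * \<mu>\<^sup>2 / 2) = a * (a - 1) * (w * \<mu>\<^sup>2 / 2)"
    by (simp add: power2_eq_square field_simps)
  finally show ?thesis .
qed

text \<open>Here mix = 1 + y with y = p (lik - 1) of mean zero, so in
  \<open>powr_one_plus_le\<close> the linear term disappears and the excess over 1 is of order p^a E
  lik^a.\<close>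

lemma nn_integral_mix_powr:
  assumes n: "n \<in> {1..N}" and \<nu>: "1 \<le> \<nu>" and p: "0 < p" "p < 1" and a: "1 < a" "a \<le> 2"
  shows "(\<integral>\<^sup>+\<omega>. ennreal (mix \<mu> p \<nu> w n \<omega> powr a) \<partial>P_inf N)
    \<le> ennreal (1 + 2 * p powr a * exp (a * (a - 1) * (w * \<mu>\<^sup>2 / 2)))"
proof -
  interpret prob_space "P_inf N" by (rule prob_space_P_inf)
  let ?E = "exp (a * (a - 1) * (w * \<mu>\<^sup>2 / 2))"
  let ?l = "lik \<mu> \<nu> w n"
  \<comment> \<open>The negative term - a p stands on the left, so that both sides can be integrated
    in \<open>ennreal\<close> and the term cancelled afterwards.\<close>
  have pt: "mix \<mu> p \<nu> w n \<omega> powr a + a * p \<le> 1 + p powr a + a * p * ?l \<omega> + p powr a * ?l \<omega> powr a" for \<omega>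
  proof -
    have l: "0 < ?l \<omega>" by (rule lik_pos)
    define y where "y = p * (?l \<omega> - 1)"
    have "0 < p * ?l \<omega>" using p l by simp
    then have y: "- 1 \<le> y" using p unfolding y_def right_diff_distrib mult_1_right by linarith
    have "\<bar>?l \<omega> - 1\<bar> powr a \<le> 1 + ?l \<omega> powr a"
    proof (cases "1 \<le> ?l \<omega>")
      case True
      then have "\<bar>?l \<omega> - 1\<bar> powr a \<le> ?l \<omega> powr a" using a by (intro powr_mono2) auto
      then show ?thesis by simp
    next
      case False
      then have "\<bar>?l \<omega> - 1\<bar> powr a \<le> 1 powr a" using a l by (intro powr_mono2) auto
      then have "\<bar>?l \<omega> - 1\<bar> powr a \<le> 1" by simp
      then show ?thesis using powr_ge_zero[of "?l \<omega>" a] by linarith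
    qed
    then have "p powr a * \<bar>?l \<omega> - 1\<bar> powr a \<le> p powr a * (1 + ?l \<omega> powr a)" by (intro mult_left_mono) auto
    moreover have "\<bar>y\<bar> powr a = p powr a * \<bar>?l \<omega> - 1\<bar> powr a"
      using p by (simp add: y_def abs_mult powr_mult)
    moreover have "mix \<mu> p \<nu> w n \<omega> = 1 + y" by (simp add: mix_def y_def algebra_simps)
    moreover have "a * y = a * p * ?l \<omega> - a * p" by (simp add: y_def algebra_simps)
    ultimately show ?thesis
      using powr_one_plus_le[OF a y] by (simp add: distrib_left)
  qed
  have "(\<integral>\<^sup>+\<omega>. ennreal (mix \<mu> p \<nu> w n \<omega> powr a) \<partial>P_inf N) + ennreal (a * p)
      = (\<integral>\<^sup>+\<omega>. ennreal (mix \<mu> p \<nu> w n \<omega> powr a) + ennreal (a * p) \<partial>P_inf N)"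
    by (subst nn_integral_add) (auto simp: emeasure_space_1)
  also have "\<dots> \<le> (\<integral>\<^sup>+\<omega>. ennreal (1 + p powr a) + ennreal (a * p) * ennreal (?l \<omega> powr 1) + ennreal (p powr a) * ennreal (?l \<omega> powr a) \<partial>P_inf N)"
  proof (intro nn_integral_mono)
    fix \<omega>
    have "ennreal (mix \<mu> p \<nu> w n \<omega> powr a) + ennreal (a * p) = ennreal (mix \<mu> p \<nu> w n \<omega> powr a + a * p)"
      using p a by simp
    also have "\<dots> \<le> ennreal (1 + p powr a + a * p * ?l \<omega> + p powr a * ?l \<omega> powr a)"
      by (rule ennreal_leI[OF pt])
    also have "\<dots> = ennreal (1 + p powr a) + ennreal (a * p) * ennreal (?l \<omega> powr 1) + ennreal (p powr a) * ennreal (?l \<omega> powr a)"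
      using p a lik_pos[of \<mu> \<nu> w n \<omega>] by (simp add: ennreal_mult'[symmetric] ennreal_plus[symmetric] del: ennreal_plus)
    finally show "ennreal (mix \<mu> p \<nu> w n \<omega> powr a) + ennreal (a * p) \<le> \<dots>" .
  qed
  also have "\<dots> = ennreal (1 + p powr a) + ennreal (a * p) * (\<integral>\<^sup>+\<omega>. ennreal (?l \<omega> powr 1) \<partial>P_inf N)
      + ennreal (p powr a) * (\<integral>\<^sup>+\<omega>. ennreal (?l \<omega> powr a) \<partial>P_inf N)"
    by (simp add: nn_integral_add nn_integral_cmult emeasure_space_1)
  also have "\<dots> = ennreal (1 + p powr a + p powr a * ?E) + ennreal (a * p)"
    using p a by (simp only: nn_integral_lik_powr[OF n \<nu>])
      (simp add: ennreal_mult'[symmetric] ennreal_plus[symmetric] algebra_simps del: ennreal_plus)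
  finally have "(\<integral>\<^sup>+\<omega>. ennreal (mix \<mu> p \<nu> w n \<omega> powr a) \<partial>P_inf N) \<le> ennreal (1 + p powr a + p powr a * ?E)"
    by (simp only: ennreal_add_left_cancel_le add.commute[of _ "ennreal (a * p)"]) simp
  also have "\<dots> \<le> ennreal (1 + 2 * p powr a * ?E)"
  proof (intro ennreal_leI)
    have "1 \<le> ?E" using a by simp
    then have "p powr a * 1 \<le> p powr a * ?E" by (intro mult_left_mono) auto
    then show "1 + p powr a + p powr a * ?E \<le> 1 + 2 * p powr a * ?E" by simp
  qed
  finally show ?thesis .
qed

text \<open>An alarm at one of the times \<nu>, ..., \<nu> + w - 1 is decided by the observations
  before \<nu> + w, so a likelihood ratio applies for each affected set; its average over the sets
  is the product of the mixtures. The identity is additive because subtraction in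
  \<open>ennreal\<close> is truncated.\<close>

lemma late_prob_diff:
  assumes \<nu>: "1 \<le> \<nu>" and p: "0 < p" "p < 1"
  shows "ennreal (tail (\<nu> - 1)) = late_prob \<mu> p \<nu> (\<nu> - 1 + w)
    + (\<integral>\<^sup>+\<omega>. (if quiet \<omega> 0 (\<nu> - 1) \<and> \<not> quiet \<omega> 0 (\<nu> - 1 + w) then 1 else 0) * ennreal (\<Prod>n\<in>{1..N}. mix \<mu> p \<nu> w n \<omega>) \<partial>P_inf N)"
proof -
  let ?P = "P_change N \<mu> p \<nu>"
  let ?q = "\<lambda>\<omega>. quiet \<omega> 0 (\<nu> - 1) \<and> \<not> quiet \<omega> 0 (\<nu> - 1 + w)"
  let ?f = "\<lambda>\<omega>. if ?q \<omega> then 1 else 0 :: ennreal"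
  let ?L = "\<lambda>A \<omega>. \<Prod>n\<in>{1..N}. ennreal (if n \<in> A then lik \<mu> \<nu> w n \<omega> else 1)"
  have fm: "?f \<in> borel_measurable (P_inf N)" by measurable
  have fmK: "?f \<in> borel_measurable (PiM K (\<lambda>_. stdn))" for K by measurable
  have dep: "?f (restrict \<omega> (obs_index N)) = ?f \<omega>" for \<omega> by (simp add: quiet_restrict)
  have dep2: "?f (restrict \<omega> ({1..N} \<times> {1..<\<nu> + w})) = ?f \<omega>" for \<omega>
  proof -
    have "quiet (restrict \<omega> ({1..N} \<times> {1..<\<nu> + w})) 0 j = quiet \<omega> 0 j" if "j \<le> \<nu> - 1 + w" for j
      using that \<nu> by (intro quiet_cong) (auto simp: block_def)
    then show ?thesis by simp
  qed
  have "ennreal (tail (\<nu> - 1)) = late_prob \<mu> p \<nu> (\<nu> - 1)" using \<nu> by (simp add: late_prob_pre)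
  also have "\<dots> = emeasure ?P ({\<omega> \<in> space ?P. quiet \<omega> 0 (\<nu> - 1 + w)} \<union> {\<omega> \<in> space ?P. ?q \<omega>})"
    unfolding late_prob_def by (intro arg_cong[where f="emeasure ?P"]) (auto simp: quiet_def)
  also have "\<dots> = late_prob \<mu> p \<nu> (\<nu> - 1 + w) + emeasure ?P {\<omega> \<in> space ?P. ?q \<omega>}"
    unfolding late_prob_def by (intro plus_emeasure[symmetric]) auto
  also have "emeasure ?P {\<omega> \<in> space ?P. ?q \<omega>} = (\<integral>\<^sup>+\<omega>. ?f \<omega> \<partial>?P)"
    by (subst nn_integral_if_eq_emeasure) auto
  also have "\<dots> = (\<integral>\<^sup>+A. \<integral>\<^sup>+\<omega>. ?f (add_mean \<mu> \<nu> A \<omega>) \<partial>P_inf N \<partial>measure_pmf (affected_pmf N p))"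
    by (rule nn_integral_P_change[OF fm dep])
  also have "\<dots> = (\<integral>\<^sup>+A. \<integral>\<^sup>+\<omega>. ?f \<omega> * ?L A \<omega> \<partial>P_inf N \<partial>measure_pmf (affected_pmf N p))"
    unfolding nn_integral_P_given[OF fm dep, symmetric] lik_def
    by (intro nn_integral_cong nn_integral_P_given_likelihood[OF \<nu> fmK dep2])
  \<comment> \<open>There are finitely many affected sets, so exchanging the two integrals is
    exchanging an integral with a finite sum.\<close>
  also have "\<dots> = (\<Sum>A\<in>set_pmf (affected_pmf N p). (\<integral>\<^sup>+\<omega>. ?f \<omega> * ?L A \<omega> \<partial>P_inf N) * ennreal (pmf (affected_pmf N p) A))"
    by (rule nn_integral_measure_pmf_finite[OF finite_set_affected_pmf, where f="\<lambda>A. \<integral>\<^sup>+\<omega>. ?f \<omega> * ?L A \<omega> \<partial>P_inf N"]) simp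
  also have "\<dots> = (\<Sum>A\<in>set_pmf (affected_pmf N p). \<integral>\<^sup>+\<omega>. ?f \<omega> * ?L A \<omega> * ennreal (pmf (affected_pmf N p) A) \<partial>P_inf N)"
    by (intro sum.cong refl nn_integral_multc[symmetric]) simp
  also have "\<dots> = (\<integral>\<^sup>+\<omega>. (\<Sum>A\<in>set_pmf (affected_pmf N p). ?f \<omega> * ?L A \<omega> * ennreal (pmf (affected_pmf N p) A)) \<partial>P_inf N)"
    by (intro nn_integral_sum[symmetric]) simp
  also have "\<dots> = (\<integral>\<^sup>+\<omega>. ?f \<omega> * ennreal (\<Prod>n\<in>{1..N}. mix \<mu> p \<nu> w n \<omega>) \<partial>P_inf N)"
  proof (intro nn_integral_cong)
    fix \<omega>
    have "(\<Sum>A\<in>set_pmf (affected_pmf N p). ?f \<omega> * ?L A \<omega> * ennreal (pmf (affected_pmf N p) A))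
        = (\<integral>\<^sup>+A. ?f \<omega> * ?L A \<omega> \<partial>measure_pmf (affected_pmf N p))"
      by (rule nn_integral_measure_pmf_finite[OF finite_set_affected_pmf, where f="\<lambda>A. ?f \<omega> * ?L A \<omega>", symmetric]) simp
    also have "\<dots> = ?f \<omega> * (\<integral>\<^sup>+A. ?L A \<omega> \<partial>measure_pmf (affected_pmf N p))"
      by (rule nn_integral_cmult) simp
    also have "(\<integral>\<^sup>+A. ?L A \<omega> \<partial>measure_pmf (affected_pmf N p)) = ennreal (\<Prod>n\<in>{1..N}. mix \<mu> p \<nu> w n \<omega>)"
      unfolding mix_def using p lik_pos[of \<mu> \<nu> w _ \<omega>]
      by (intro nn_integral_affected_prod) (auto intro: less_imp_le)
    finally show "(\<Sum>A\<in>set_pmf (affected_pmf N p). ?f \<omega> * ?L A \<omega> * ennreal (pmf (affected_pmf N p) A))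
        = ?f \<omega> * ennreal (\<Prod>n\<in>{1..N}. mix \<mu> p \<nu> w n \<omega>)" .
  qed
  finally show ?thesis .
qed

text \<open>The likelihood ratio L is split at exp C. Below, the null probability of an alarm in the
  window is multiplied by at most exp C. Above, L \<le> exp (- s C) L^(1+s); there the alarm event
  is enlarged to \<open>quiet \<omega> 0 (\<nu> - 1)\<close>, which is independent of the
  observations in L. Thus both errors carry the factor \<open>tail (\<nu> - 1)\<close> that the
  conditioning divides out.\<close>

lemma late_prob_ge:
  assumes \<nu>: "1 \<le> \<nu>" and p: "0 < p" "p < 1" and s: "0 < s" "s \<le> 1"
    and drop: "tail (\<nu> - 1) - tail (\<nu> - 1 + w) \<le> \<delta> * tail (\<nu> - 1)"
  shows "ennreal (tail (\<nu> - 1)) \<le> late_prob \<mu> p \<nu> (\<nu> - 1 + w) + ennreal (tail (\<nu> - 1) *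
    (exp C * \<delta> + exp (- s * C) * (1 + 2 * p powr (1 + s) * exp (s * (1 + s) * (w * \<mu>\<^sup>2 / 2))) ^ N))"
proof -
  interpret prob_space "P_inf N" by (rule prob_space_P_inf)
  let ?E = "1 + 2 * p powr (1 + s) * exp (s * (1 + s) * (w * \<mu>\<^sup>2 / 2))"
  let ?f = "\<lambda>\<omega>. if quiet \<omega> 0 (\<nu> - 1) \<and> \<not> quiet \<omega> 0 (\<nu> - 1 + w) then 1 else 0 :: ennreal"
  let ?g = "\<lambda>\<omega>. if quiet \<omega> 0 (\<nu> - 1) then 1 else 0 :: ennreal"
  let ?L = "\<lambda>\<omega>. \<Prod>n\<in>{1..N}. mix \<mu> p \<nu> w n \<omega>"
  let ?M = "\<lambda>\<omega>. \<Prod>n\<in>{1..N}. ennreal (mix \<mu> p \<nu> w n \<omega> powr (1 + s))"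
  have mixpos: "0 < mix \<mu> p \<nu> w n \<omega>" for n \<omega>
    unfolding mix_def using p lik_pos[of \<mu> \<nu> w n \<omega>] by (intro add_pos_pos mult_pos_pos) auto
  have Lpos: "0 < ?L \<omega>" for \<omega> using mixpos by (intro prod_pos) auto
  have Mpow: "?M \<omega> = ennreal (?L \<omega> powr (1 + s))" for \<omega>
    using mixpos by (simp add: prod_ennreal prod_powr_distrib less_imp_le)
  have fint: "(\<integral>\<^sup>+\<omega>. ?f \<omega> \<partial>P_inf N) \<le> ennreal (\<delta> * tail (\<nu> - 1))"
  proof -
    have "(\<integral>\<^sup>+\<omega>. ?f \<omega> \<partial>P_inf N) = emeasure (P_inf N) ({\<omega> \<in> space (P_inf N). quiet \<omega> 0 (\<nu> - 1)} - {\<omega> \<in> space (P_inf N). quiet \<omega> 0 (\<nu> - 1 + w)})"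
      by (subst nn_integral_if_eq_emeasure) (auto intro!: arg_cong[where f="emeasure (P_inf N)"])
    also have "\<dots> = ennreal (tail (\<nu> - 1) - tail (\<nu> - 1 + w))"
      unfolding emeasure_eq_measure tail_def by (subst finite_measure_Diff) (auto simp: quiet_def)
    finally show ?thesis using drop by (simp add: ennreal_leI)
  qed
  have M_le: "(\<integral>\<^sup>+\<omega>. ?M \<omega> \<partial>P_inf N) \<le> ennreal (?E ^ N)"
  proof -
    have "(\<integral>\<^sup>+\<omega>. ?M \<omega> \<partial>P_inf N) = (\<Prod>n\<in>{1..N}. \<integral>\<^sup>+\<omega>. ennreal (mix \<mu> p \<nu> w n \<omega> powr (1 + s)) \<partial>P_inf N)"
      unfolding P_inf_def
    proof (rule nn_integral_PiM_blocks[OF prob_space_stdn, where K="\<lambda>n. {n} \<times> {\<nu>..<\<nu> + w}"])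
      fix n \<omega>
      show "ennreal (mix \<mu> p \<nu> w n (restrict \<omega> ({n} \<times> {\<nu>..<\<nu> + w})) powr (1 + s)) = ennreal (mix \<mu> p \<nu> w n \<omega> powr (1 + s))"
        unfolding mix_def lik_def
        by (intro prod.cong refl arg_cong[where f="\<lambda>x. ennreal (((1 - p) * 1 + p * x) powr (1 + s))"]) auto
    qed (use \<nu> in \<open>auto simp: disjoint_family_on_def obs_index_def\<close>)
    also have "\<dots> \<le> (\<Prod>n\<in>{1..N}. ennreal ?E)"
      using nn_integral_mix_powr[OF _ \<nu> p, of _ "1 + s" \<mu> w] s by (intro prod_mono_ennreal) (simp add: mult.commute)
    also have "(\<Prod>n\<in>{1..N}. ennreal ?E) = ennreal (?E ^ N)" by (simp add: ennreal_power del: ennreal_plus)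
    finally show ?thesis .
  qed
  have "(\<integral>\<^sup>+\<omega>. ?f \<omega> * ennreal (?L \<omega>) \<partial>P_inf N)
      \<le> (\<integral>\<^sup>+\<omega>. ennreal (exp C) * ?f \<omega> + ennreal (exp (- s * C)) * (?g \<omega> * ?M \<omega>) \<partial>P_inf N)"
  proof (intro nn_integral_mono)
    fix \<omega>
    show "?f \<omega> * ennreal (?L \<omega>) \<le> ennreal (exp C) * ?f \<omega> + ennreal (exp (- s * C)) * (?g \<omega> * ?M \<omega>)"
    proof (cases "?L \<omega> \<le> exp C")
      case True
      then have "?f \<omega> * ennreal (?L \<omega>) \<le> ennreal (exp C) * ?f \<omega>"
        by (auto intro: ennreal_leI)
      then show ?thesis by (rule order_trans) simp
    next
      case False
      have "1 \<le> (?L \<omega> / exp C) powr s" using False s by (intro ge_one_powr_ge_zero) (auto simp: divide_simps)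
      then have "?L \<omega> * 1 \<le> ?L \<omega> * (?L \<omega> / exp C) powr s" using Lpos[of \<omega>] by (intro mult_left_mono) auto
      also have "\<dots> = exp (- s * C) * ?L \<omega> powr (1 + s)"
        using Lpos[of \<omega>] by (simp add: powr_divide powr_add powr_def[of "exp C"] exp_minus field_simps less_imp_le)
      finally have "ennreal (?L \<omega>) \<le> ennreal (exp (- s * C)) * ?M \<omega>"
        unfolding Mpow by (simp add: ennreal_mult'[symmetric] ennreal_leI)
      then have "?f \<omega> * ennreal (?L \<omega>) \<le> ennreal (exp (- s * C)) * (?g \<omega> * ?M \<omega>)"
        by auto
      then show ?thesis by (rule order_trans) simp
    qed
  qed
  also have "\<dots> = ennreal (exp C) * (\<integral>\<^sup>+\<omega>. ?f \<omega> \<partial>P_inf N) + ennreal (exp (- s * C)) * (\<integral>\<^sup>+\<omega>. ?g \<omega> * ?M \<omega> \<partial>P_inf N)"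
    by (subst nn_integral_add) (auto simp: nn_integral_cmult)
  also have "(\<integral>\<^sup>+\<omega>. ?g \<omega> * ?M \<omega> \<partial>P_inf N) = (\<integral>\<^sup>+\<omega>. ?g \<omega> \<partial>P_inf N) * (\<integral>\<^sup>+\<omega>. ?M \<omega> \<partial>P_inf N)"
    unfolding P_inf_def
  proof (rule nn_integral_PiM_indep2[OF prob_space_stdn, where K="block 0 (\<nu> - 1)" and K'="block (\<nu> - 1) w"])
    fix \<omega>
    show "?g (restrict \<omega> (block 0 (\<nu> - 1))) = ?g \<omega>"
      using quiet_cong[of 0 "\<nu> - 1" "restrict \<omega> (block 0 (\<nu> - 1))" \<omega>] by auto
    show "?M (restrict \<omega> (block (\<nu> - 1) w)) = ?M \<omega>"
      unfolding mix_def lik_def using \<nu>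
      by (intro prod.cong refl arg_cong[where f="\<lambda>x. ennreal (((1 - p) * 1 + p * x) powr (1 + s))"]) (auto simp: block_def)
  qed (auto simp: block_disjoint block_subset)
  also have "(\<integral>\<^sup>+\<omega>. ?g \<omega> \<partial>P_inf N) = ennreal (tail (\<nu> - 1))" by (simp add: nn_integral_if_eq_emeasure emeasure_quiet)
  also have "ennreal (exp C) * (\<integral>\<^sup>+\<omega>. ?f \<omega> \<partial>P_inf N) + ennreal (exp (- s * C)) * (ennreal (tail (\<nu> - 1)) * (\<integral>\<^sup>+\<omega>. ?M \<omega> \<partial>P_inf N))
      \<le> ennreal (exp C) * ennreal (\<delta> * tail (\<nu> - 1)) + ennreal (exp (- s * C)) * (ennreal (tail (\<nu> - 1)) * ennreal (?E ^ N))"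
    by (intro add_mono mult_left_mono fint M_le) auto
  also have "\<dots> = ennreal (tail (\<nu> - 1) * (exp C * \<delta> + exp (- s * C) * ?E ^ N))"
  proof -
    have "0 \<le> \<delta> * tail (\<nu> - 1)" using drop tail_antimono[of "\<nu> - 1" "\<nu> - 1 + w"] by simp
    then have n1: "0 \<le> exp C * (\<delta> * tail (\<nu> - 1))" by simp
    have "0 \<le> ?E" by (intro add_nonneg_nonneg) auto
    then have n2: "0 \<le> exp (- s * C) * (tail (\<nu> - 1) * ?E ^ N)" using tail_nonneg by simp
    have "ennreal (exp C) * ennreal (\<delta> * tail (\<nu> - 1)) + ennreal (exp (- s * C)) * (ennreal (tail (\<nu> - 1)) * ennreal (?E ^ N))
        = ennreal (exp C * (\<delta> * tail (\<nu> - 1))) + ennreal (exp (- s * C) * (tail (\<nu> - 1) * ?E ^ N))"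
      by (simp only: ennreal_mult'[OF exp_ge_zero] ennreal_mult'[OF tail_nonneg])
    also have "\<dots> = ennreal (exp C * (\<delta> * tail (\<nu> - 1)) + exp (- s * C) * (tail (\<nu> - 1) * ?E ^ N))"
      by (rule ennreal_plus[OF n1 n2, symmetric])
    also have "exp C * (\<delta> * tail (\<nu> - 1)) + exp (- s * C) * (tail (\<nu> - 1) * ?E ^ N)
        = tail (\<nu> - 1) * (exp C * \<delta> + exp (- s * C) * ?E ^ N)"
      by (simp only: distrib_left mult_ac)
    finally show ?thesis .
  qed
  finally show ?thesis
    unfolding late_prob_diff[OF \<nu> p, of \<mu> w] by (rule add_left_mono)
qed

lemma cond_delay_ge:
  assumes \<nu>: "1 \<le> \<nu>" and p: "0 < p" "p < 1" and s: "0 < s" "s \<le> 1" and pos: "0 < tail (\<nu> - 1)"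
    and drop: "tail (\<nu> - 1) - tail (\<nu> - 1 + w) \<le> \<delta> * tail (\<nu> - 1)"
    and \<eta>: "exp C * \<delta> + exp (- s * C) * (1 + 2 * p powr (1 + s) * exp (s * (1 + s) * (w * \<mu>\<^sup>2 / 2))) ^ N \<le> \<eta>" "\<eta> \<le> 1"
  shows "ennreal (w * (1 - \<eta>)) \<le> cond_delay N \<mu> p T \<nu>"
proof -
  have "ennreal (tail (\<nu> - 1)) \<le> late_prob \<mu> p \<nu> (\<nu> - 1 + w) + ennreal (tail (\<nu> - 1) *
    (exp C * \<delta> + exp (- s * C) * (1 + 2 * p powr (1 + s) * exp (s * (1 + s) * (w * \<mu>\<^sup>2 / 2))) ^ N))"
    by (rule late_prob_ge) fact+
  also have "\<dots> \<le> late_prob \<mu> p \<nu> (\<nu> - 1 + w) + ennreal (tail (\<nu> - 1) * \<eta>)"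
    by (intro add_left_mono ennreal_leI mult_left_mono \<eta> tail_nonneg)
  finally have "ennreal (tail (\<nu> - 1)) - ennreal (tail (\<nu> - 1) * \<eta>) \<le> late_prob \<mu> p \<nu> (\<nu> - 1 + w)"
    by (simp add: ennreal_minus_le_iff add.commute)
  moreover have "0 \<le> \<eta>"
  proof -
    have "0 \<le> \<delta> * tail (\<nu> - 1)" using drop tail_antimono[of "\<nu> - 1" "\<nu> - 1 + w"] by simp
    then have "0 \<le> \<delta>" using pos by (simp add: zero_le_mult_iff)
    then have "0 \<le> exp C * \<delta> + exp (- s * C) * (1 + 2 * p powr (1 + s) * exp (s * (1 + s) * (w * \<mu>\<^sup>2 / 2))) ^ N"
      by (intro add_nonneg_nonneg mult_nonneg_nonneg zero_le_power) auto
    then show ?thesis using \<eta> by linarith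
  qed
  ultimately have low: "ennreal (tail (\<nu> - 1) * (1 - \<eta>)) \<le> late_prob \<mu> p \<nu> (\<nu> - 1 + w)"
    using pos by (simp add: ennreal_minus algebra_simps)
  have "ennreal (w * (1 - \<eta>)) * ennreal (tail (\<nu> - 1)) = (\<Sum>j<w. ennreal (tail (\<nu> - 1) * (1 - \<eta>)))"
  proof -
    have "ennreal (w * (1 - \<eta>)) * ennreal (tail (\<nu> - 1)) = ennreal (w * (tail (\<nu> - 1) * (1 - \<eta>)))"
      using pos by (subst ennreal_mult''[symmetric]) (auto simp: mult_ac)
    also have "\<dots> = ennreal (real w) * ennreal (tail (\<nu> - 1) * (1 - \<eta>))" by (rule ennreal_mult') simp
    finally show ?thesis by (simp add: ennreal_of_nat_eq_real_of_nat)
  qed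
  also have "\<dots> \<le> (\<Sum>j<w. late_prob \<mu> p \<nu> (\<nu> - 1 + j))"
  proof (intro sum_mono)
    fix j assume "j \<in> {..<w}"
    then have "late_prob \<mu> p \<nu> (\<nu> - 1 + w) \<le> late_prob \<mu> p \<nu> (\<nu> - 1 + j)"
      unfolding late_prob_def by (intro emeasure_mono) (auto simp: quiet_def)
    then show "ennreal (tail (\<nu> - 1) * (1 - \<eta>)) \<le> late_prob \<mu> p \<nu> (\<nu> - 1 + j)" using low by order
  qed
  also have "\<dots> \<le> (\<Sum>j. late_prob \<mu> p \<nu> (\<nu> - 1 + j))" by (rule sum_le_suminf) auto
  finally have "ennreal (w * (1 - \<eta>)) * ennreal (tail (\<nu> - 1)) / ennreal (tail (\<nu> - 1))
      \<le> (\<Sum>j. late_prob \<mu> p \<nu> (\<nu> - 1 + j)) / ennreal (tail (\<nu> - 1))"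
    by (rule divide_right_mono_ennreal)
  then show ?thesis
    unfolding cond_delay_eq[OF \<nu>] using pos by (subst (asm) ennreal_mult_divide_eq) auto
qed

text \<open>If every window of length w after i0 reduced the tail by more than the fraction 2 w /
  \<gamma>, the sum S of the tail from i0 on would satisfy (2 w / \<gamma>) S \<le> w, so S \<le>
  \<gamma> / 2. The terms before i0 add at most i0 < \<gamma> / 2, and the total could not be
  \<gamma>.\<close>

lemma exists_slow_drop:
  assumes arl: "ARL N T = ennreal \<gamma>" and w: "1 \<le> w" "2 * real w \<le> \<gamma>" and i0: "2 * real i0 < \<gamma>"
  shows "\<exists>i\<ge>i0. 0 < tail i \<and> tail i - tail (i + w) \<le> 2 * w / \<gamma> * tail i"
proof (rule ccontr)
  assume neg: "\<not> ?thesis"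
  have *: "2 * real w / \<gamma> * tail i < tail i - tail (i + w)" if "i0 \<le> i" "0 < tail i" for i
  proof (rule ccontr)
    assume "\<not> 2 * real w / \<gamma> * tail i < tail i - tail (i + w)"
    then have "\<exists>i\<ge>i0. 0 < tail i \<and> tail i - tail (i + w) \<le> 2 * real w / \<gamma> * tail i"
      using that by (intro exI[of _ i] conjI) (simp_all only: not_less)
    with neg show False by (rule notE)
  qed
  have \<gamma>: "0 < \<gamma>" using w by simp
  define q where "q = 1 - 2 * w / \<gamma>"
  have contract: "tail (i + w) \<le> q * tail i" if "i0 \<le> i" for i
  proof (cases "0 < tail i")
    case True
    then show ?thesis using *[OF that] by (simp add: q_def algebra_simps)
  next
    case False
    then have "tail i = 0" using tail_nonneg[of i] by simp
    then show ?thesis using tail_antimono[of i "i + w"] by simp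
  qed
  have sm: "summable tail" and sum: "suminf tail = \<gamma>"
    using suminf_ennreal2[of tail] arl \<gamma> unfolding ARL_eq
    by (auto simp: tail_nonneg summable_suminf_not_top suminf_nonneg intro: summable_suminf_not_top)
  define S where "S = (\<Sum>i. tail (i + i0))"
  have smi: "summable (\<lambda>i. tail (i + i0))" using sm by (rule summable_ignore_initial_segment)
  have "S = (\<Sum>i. tail (i + w + i0)) + (\<Sum>i<w. tail (i + i0))"
    unfolding S_def using suminf_split_initial_segment[OF smi, of w] by simp
  also have "(\<Sum>i<w. tail (i + i0)) \<le> w" using sum_mono[of "{..<w}" "\<lambda>i. tail (i + i0)" "\<lambda>_. 1"] tail_le_1 by simp
  also have "(\<Sum>i. tail (i + w + i0)) \<le> (\<Sum>i. q * tail (i + i0))"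
    using contract[of "_ + i0"] summable_ignore_initial_segment[OF smi, of w]
    by (intro suminf_le summable_mult smi) (auto simp: add_ac)
  also have "\<dots> = q * S" unfolding S_def by (rule suminf_mult[OF smi])
  finally have "(1 - q) * S \<le> w" by (simp add: algebra_simps)
  then have "2 * S \<le> \<gamma>" using w \<gamma> by (simp add: q_def field_simps)
  moreover have "\<gamma> = S + (\<Sum>i<i0. tail i)"
    unfolding S_def sum[symmetric] by (rule suminf_split_initial_segment[OF sm])
  moreover have "(\<Sum>i<i0. tail i) \<le> i0" using sum_mono[of "{..<i0}" tail "\<lambda>_. 1"] tail_le_1 by simp
  ultimately show False using i0 by linarith
qed

end

section \<open>Asymptotics\<close>

text \<open>The threshold and the mean weight are combined. What survives in the exponent is, in
  this order: the deficit of a finite run against \<xi>, the remainder of order 2 \<theta>, a cross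
  term from the affected streams, and with negative sign the gain from affected streams that reach
  level \<open>d\<close>.\<close>

lemma (in mei_rule) miss_prob_le_exp:
  assumes p: "0 \<le> p" "p \<le> 1" and st: "st + h = \<nu> - 1" "1 \<le> \<nu>" and p0': "p0 \<le> 1/2" and k: "1 \<le> k"
    and \<theta>: "1/2 < \<theta>" "\<theta> < 1" and thr: "b \<le> N * u + ln (4 * \<gamma>)"
    and a: "a = (d + k * m\<^sup>2 / 2 - k * m * \<mu>) / (m * sqrt k)"
    and v: "v = p0 * (lam * exp (d / 2))"
  shows "miss_prob \<mu> p \<nu> st (h + k) \<le> ennreal (exp (ln (4 * \<gamma>) + N *
    (p0 * lam * (exp (- m\<^sup>2 / 8) ^ (h + k) / (1 - exp (- m\<^sup>2 / 8)))
     + 2 * (p0 * (lam + 1)) powr (2 * \<theta>) * cusum_bound m \<theta> + p * p0 * (2 + lam * xi m)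
     - p * (exp (- (max a 0 + 1)\<^sup>2 / 2) / sqrt (2 * pi) * (v / (1 + v))))))"
proof -
  let ?e0 = "\<integral>x. weight lam p0 (rcus m 0 x (h + k)) \<partial>stream"
  let ?e1 = "\<integral>x. weight lam p0 (rcus m 0 (\<lambda>i. x i + (if h \<le> i then \<mu> else 0)) (h + k)) \<partial>stream"
  define A1 where "A1 = p0 * lam * (exp (- m\<^sup>2 / 8) ^ (h + k) / (1 - exp (- m\<^sup>2 / 8)))"
  define A2 where "A2 = 2 * (p0 * (lam + 1)) powr (2 * \<theta>) * cusum_bound m \<theta>"
  define S where "S = exp (- (max a 0 + 1)\<^sup>2 / 2) / sqrt (2 * pi) * (v / (1 + v))"
  define E where "E = (1 - p) * ?e0 + p * ?e1"
  have e0: "0 \<le> ?e0" and e1: "0 \<le> ?e1"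
    using weight_bounds[OF lam p0(1) p0'] by (auto intro!: Bochner_Integration.integral_nonneg)
  have E0: "0 \<le> E" unfolding E_def using p e0 e1 by simp
  have up0: "?e0 \<le> 1 - p0 * (lam * xi_at m (h + k) - 1) + A2"
    unfolding A2_def using m lam p0 p0' \<theta> by (intro null_weight_upper) auto
  have low0: "1 - p0 * lam * xi m \<le> ?e0"
    using m lam p0 p0' by (intro null_weight_lower) auto
  have up1: "?e1 \<le> 1 + 2 * p0 - S"
    unfolding S_def by (rule changed_weight_upper[OF m lam p0(1) p0' k a v])
  have "?e1 - ?e0 \<le> p0 * (2 + lam * xi m) - S"
    using low0 up1 by (simp add: algebra_simps)
  then have "p * (?e1 - ?e0) \<le> p * (p0 * (2 + lam * xi m) - S)" using p by (intro mult_left_mono) auto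
  then have "E \<le> 1 - p0 * (lam * xi_at m (h + k) - 1) + A2 + p * (p0 * (2 + lam * xi m) - S)"
    using up0 unfolding E_def by (simp add: algebra_simps)
  moreover have "p0 * lam * (xi m - xi_at m (h + k)) \<le> A1"
    unfolding A1_def using xi_le_xi_at[OF m, of "h + k"] lam p0 by (intro mult_left_mono) auto
  moreover have "u \<le> p0 * (lam * xi m - 1)"
    using u_arg_pos ln_add_one_self_le_self2[of "p0 * (lam * xi m - 1)"] by simp
  \<comment> \<open>The cancellation: \<open>u\<close> contributes at most p0 (lam \<xi> - 1), and
    the null weight contributes - p0 (lam \<xi>_t - 1) with \<xi>_t the moment after h + k steps.
    Only p0 lam (\<xi> - \<xi>_t) is left.\<close>
  ultimately have uE: "u + (E - 1) \<le> A1 + A2 + p * p0 * (2 + lam * xi m) - p * S"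
    by (simp add: algebra_simps)
  have "E ^ N \<le> exp (E - 1) ^ N"
    using E0 exp_ge_add_one_self[of "E - 1"] by (intro power_mono) auto
  also have "\<dots> = exp (N * (E - 1))" by (simp add: exp_of_nat_mult)
  finally have "exp b * E ^ N \<le> exp (N * u + ln (4 * \<gamma>)) * exp (N * (E - 1))"
    using thr E0 by (intro mult_mono) auto
  also have "\<dots> = exp (ln (4 * \<gamma>) + N * (u + (E - 1)))"
    by (simp only: exp_add[symmetric]) (simp add: algebra_simps)
  also have "\<dots> \<le> exp (ln (4 * \<gamma>) + N * (A1 + A2 + p * p0 * (2 + lam * xi m) - p * S))"
    using uE by (simp add: mult_left_mono)
  finally have "exp b * E ^ N \<le> exp (ln (4 * \<gamma>) + N * (A1 + A2 + p * p0 * (2 + lam * xi m) - p * S))" .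
  then show ?thesis
    using miss_prob_le[OF p st p0', of \<mu> "h + k"]
    unfolding A1_def A2_def S_def E_def by (meson ennreal_leI order_trans)
qed

text \<open>Origin of the conditions: \<open>exponent\<close> gives N p^(1+s) exp (s (1+s) w \<mu>^2
  / 2) the order N^\<zeta> at w = 2 \<rho> \<mu>^-2 log N. The inequality in \<open>tilt\<close>
  keeps p0 exp (d / 2) bounded at the level d = \<rho> (1+s)^2 log N, and its disjunction makes the
  gain of the affected streams have the same exponent \<zeta>. \<kappa> is K_N / log N: together
  with the post-change time 2 \<rho> / \<mu>^2 it gives 4 (1-\<zeta>) / m^2, the time needed to
  approach \<xi>.\<close>

locale mei_asymptotics =
  fixes \<mu> m lam \<zeta> \<beta> c s \<rho> \<kappa> :: real and \<gamma> p p0 b :: "nat \<Rightarrow> real"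
  assumes \<mu>: "0 < \<mu>" and lam: "0 < lam" and \<zeta>: "0 < \<zeta>" "\<zeta> < 1" and c: "0 < c"
    and s: "0 < s" "s \<le> 1" and \<rho>: "0 < \<rho>" and m_eq: "m = (1 + s) * \<mu>"
    and exponent: "(1 + s) * (\<beta> - s * \<rho>) = 1 - \<zeta>"
    and tilt: "s = 1 \<or> \<rho> * (1 + s)\<^sup>2 = 1 - \<zeta>" "\<rho> * (1 + s)\<^sup>2 \<le> 1 - \<zeta>"
    and \<beta>: "(1 - \<zeta>) / 2 \<le> \<beta>"
    and \<kappa>: "0 \<le> \<kappa>" "\<kappa> = 4 * (1 - \<zeta>) / m\<^sup>2 - 2 * \<rho> / \<mu>\<^sup>2"
    and ln_\<gamma>: "(\<lambda>N. ln (\<gamma> N)) \<sim>[sequentially] (\<lambda>N. real N powr \<zeta>)"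
    and p_asymp: "p \<sim>[sequentially] (\<lambda>N. real N powr (- \<beta>))"
    and p0_eq: "\<And>N. p0 N = c * sqrt (ln (\<gamma> N) / real N)"
    and ev: "\<forall>\<^sub>F N in sequentially. 1 \<le> \<gamma> N \<and> 0 < p N \<and> p N < 1 \<and> 0 < p0 N \<and> p0 N \<le> 1 \<and>
           ARL N (T_Mei N m lam (p0 N) (b N)) = ennreal (\<gamma> N)"
begin

lemma m_pos: "0 < m" using m_eq \<mu> s by simp

lemma real_powr_tendsto_at_top: "0 < x \<Longrightarrow> filterlim (\<lambda>N. real N powr x) at_top sequentially"
proof -
  assume "0 < x"
  then have "filterlim (\<lambda>t::real. t powr x) at_top at_top" by real_asymp
  then show ?thesis by (rule filterlim_compose[OF _ filterlim_real_sequentially])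
qed

lemma ev_ge_1: "\<forall>\<^sub>F N in sequentially. 1 \<le> N"
  by (rule eventually_ge_at_top)

lemma ev_ln_\<gamma>: "\<forall>\<^sub>F N in sequentially. real N powr \<zeta> / 2 \<le> ln (\<gamma> N) \<and> ln (\<gamma> N) \<le> 2 * real N powr \<zeta>"
proof -
  have "\<forall>\<^sub>F N in sequentially. norm (ln (\<gamma> N)) \<le> 2 * norm (real N powr \<zeta>)"
    by (rule asymp_equiv_imp_eventually_le[OF ln_\<gamma>]) simp
  moreover have "\<forall>\<^sub>F N in sequentially. norm (ln (\<gamma> N)) \<ge> 1/2 * norm (real N powr \<zeta>)"
    by (rule asymp_equiv_imp_eventually_ge[OF ln_\<gamma>]) simp
  ultimately show ?thesis
    using ev by eventually_elim (auto simp: abs_of_nonneg)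
qed

lemma ev_p: "\<forall>\<^sub>F N in sequentially. real N powr (- \<beta>) / 2 \<le> p N \<and> p N \<le> 2 * real N powr (- \<beta>)"
proof -
  have "\<forall>\<^sub>F N in sequentially. norm (p N) \<le> 2 * norm (real N powr (- \<beta>))"
    by (rule asymp_equiv_imp_eventually_le[OF p_asymp]) simp
  moreover have "\<forall>\<^sub>F N in sequentially. norm (p N) \<ge> 1/2 * norm (real N powr (- \<beta>))"
    by (rule asymp_equiv_imp_eventually_ge[OF p_asymp]) simp
  ultimately show ?thesis
    using ev by eventually_elim auto
qed

lemma ev_p0: "\<forall>\<^sub>F N in sequentially. c / 2 * real N powr (- (1 - \<zeta>) / 2) \<le> p0 N \<and> p0 N \<le> 2 * c * real N powr (- (1 - \<zeta>) / 2)"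
  using ev_ln_\<gamma> ev_ge_1
proof eventually_elim
  case (elim N)
  define y where "y = real N powr (- (1 - \<zeta>) / 2)"
  have y: "0 \<le> y" by (simp add: y_def)
  have y2: "y\<^sup>2 = real N powr \<zeta> / real N"
  proof -
    have "y\<^sup>2 = real N powr (- (1 - \<zeta>) / 2 + - (1 - \<zeta>) / 2)"
      by (simp only: y_def power2_eq_square powr_add)
    also have "- (1 - \<zeta>) / 2 + - (1 - \<zeta>) / 2 = \<zeta> - 1" by (simp add: field_simps)
    also have "real N powr (\<zeta> - 1) = real N powr \<zeta> / real N" using elim by (simp add: powr_diff)
    finally show ?thesis .
  qed
  have "(y / 2)\<^sup>2 \<le> ln (\<gamma> N) / real N"
  proof -
    have "real N powr \<zeta> / 4 \<le> ln (\<gamma> N)" using elim by simp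
    then have "real N powr \<zeta> / 4 / real N \<le> ln (\<gamma> N) / real N" by (intro divide_right_mono) auto
    then show ?thesis using y2 by (simp add: power_divide)
  qed
  then have lo: "y / 2 \<le> sqrt (ln (\<gamma> N) / real N)" by (rule real_le_rsqrt)
  have "ln (\<gamma> N) / real N \<le> (2 * y)\<^sup>2"
  proof -
    have "ln (\<gamma> N) \<le> 4 * real N powr \<zeta>" using elim by simp
    then have "ln (\<gamma> N) / real N \<le> 4 * real N powr \<zeta> / real N" by (intro divide_right_mono) auto
    then show ?thesis using y2 by (simp add: power_mult_distrib)
  qed
  then have hi: "sqrt (ln (\<gamma> N) / real N) \<le> 2 * y" using y by (intro real_le_lsqrt) auto
  show ?case
    unfolding p0_eq y_def[symmetric] using mult_left_mono[OF lo, of c] mult_left_mono[OF hi, of c] c by auto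
qed

lemma p0_tendsto_0: "p0 \<longlonglongrightarrow> 0"
proof (rule tendsto_sandwich)
  show "\<forall>\<^sub>F N in sequentially. p0 N \<le> 2 * c * real N powr (- (1 - \<zeta>) / 2)" using ev_p0 by eventually_elim simp
  show "\<forall>\<^sub>F N in sequentially. 0 \<le> p0 N" using ev by eventually_elim simp
  have "(\<lambda>N. real N powr (- (1 - \<zeta>) / 2)) \<longlonglongrightarrow> 0"
    using \<zeta> by (intro tendsto_neg_powr filterlim_real_sequentially) auto
  from tendsto_mult_left[OF this, of "2 * c"] show "(\<lambda>N. 2 * c * real N powr (- (1 - \<zeta>) / 2)) \<longlonglongrightarrow> 0" by simp
qed auto

lemma ev_poly_le_\<gamma>:
  assumes "0 \<le> A"
  shows "\<forall>\<^sub>F N in sequentially. A * real N ^ 2 \<le> \<gamma> N"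
proof -
  have "((\<lambda>x::real. A * x ^ 2 / exp (x powr \<zeta> / 2)) \<longlongrightarrow> 0) at_top"
    using \<zeta> assms by real_asymp
  then have "(\<lambda>N. A * real N ^ 2 / exp (real N powr \<zeta> / 2)) \<longlonglongrightarrow> 0"
    by (rule filterlim_compose[OF _ filterlim_real_sequentially])
  then have "\<forall>\<^sub>F N in sequentially. A * real N ^ 2 / exp (real N powr \<zeta> / 2) < 1"
    by (rule order_tendstoD) simp
  then show ?thesis
    using ev_ln_\<gamma> ev
  proof eventually_elim
    case (elim N)
    then have "A * real N ^ 2 \<le> exp (real N powr \<zeta> / 2)" by simp
    also have "\<dots> \<le> exp (ln (\<gamma> N))" by (subst exp_le_cancel_iff) (use elim in simp)
    also have "\<dots> = \<gamma> N" using elim by simp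
    finally show ?case .
  qed
qed

lemma ev_ln_le: "\<forall>\<^sub>F N in sequentially. A + B * ln (real N) \<le> real N"
proof -
  have "((\<lambda>x::real. (A + B * ln x) / x) \<longlongrightarrow> 0) at_top" by real_asymp
  then have "(\<lambda>N. (A + B * ln (real N)) / real N) \<longlonglongrightarrow> 0"
    by (rule filterlim_compose[OF _ filterlim_real_sequentially])
  then have "\<forall>\<^sub>F N in sequentially. (A + B * ln (real N)) / real N < 1"
    by (rule order_tendstoD) simp
  then show ?thesis using ev_ge_1 by eventually_elim (simp add: divide_simps)
qed

lemma ev_ln_ge: "0 < B \<Longrightarrow> \<forall>\<^sub>F N in sequentially. A \<le> B * ln (real N)"
proof -
  assume B: "0 < B"
  have "filterlim (\<lambda>N. ln (real N)) at_top sequentially"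
    by (rule filterlim_compose[OF ln_at_top filterlim_real_sequentially])
  then have "\<forall>\<^sub>F N in sequentially. A / B \<le> ln (real N)" by (simp add: filterlim_at_top)
  then show ?thesis by eventually_elim (use B in \<open>simp add: pos_divide_le_eq mult.commute\<close>)
qed

lemma rule_locale: "0 < p0 N \<Longrightarrow> p0 N \<le> 1 \<Longrightarrow> mei_rule m lam (p0 N)"
  using m_pos lam by (simp add: mei_rule_def)

subsection \<open>Upper bound\<close>

context
  fixes \<epsilon> :: real
  assumes \<epsilon>: "0 < \<epsilon>" "\<epsilon> \<le> s"
begin

definition "\<tau> = (1 + \<epsilon>) * (2 * \<rho> / \<mu>\<^sup>2)"
definition "k N = nat \<lceil>\<tau> * ln (real N)\<rceil>"
text \<open>Only \<nu> - 1 observations precede a change at \<nu> \<ge> K_N, hence the subtraction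
  of 1.\<close>

definition "h N = nat \<lceil>\<kappa> * ln (real N)\<rceil> - 1"
text \<open>Half of what the extra factor 1 + \<epsilon> gains in the tail exponent, which falls
  from \<rho> s^2 to \<rho> s^2 / (1 + \<epsilon>). The other half pays for lower-order
  losses.\<close>

definition "g = \<rho> * s\<^sup>2 * \<epsilon> / (1 + \<epsilon>) / 2"
text \<open>The level m^2 / 2 per step, over 2 \<rho> \<mu>^-2 log N steps, of a stream whose
  observations average \<open>m\<close>.\<close>

definition "d N = \<rho> * (1 + s)\<^sup>2 * ln (real N)"
definition "a N = (d N + k N * m\<^sup>2 / 2 - k N * m * \<mu>) / (m * sqrt (k N))"
definition "v N = p0 N * (lam * exp (d N / 2))"
text \<open>Close enough to 1 that N p0^(2 \<theta>) stays below the order N^(\<zeta> + g / 2); the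
  3/4 secures \<theta> > 1/2.\<close>

definition "\<theta> = max (3/4) (1 - g / (2 * (1 - \<zeta>)))"
definition "r = exp (- m\<^sup>2 / 8)"

lemma \<tau>_pos: "0 < \<tau>" using \<epsilon> \<rho> \<mu> by (simp add: \<tau>_def)
lemma g_pos: "0 < g" using \<epsilon> \<rho> s by (simp add: g_def)
lemma \<theta>: "1/2 < \<theta>" "\<theta> < 1" using g_pos \<zeta> by (simp_all add: \<theta>_def less_max_iff_disj)
lemma r: "0 < r" "r < 1" using exp_rate_less_1[OF m_pos] by (auto simp: r_def)

lemma ev_k: "\<forall>\<^sub>F N in sequentially. 1 \<le> k N \<and> \<tau> * ln (real N) \<le> k N \<and> real (k N) \<le> \<tau> * ln (real N) + 1"
  using ev_ln_ge[OF \<tau>_pos, of 1] by eventually_elim (auto simp: k_def; linarith)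

lemma powr_exp_ln: "1 \<le> N \<Longrightarrow> exp (x * ln (real N)) = real N powr x"
  by (simp add: powr_def)

text \<open>The h + k observations number at least 4 (1-\<zeta>) m^-2 log N - 1, so \<open>r\<close>
  to this power is at most N^(-(1-\<zeta>)/2) / r; the extra 1 / r pays for the step lost in
  \<open>h\<close>. Together with the order of \<open>p0\<close> this leaves N^\<zeta>.\<close>

lemma ev_stationary: "\<forall>\<^sub>F N in sequentially. N * (p0 N * lam * (r ^ (h N + k N) / (1 - r))) \<le> 2 * c * lam / (r * (1 - r)) * real N powr \<zeta>"
  using ev_k ev_p0 ev ev_ge_1
proof eventually_elim
  case (elim N)
  have L: "0 \<le> ln (real N)" using elim by simp
  have "\<kappa> * ln (real N) - 1 \<le> h N" unfolding h_def by linarith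
  then have "\<kappa> * ln (real N) - 1 + \<tau> * ln (real N) \<le> real (h N + k N)" using elim by simp
  moreover have "2 * \<rho> / \<mu>\<^sup>2 * ln (real N) \<le> \<tau> * ln (real N)"
    unfolding \<tau>_def using \<epsilon> \<rho> L by (intro mult_right_mono) (auto simp: divide_right_mono)
  ultimately have M: "4 * (1 - \<zeta>) / m\<^sup>2 * ln (real N) - 1 \<le> real (h N + k N)"
    unfolding \<kappa>(2) by (simp add: algebra_simps)
  have "r ^ (h N + k N) = exp (- (m\<^sup>2 / 8) * real (h N + k N))"
    unfolding r_def by (simp only: exp_of_nat_mult[symmetric]) (simp add: mult.commute)
  also have "\<dots> \<le> exp (- (m\<^sup>2 / 8) * (4 * (1 - \<zeta>) / m\<^sup>2 * ln (real N) - 1))"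
    using M by (simp add: mult_left_mono)
  also have "- (m\<^sup>2 / 8) * (4 * (1 - \<zeta>) / m\<^sup>2 * ln (real N) - 1) = (- (1 - \<zeta>) / 2) * ln (real N) + m\<^sup>2 / 8"
    using m_pos by (simp add: field_simps)
  also have "exp \<dots> = real N powr (- (1 - \<zeta>) / 2) / r"
    using elim by (simp only: exp_add powr_exp_ln) (simp add: r_def exp_minus field_simps)
  finally have rM: "r ^ (h N + k N) \<le> real N powr (- (1 - \<zeta>) / 2) / r" .
  have "N * (p0 N * lam * (r ^ (h N + k N) / (1 - r)))
      \<le> N * (2 * c * real N powr (- (1 - \<zeta>) / 2) * lam * (real N powr (- (1 - \<zeta>) / 2) / r / (1 - r)))"
    using elim rM r lam c by (intro mult_left_mono mult_mono divide_right_mono mult_right_mono) (auto intro!: mult_nonneg_nonneg)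
  also have "\<dots> = 2 * c * lam / (r * (1 - r)) * (real N powr 1 * real N powr (- (1 - \<zeta>) / 2) * real N powr (- (1 - \<zeta>) / 2))"
    using elim by simp
  also have "real N powr 1 * real N powr (- (1 - \<zeta>) / 2) * real N powr (- (1 - \<zeta>) / 2) = real N powr \<zeta>"
    using elim by (simp only: powr_add[symmetric]) (simp add: field_simps)
  finally show ?case .
qed

lemma ev_second_moment:
  defines "A \<equiv> 2 * (2 * c * (lam + 1)) powr (2 * \<theta>) * cusum_bound m \<theta>"
  shows "\<forall>\<^sub>F N in sequentially. N * (2 * (p0 N * (lam + 1)) powr (2 * \<theta>) * cusum_bound m \<theta>) \<le> A * real N powr (\<zeta> + g / 2)"
  using ev_p0 ev ev_ge_1
proof eventually_elim
  case (elim N)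
  have B: "0 \<le> cusum_bound m \<theta>" using cusum_bound_ge_1[of \<theta> m] \<theta> m_pos by simp
  have "(p0 N * (lam + 1)) powr (2 * \<theta>) \<le> (2 * c * real N powr (- (1 - \<zeta>) / 2) * (lam + 1)) powr (2 * \<theta>)"
    using elim lam \<theta> by (intro powr_mono2 mult_right_mono) auto
  also have "\<dots> = (2 * c * (lam + 1)) powr (2 * \<theta>) * real N powr (- (1 - \<zeta>) * \<theta>)"
  proof -
    have "2 * c * real N powr (- (1 - \<zeta>) / 2) * (lam + 1) = (2 * c * (lam + 1)) * real N powr (- (1 - \<zeta>) / 2)"
      by (simp only: mult_ac)
    moreover have "- (1 - \<zeta>) / 2 * (2 * \<theta>) = - (1 - \<zeta>) * \<theta>" by simp
    ultimately show ?thesis by (simp only: powr_mult[of _ "real N powr (- (1 - \<zeta>) / 2)"] powr_powr)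
  qed
  finally have "N * (2 * (p0 N * (lam + 1)) powr (2 * \<theta>) * cusum_bound m \<theta>)
      \<le> N * (2 * ((2 * c * (lam + 1)) powr (2 * \<theta>) * real N powr (- (1 - \<zeta>) * \<theta>)) * cusum_bound m \<theta>)"
    using B by (intro mult_left_mono mult_right_mono) auto
  also have "\<dots> = A * (real N powr 1 * real N powr (- (1 - \<zeta>) * \<theta>))"
    using elim by (simp add: A_def)
  also have "real N powr 1 * real N powr (- (1 - \<zeta>) * \<theta>) = real N powr (1 - (1 - \<zeta>) * \<theta>)"
    by (simp only: powr_add[symmetric]) (simp add: algebra_simps)
  also have "A * \<dots> \<le> A * real N powr (\<zeta> + g / 2)"
  proof (intro mult_left_mono powr_mono)
    have "(1 - \<zeta>) * (1 - g / (2 * (1 - \<zeta>))) \<le> (1 - \<zeta>) * \<theta>"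
      using \<zeta> by (intro mult_left_mono) (auto simp: \<theta>_def)
    also have "(1 - \<zeta>) * (1 - g / (2 * (1 - \<zeta>))) = 1 - \<zeta> - g / 2" using \<zeta> by (simp add: field_simps)
    finally show "1 - (1 - \<zeta>) * \<theta> \<le> \<zeta> + g / 2" by simp
  qed (use elim B in \<open>auto simp: A_def\<close>)
  finally show ?case .
qed

text \<open>The exponent 1 - \<beta> - (1-\<zeta>)/2 is at most \<zeta> precisely because \<beta>
  \<ge> (1-\<zeta>)/2.\<close>

lemma ev_cross: "\<forall>\<^sub>F N in sequentially. N * (p N * p0 N * (2 + lam * xi m)) \<le> 4 * c * (2 + lam * xi m) * real N powr \<zeta>"
  using ev_p0 ev_p ev ev_ge_1
proof eventually_elim
  case (elim N)
  have B: "0 \<le> 2 + lam * xi m" using lam xi_ge_1[OF m_pos] by simp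
  have "N * (p N * p0 N * (2 + lam * xi m))
      \<le> N * (2 * real N powr (- \<beta>) * (2 * c * real N powr (- (1 - \<zeta>) / 2)) * (2 + lam * xi m))"
    using elim B by (intro mult_left_mono mult_right_mono mult_mono) auto
  also have "\<dots> = 4 * c * (2 + lam * xi m) * (real N powr 1 * real N powr (- \<beta>) * real N powr (- (1 - \<zeta>) / 2))"
    using elim by simp
  also have "real N powr 1 * real N powr (- \<beta>) * real N powr (- (1 - \<zeta>) / 2) = real N powr (1 - \<beta> - (1 - \<zeta>) / 2)"
    by (simp only: powr_add[symmetric]) (simp add: field_simps)
  also have "4 * c * (2 + lam * xi m) * \<dots> \<le> 4 * c * (2 + lam * xi m) * real N powr \<zeta>"
  proof (intro mult_left_mono powr_mono)
    show "0 \<le> 4 * c * (2 + lam * xi m)" using c by (intro mult_nonneg_nonneg B) auto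
  qed (use elim \<beta> in \<open>auto simp: field_simps\<close>)
  finally show ?case .
qed

text \<open>Since \<open>m \<le> 2 * \<mu>\<close> the drift per step is nonnegative, so k may be
  replaced by \<tau> log N. The numerator then is \<rho> (1+s) (2 s - \<epsilon> (1-s)) log N; for s
  = 1 it contains no \<epsilon> at all, so the gain is taken from the factor sqrt (1 + \<epsilon>)
  in the standard deviation.\<close>

lemma a_le:
  assumes L: "0 < ln (real N)" and k: "1 \<le> k N" "\<tau> * ln (real N) \<le> k N"
  shows "a N \<le> s * sqrt (2 * \<rho> / (1 + \<epsilon>)) * sqrt (ln (real N))"
proof -
  define L where "L = ln (real N)"
  have L0: "0 < L" using L by (simp add: L_def)
  have sq: "0 < sqrt (real (k N))" using k by simp
  have km: "k N * m\<^sup>2 / 2 - k N * m * \<mu> = - (k N * (m * \<mu> * (1 - s) / 2))"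
    by (simp add: m_eq power2_eq_square field_simps)
  have "m * \<mu> * (1 - s) / 2 \<ge> 0" using m_pos \<mu> s by simp
  then have "\<tau> * L * (m * \<mu> * (1 - s) / 2) \<le> k N * (m * \<mu> * (1 - s) / 2)"
    using k by (intro mult_right_mono) (auto simp: L_def)
  then have "d N + k N * m\<^sup>2 / 2 - k N * m * \<mu> \<le> d N - \<tau> * L * (m * \<mu> * (1 - s) / 2)"
    using km by linarith
  also have "\<dots> = \<rho> * (1 + s) * L * (2 * s - \<epsilon> * (1 - s))"
    using \<mu> by (simp add: d_def L_def[symmetric] \<tau>_def m_eq power2_eq_square field_simps)
  also have "\<dots> \<le> \<rho> * (1 + s) * L * (2 * s)"
    using \<rho> s L0 \<epsilon> by (intro mult_left_mono) auto
  finally have num: "d N + k N * m\<^sup>2 / 2 - k N * m * \<mu> \<le> \<rho> * (1 + s) * L * (2 * s)" .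
  have "a N \<le> \<rho> * (1 + s) * L * (2 * s) / (m * sqrt (k N))"
    unfolding a_def using num m_pos sq by (intro divide_right_mono) auto
  also have "\<dots> \<le> \<rho> * (1 + s) * L * (2 * s) / (m * sqrt (\<tau> * L))"
    using \<rho> s L0 m_pos sq \<tau>_pos k by (intro divide_left_mono mult_left_mono mult_pos_pos) (auto simp: L_def)
  also have "\<dots> = s * sqrt (2 * \<rho> / (1 + \<epsilon>)) * sqrt L"
  proof -
    have t: "sqrt (\<tau> * L) = sqrt (1 + \<epsilon>) * sqrt (2 * \<rho>) / \<mu> * sqrt L"
      unfolding \<tau>_def using \<mu> by (simp add: real_sqrt_mult real_sqrt_divide)
    have "2 * \<rho> * L = sqrt (2 * \<rho>) * sqrt (2 * \<rho>) * (sqrt L * sqrt L)" using \<rho> L0 by simp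
    then have num2: "\<rho> * (1 + s) * L * (2 * s) = (1 + s) * s * (sqrt (2 * \<rho>) * sqrt (2 * \<rho>) * (sqrt L * sqrt L))"
      by (simp add: algebra_simps)
    have gen: "q * s * (P * P * (Q * Q)) / (q * \<mu> * (R * P / \<mu> * Q)) = s * (P / R) * Q"
      if "0 < P" "0 < Q" "0 < R" "0 < q" for P Q R q :: real
      using that \<mu> by (simp add: field_simps)
    show ?thesis
      unfolding t m_eq real_sqrt_divide num2 by (rule gen) (use \<rho> L0 \<epsilon> s in auto)
  qed
  finally show ?thesis by (simp add: L_def)
qed

text \<open>The 1 in (max a 0 + 1)^2 costs a term of order sqrt (log N), which is absorbed by g log
  N. That is why only g of the available 2 g appears.\<close>

lemma ev_tail: "\<forall>\<^sub>F N in sequentially. real N powr (- \<rho> * s\<^sup>2 + g) / exp 1 \<le> exp (- (max (a N) 0 + 1)\<^sup>2 / 2)"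
proof -
  define \<alpha> where "\<alpha> = s * sqrt (2 * \<rho> / (1 + \<epsilon>))"
  have \<alpha>0: "0 \<le> \<alpha>" using s \<rho> \<epsilon> by (simp add: \<alpha>_def)
  have \<alpha>2: "\<alpha>\<^sup>2 / 2 = \<rho> * s\<^sup>2 - 2 * g"
    using \<rho> \<epsilon> by (simp add: \<alpha>_def power_mult_distrib g_def field_simps)
  have "((\<lambda>x::real. \<alpha> * sqrt (ln x) / ln x) \<longlongrightarrow> 0) at_top" by real_asymp
  then have "(\<lambda>N. \<alpha> * sqrt (ln (real N)) / ln (real N)) \<longlonglongrightarrow> 0"
    by (rule filterlim_compose[OF _ filterlim_real_sequentially])
  then have "\<forall>\<^sub>F N in sequentially. \<alpha> * sqrt (ln (real N)) / ln (real N) < g"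
    by (rule order_tendstoD) (rule g_pos)
  then show ?thesis
    using ev_k ev_ln_ge[OF zero_less_one, of 1] ev_ge_1
  proof eventually_elim
    case (elim N)
    define L where "L = ln (real N)"
    have L: "1 \<le> L" using elim by (simp add: L_def)
    have x: "\<alpha> * sqrt L \<le> g * L" using elim L by (simp add: L_def[symmetric] pos_divide_less_eq)
    have "a N \<le> \<alpha> * sqrt L"
      unfolding \<alpha>_def L_def by (rule a_le) (use elim in linarith)+
    then have "max (a N) 0 \<le> \<alpha> * sqrt L" using \<alpha>0 L by simp
    then have "(max (a N) 0 + 1)\<^sup>2 \<le> (\<alpha> * sqrt L + 1)\<^sup>2" by (intro power_mono) auto
    also have "\<dots> = \<alpha>\<^sup>2 * L + 2 * (\<alpha> * sqrt L) + 1"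
      using L by (simp add: power2_eq_square algebra_simps)
    finally have "(max (a N) 0 + 1)\<^sup>2 / 2 \<le> \<alpha>\<^sup>2 / 2 * L + \<alpha> * sqrt L + 1" by simp
    also have "\<dots> \<le> (\<rho> * s\<^sup>2 - g) * L + 1" using x unfolding \<alpha>2 by (simp add: algebra_simps)
    finally have "exp (- ((\<rho> * s\<^sup>2 - g) * L + 1)) \<le> exp (- (max (a N) 0 + 1)\<^sup>2 / 2)" by simp
    moreover have "exp (- ((\<rho> * s\<^sup>2 - g) * L + 1)) = real N powr (- \<rho> * s\<^sup>2 + g) / exp 1"
    proof -
      have "- ((\<rho> * s\<^sup>2 - g) * L + 1) = (- \<rho> * s\<^sup>2 + g) * ln (real N) - 1" by (simp add: L_def algebra_simps)
      then show ?thesis using elim powr_exp_ln[of N "- \<rho> * s\<^sup>2 + g"] by (simp only: exp_diff)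
    qed
    ultimately show ?case by metis
  qed
qed

text \<open>The bookkeeping of the gain: about N^(1-\<beta>) affected streams, each contributing p0
  exp (d / 2) with probability of order N^(- \<rho> s^2), up to the surplus g.\<close>

lemma signal_exponent: "1 - \<beta> + (\<rho> * (1 + s)\<^sup>2 / 2 - (1 - \<zeta>) / 2) + - \<rho> * s\<^sup>2 = \<zeta>"
proof -
  have b: "\<beta> = (1 - \<zeta>) / (1 + s) + s * \<rho>" using exponent s by (simp add: field_simps)
  from tilt(1) show ?thesis
  proof
    assume "s = 1"
    then show ?thesis using b by (simp add: power2_eq_square field_simps)
  next
    assume *: "\<rho> * (1 + s)\<^sup>2 = 1 - \<zeta>"
    then have "(1 - \<zeta>) / (1 + s) = \<rho> * (1 + s)" using s by (simp add: power2_eq_square field_simps)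
    with b have b': "\<beta> = \<rho> * (1 + s) + s * \<rho>" by simp
    have "\<zeta> = 1 - \<rho> * (1 + s)\<^sup>2" using * by simp
    then show ?thesis unfolding b' by (simp add: power2_eq_square field_simps)
  qed
qed

lemma ev_signal:
  defines "A \<equiv> c * lam / (4 * exp 1 * sqrt (2 * pi) * (1 + 2 * c * lam))"
  shows "\<forall>\<^sub>F N in sequentially. A * real N powr (\<zeta> + g)
    \<le> N * (p N * (exp (- (max (a N) 0 + 1)\<^sup>2 / 2) / sqrt (2 * pi) * (v N / (1 + v N))))"
  using ev_tail ev_p ev_p0 ev ev_ge_1
proof eventually_elim
  case (elim N)
  define x where "x = \<rho> * (1 + s)\<^sup>2 / 2 - (1 - \<zeta>) / 2"
  \<comment> \<open>Hence \<open>v N\<close> is bounded, and v / (1 + v) is of the order of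
    v.\<close>
  have x: "x \<le> 0" using tilt(2) by (simp add: x_def)
  have N: "1 \<le> N" using elim by blast
  have e: "exp (d N / 2) = real N powr (\<rho> * (1 + s)\<^sup>2 / 2)"
    using powr_exp_ln[OF N, of "\<rho> * (1 + s)\<^sup>2 / 2"] by (simp add: d_def)
  have px: "real N powr (- (1 - \<zeta>) / 2) * (lam * exp (d N / 2)) = lam * real N powr x"
  proof -
    have "- (1 - \<zeta>) / 2 + \<rho> * (1 + s)\<^sup>2 / 2 = x" by (simp add: x_def field_simps)
    then have "real N powr (- (1 - \<zeta>) / 2) * real N powr (\<rho> * (1 + s)\<^sup>2 / 2) = real N powr x"
      by (simp only: powr_add[symmetric])
    then show ?thesis unfolding e by (simp only: mult_ac)
  qed
  have v1: "v N \<le> 2 * c * (lam * real N powr x)"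
  proof -
    have "v N \<le> 2 * c * real N powr (- (1 - \<zeta>) / 2) * (lam * exp (d N / 2))"
      unfolding v_def using elim lam by (intro mult_right_mono) auto
    then show ?thesis by (simp only: px mult.assoc)
  qed
  have v2: "c / 2 * (lam * real N powr x) \<le> v N"
  proof -
    have "c / 2 * real N powr (- (1 - \<zeta>) / 2) * (lam * exp (d N / 2)) \<le> v N"
      unfolding v_def using elim lam by (intro mult_right_mono) auto
    then show ?thesis by (simp only: px mult.assoc)
  qed
  have "real N powr x \<le> real N powr 0" using N x by (intro powr_mono) auto
  then have "real N powr x \<le> 1" using N by simp
  then have "2 * c * (lam * real N powr x) \<le> 2 * c * (lam * 1)" using c lam by (intro mult_left_mono) auto
  then have v3: "1 + v N \<le> 1 + 2 * c * lam" using v1 by simp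
  have v0: "0 < v N" using elim lam by (simp add: v_def)
  have "c / 2 * (lam * real N powr x) / (1 + 2 * c * lam) \<le> v N / (1 + v N)"
    using v2 v3 v0 c lam by (intro frac_le) auto
  then have "N * (real N powr (- \<beta>) / 2 * (real N powr (- \<rho> * s\<^sup>2 + g) / exp 1 / sqrt (2 * pi) * (c / 2 * (lam * real N powr x) / (1 + 2 * c * lam))))
     \<le> N * (p N * (exp (- (max (a N) 0 + 1)\<^sup>2 / 2) / sqrt (2 * pi) * (v N / (1 + v N))))"
    using elim c lam by (intro mult_left_mono mult_mono divide_right_mono) auto
  moreover have "N * (real N powr (- \<beta>) / 2 * (real N powr (- \<rho> * s\<^sup>2 + g) / exp 1 / sqrt (2 * pi) * (c / 2 * (lam * real N powr x) / (1 + 2 * c * lam))))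
     = A * (real N powr 1 * real N powr (- \<beta>) * real N powr (- \<rho> * s\<^sup>2 + g) * real N powr x)"
    using N unfolding A_def by (simp add: field_simps)
  moreover have "real N powr 1 * real N powr (- \<beta>) * real N powr (- \<rho> * s\<^sup>2 + g) * real N powr x = real N powr (\<zeta> + g)"
    unfolding powr_add[symmetric] using signal_exponent by (intro arg_cong[where f="\<lambda>y. real N powr y"]) (simp add: x_def)
  ultimately show ?case by simp
qed

text \<open>The gain has order N^(\<zeta> + g), against at most N^(\<zeta> + g/2) for everything
  else, including the two copies of log \<gamma>.\<close>

lemma ev_exponent:
  "\<forall>\<^sub>F N in sequentially. ln (4 * \<gamma> N) + N *
    (p0 N * lam * (r ^ (h N + k N) / (1 - r))
     + 2 * (p0 N * (lam + 1)) powr (2 * \<theta>) * cusum_bound m \<theta> + p N * p0 N * (2 + lam * xi m)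
     - p N * (exp (- (max (a N) 0 + 1)\<^sup>2 / 2) / sqrt (2 * pi) * (v N / (1 + v N)))) \<le> - ln (\<gamma> N)"
proof -
  define A1 where "A1 = 2 * c * lam / (r * (1 - r))"
  define A2 where "A2 = 2 * (2 * c * (lam + 1)) powr (2 * \<theta>) * cusum_bound m \<theta>"
  define A3 where "A3 = 4 * c * (2 + lam * xi m)"
  define A4 where "A4 = c * lam / (4 * exp 1 * sqrt (2 * pi) * (1 + 2 * c * lam))"
  \<comment> \<open>The terms ln 4 + 4 stand for ln (4 \<gamma>) + ln \<gamma>, using ln \<gamma>
    \<le> 2 N^\<zeta>.\<close>
  define B where "B = ln 4 + 4 + A1 + A3"
  have A4: "0 < A4" using c lam by (auto simp: A4_def intro!: divide_pos_pos mult_pos_pos add_pos_pos)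
  have A2: "0 \<le> A2" using cusum_bound_ge_1[of \<theta> m] \<theta> m_pos by (simp add: A2_def)
  have B: "0 \<le> B"
    using c lam r xi_ge_1[OF m_pos] by (auto simp: B_def A1_def A3_def intro!: add_nonneg_nonneg)
  have "\<forall>\<^sub>F N in sequentially. 1 + (B + A2) / A4 \<le> real N powr (g / 2)"
    using real_powr_tendsto_at_top[of "g / 2"] g_pos by (simp add: filterlim_at_top)
  then show ?thesis
    using ev_stationary ev_second_moment ev_cross ev_signal ev_ln_\<gamma> ev ev_ge_1
  proof eventually_elim
    case (elim N)
    define x where "x = real N powr \<zeta>"
    define y where "y = real N powr (g / 2)"
    have "real N powr 0 \<le> x" unfolding x_def using elim \<zeta> by (intro powr_mono) auto
    then have x: "1 \<le> x" using elim by simp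
    have "0 \<le> (B + A2) / A4" using A2 B A4 by simp
    then have y: "1 \<le> y" "(B + A2) / A4 \<le> y" using elim by (auto simp: y_def)
    have "B + A2 * y \<le> (B + A2) * y" using y B by (simp add: algebra_simps mult_le_cancel_left1)
    also have "\<dots> \<le> (A4 * y) * y" using y A4 by (intro mult_right_mono) (auto simp: pos_divide_le_eq mult.commute)
    finally have "x * (B + A2 * y) \<le> x * (A4 * y * y)" using x by (intro mult_left_mono) auto
    moreover have "ln 4 \<le> ln (4::real) * x" using x by (simp add: mult_le_cancel_left1)
    moreover have "x * (B + A2 * y) = ln 4 * x + 4 * x + A1 * x + A3 * x + A2 * (x * y)"
      unfolding B_def by (simp add: algebra_simps)
    moreover have "x * (A4 * y * y) = A4 * (x * y * y)" by simp
    ultimately have key: "ln 4 + 4 * x + A1 * x + A3 * x + A2 * (x * y) \<le> A4 * (x * y * y)"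
      by linarith
    have xy: "real N powr (\<zeta> + g / 2) = x * y" "real N powr (\<zeta> + g) = x * y * y"
      unfolding x_def y_def powr_add[symmetric] by (simp_all add: add.assoc)
    have "ln (4 * \<gamma> N) = ln 4 + ln (\<gamma> N)" using elim by (simp add: ln_mult)
    moreover have "ln (\<gamma> N) \<le> 2 * x" using elim by (simp add: x_def)
    moreover have split: "real N * (t1 + t2 + t3 - t4) = real N * t1 + real N * t2 + real N * t3 - real N * t4" for t1 t2 t3 t4
      by (simp add: algebra_simps)
    moreover note key elim(2-5)[folded A1_def A2_def A3_def A4_def, unfolded xy x_def[symmetric]]
    ultimately show ?case unfolding split by linarith
  qed
qed

text \<open>The memory length is taken to be L = N: long enough that N r^N vanishes, yet negligible
  against \<gamma>, which outgrows every polynomial. Two quarters leave the 1/2 required by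
  \<open>cond_delay_le\<close>.\<close>

lemma ev_window:
  "\<forall>\<^sub>F N in sequentially. 1/4 \<ge> (real N + h N) / \<gamma> N \<and> N * (cusum_bound m (1/2) * r ^ N) \<le> 1/4"
proof -
  have "(\<lambda>N. real N * r ^ N) \<longlonglongrightarrow> 0" using r by (intro powser_times_n_limit_0) auto
  from tendsto_mult_left[OF this, of "cusum_bound m (1/2)"]
  have "(\<lambda>N. cusum_bound m (1/2) * (real N * r ^ N)) \<longlonglongrightarrow> 0" by simp
  then have "\<forall>\<^sub>F N in sequentially. cusum_bound m (1/2) * (real N * r ^ N) < 1/4"
    by (rule order_tendstoD) simp
  then show ?thesis
    using ev_ln_le[of 0 \<kappa>] ev_poly_le_\<gamma>[of 8, simplified] ev ev_ge_1
  proof eventually_elim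
    case (elim N)
    have "0 \<le> \<kappa> * ln (real N)" using \<kappa> elim by simp
    then have "real (h N) \<le> \<kappa> * ln (real N)" unfolding h_def by linarith
    then have "real N + h N \<le> 2 * real N" using elim by simp
    also have "\<dots> \<le> 2 * real N ^ 2" using elim by (simp add: power2_eq_square)
    also have "\<dots> \<le> \<gamma> N / 4" using elim by simp
    finally have "(real N + h N) / \<gamma> N \<le> 1/4" using elim by (simp add: pos_divide_le_eq)
    then show ?case using elim by (simp add: mult_ac)
  qed
qed

text \<open>In the additive 3, one unit comes from rounding up \<open>k\<close> and two from 2
  \<gamma> times a miss probability of at most 1 / \<gamma>.\<close>

lemma ev_detection_delay_le:
  "\<forall>\<^sub>F N in sequentially. detection_delay N \<mu> (p N) (\<kappa> * ln (real N)) (T_Mei N m lam (p0 N) (b N))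
     \<le> ennreal (\<tau> * ln (real N) + 3)"
proof -
  have "\<forall>\<^sub>F N in sequentially. p0 N < 1/2" by (rule order_tendstoD[OF p0_tendsto_0]) simp
  then show ?thesis
    using ev_window ev_exponent ev_k ev ev_ge_1
  proof eventually_elim
    case (elim N)
    interpret R: mei_rule N m lam "p0 N" "b N" using elim by (intro rule_locale) auto
    have \<gamma>: "1 \<le> \<gamma> N" and arl: "ARL N R.T = ennreal (\<gamma> N)" using elim by auto
    define X where "X = ln (4 * \<gamma> N) + N *
      (p0 N * lam * (r ^ (h N + k N) / (1 - r))
     + 2 * (p0 N * (lam + 1)) powr (2 * \<theta>) * cusum_bound m \<theta> + p N * p0 N * (2 + lam * xi m)
     - p N * (exp (- (max (a N) 0 + 1)\<^sup>2 / 2) / sqrt (2 * pi) * (v N / (1 + v N))))"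
    have "exp X \<le> exp (- ln (\<gamma> N))" using elim by (simp only: X_def exp_le_cancel_iff)
    also have "\<dots> = 1 / \<gamma> N" using \<gamma> by (simp add: exp_minus inverse_eq_divide)
    finally have X: "exp X \<le> 1 / \<gamma> N" .
    show ?case unfolding detection_delay_def
    proof (rule SUP_least)
      fix \<nu> assume "\<nu> \<in> {\<nu>. 1 \<le> \<nu> \<and> \<kappa> * ln (real N) \<le> real \<nu> \<and>
        0 < emeasure (P_change N \<mu> (p N) \<nu>) (late_event N \<mu> (p N) R.T \<nu>)}"
      then have \<nu>: "1 \<le> \<nu>" "\<kappa> * ln (real N) \<le> real \<nu>"
        and pos: "0 < emeasure (P_change N \<mu> (p N) \<nu>) (late_event N \<mu> (p N) R.T \<nu>)" by auto
      have "h N \<le> \<nu> - 1" unfolding h_def using \<nu> by (simp add: ceiling_le_iff nat_le_iff diff_le_mono)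
      moreover have "1/2 \<le> R.tail (N + h N) - N * (cusum_bound m (1/2) * exp (- m\<^sup>2 / 8) ^ N)"
      proof -
        have "1 - (real N + real (h N)) / \<gamma> N \<le> R.tail (N + h N)"
          using R.tail_ge_ARL[OF arl \<gamma>, of "N + h N"] by simp
        then show ?thesis using elim(2)[THEN conjunct1] elim(2)[THEN conjunct2] unfolding r_def by linarith
      qed
      moreover have "R.miss_prob \<mu> (p N) \<nu> (\<nu> - 1 - h N) (h N + k N) \<le> ennreal (exp X)"
        unfolding X_def r_def
      proof (rule R.miss_prob_le_exp)
        show "b N \<le> N * R.u + ln (4 * \<gamma> N)" by (rule R.threshold_le[OF \<gamma> arl])
        show "a N = (d N + k N * m\<^sup>2 / 2 - k N * m * \<mu>) / (m * sqrt (k N))" by (rule a_def)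
        show "v N = p0 N * (lam * exp (d N / 2))" by (rule v_def)
      qed (use elim \<nu> calculation(1) \<theta> in auto)
      moreover have "0 < R.tail (\<nu> - 1)" using pos by (simp add: R.emeasure_late_event[OF \<nu>(1)])
      ultimately have "cond_delay N \<mu> (p N) R.T \<nu> \<le> ennreal (k N + 2 * \<gamma> N * exp X)"
        using \<mu> \<nu> elim by (intro R.cond_delay_le[OF _ _ _ _ arl \<gamma>]) auto
      also have "\<dots> \<le> ennreal (\<tau> * ln (real N) + 3)"
      proof (intro ennreal_leI)
        have "2 * \<gamma> N * exp X \<le> 2 * \<gamma> N * (1 / \<gamma> N)" using X \<gamma> by (intro mult_left_mono) auto
        then show "k N + 2 * \<gamma> N * exp X \<le> \<tau> * ln (real N) + 3" using elim \<gamma> by simp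
      qed
      finally show "cond_delay N \<mu> (p N) R.T \<nu> \<le> ennreal (\<tau> * ln (real N) + 3)" .
    qed
  qed
qed

end

subsection \<open>Lower bound\<close>

text \<open>The split level is C = (ln \<gamma>) / 2. The first term is 2 w / sqrt \<gamma>. In the
  second, \<open>exponent\<close> gives the moment the size exp (O(N^(\<zeta> - e))), which exp (- s
  C) beats because C grows like N^\<zeta>.\<close>

lemma ev_change_of_measure:
  assumes \<epsilon>: "0 < \<epsilon>" "\<epsilon> < 1" and \<eta>: "0 < \<eta>"
    and w: "\<forall>N\<ge>1. real (w N) \<le> (1 - \<epsilon>) * (2 * \<rho> / \<mu>\<^sup>2) * ln (real N)"
  shows "\<forall>\<^sub>F N in sequentially. exp (ln (\<gamma> N) / 2) * (2 * real (w N) / \<gamma> N)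
     + exp (- s * (ln (\<gamma> N) / 2)) * (1 + 2 * p N powr (1 + s) * exp (s * (1 + s) * (w N * \<mu>\<^sup>2 / 2))) ^ N \<le> \<eta>"
proof -
  define e where "e = \<epsilon> * (s * (1 + s) * \<rho>)"
  have e: "0 < e" using \<epsilon> s \<rho> by (simp add: e_def)
  have "(\<lambda>N. real N powr (- e)) \<longlonglongrightarrow> 0"
    using e by (intro tendsto_neg_powr filterlim_real_sequentially) auto
  \<comment> \<open>With the factor 8 from the moment bound, \<open>N * x\<close> becomes at most (s
    / 8) N^\<zeta>, half of the lower bound (s / 4) N^\<zeta> for s C.\<close>
  then have "\<forall>\<^sub>F N in sequentially. real N powr (- e) < s / 64"
    by (rule order_tendstoD) (use s in simp)
  moreover have "\<forall>\<^sub>F N in sequentially. - ln (\<eta> / 2) / (s / 8) \<le> real N powr \<zeta>"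
    using real_powr_tendsto_at_top[OF \<zeta>(1)] by (simp add: filterlim_at_top)
  ultimately show ?thesis
    using ev_poly_le_\<gamma>[of "(4 / \<eta>)\<^sup>2", OF zero_le_power2] ev_ln_le[of 0 "(1 - \<epsilon>) * (2 * \<rho> / \<mu>\<^sup>2)"]
      ev_p ev_ln_\<gamma> ev ev_ge_1
  proof eventually_elim
    case (elim N)
    have N: "1 \<le> N" and \<gamma>: "1 \<le> \<gamma> N" and p: "0 < p N" using elim by auto
    define C where "C = ln (\<gamma> N) / 2"
    have C2: "exp C ^ 2 = \<gamma> N" using \<gamma> by (simp add: C_def exp_double[symmetric])
    have "(4 / \<eta> * real N)\<^sup>2 \<le> exp C ^ 2" unfolding C2 using elim by (simp add: power_mult_distrib power_divide)
    then have "4 / \<eta> * real N \<le> exp C" by (rule power2_le_imp_le) simp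
    then have "4 * real N \<le> \<eta> * exp C" using \<eta> by (simp add: field_simps)
    moreover have wN: "real (w N) \<le> real N" using w[rule_format, OF N] elim by simp
    ultimately have "2 * real (w N) \<le> \<eta> / 2 * exp C" by simp
    then have "exp C * (2 * real (w N) / \<gamma> N) \<le> exp C * (\<eta> / 2 * exp C / \<gamma> N)"
      using \<gamma> by (intro mult_left_mono divide_right_mono) auto
    also have "\<dots> = \<eta> / 2" unfolding C2[symmetric] by (simp add: power2_eq_square)
    finally have first: "exp C * (2 * real (w N) / \<gamma> N) \<le> \<eta> / 2" .
    define x where "x = 2 * p N powr (1 + s) * exp (s * (1 + s) * (w N * \<mu>\<^sup>2 / 2))"
    have "w N * \<mu>\<^sup>2 / 2 \<le> (1 - \<epsilon>) * \<rho> * ln (real N)"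
      using mult_right_mono[OF w[rule_format, OF N], of "\<mu>\<^sup>2 / 2"] \<mu> by simp
    then have "exp (s * (1 + s) * (w N * \<mu>\<^sup>2 / 2)) \<le> exp (s * (1 + s) * ((1 - \<epsilon>) * \<rho> * ln (real N)))"
      using s by (simp add: mult_left_mono)
    also have "\<dots> = real N powr (s * (1 + s) * (1 - \<epsilon>) * \<rho>)"
      using N by (simp add: powr_def mult_ac)
    finally have E: "exp (s * (1 + s) * (w N * \<mu>\<^sup>2 / 2)) \<le> real N powr (s * (1 + s) * (1 - \<epsilon>) * \<rho>)" .
    have "p N powr (1 + s) \<le> (2 * real N powr (- \<beta>)) powr (1 + s)"
      using elim s p by (intro powr_mono2) auto
    also have "\<dots> = 2 powr (1 + s) * real N powr (- \<beta> * (1 + s))" by (simp add: powr_mult powr_powr)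
    also have "\<dots> \<le> 2 powr 2 * real N powr (- \<beta> * (1 + s))"
      using s by (intro mult_right_mono powr_mono) auto
    finally have P: "p N powr (1 + s) \<le> 4 * real N powr (- \<beta> * (1 + s))" by simp
    have "N * x \<le> real N powr 1 * (2 * (4 * real N powr (- \<beta> * (1 + s))) * real N powr (s * (1 + s) * (1 - \<epsilon>) * \<rho>))"
      unfolding x_def using P E by (intro mult_mono) auto
    also have "\<dots> = 8 * (real N powr 1 * real N powr (- \<beta> * (1 + s)) * real N powr (s * (1 + s) * (1 - \<epsilon>) * \<rho>))" by simp
    also have "real N powr 1 * real N powr (- \<beta> * (1 + s)) * real N powr (s * (1 + s) * (1 - \<epsilon>) * \<rho>) = real N powr \<zeta> * real N powr (- e)"
    proof -
      have "1 + - \<beta> * (1 + s) + s * (1 + s) * (1 - \<epsilon>) * \<rho> = \<zeta> + - e"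
        using exponent by (simp add: e_def algebra_simps)
      then show ?thesis by (simp only: powr_add[symmetric])
    qed
    also have "8 * (real N powr \<zeta> * real N powr (- e)) \<le> 8 * (real N powr \<zeta> * (s / 64))"
      using elim by (intro mult_left_mono) auto
    finally have Nx: "N * x \<le> s / 8 * real N powr \<zeta>" by simp
    have x0: "0 \<le> x" by (simp add: x_def)
    have "exp (- s * C) * (1 + x) ^ N \<le> exp (- s * C) * exp x ^ N"
      using x0 exp_ge_add_one_self[of x] by (intro mult_left_mono power_mono) auto
    also have "\<dots> = exp (- s * C + N * x)" by (simp only: exp_add exp_of_nat_mult)
    also have "\<dots> \<le> exp (ln (\<eta> / 2))"
    proof (subst exp_le_cancel_iff)
      have "s * (real N powr \<zeta> / 4) \<le> s * C" unfolding C_def using elim s by (intro mult_left_mono) auto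
      moreover have "- ln (\<eta> / 2) \<le> real N powr \<zeta> * (s / 8)" using elim(2) s by (subst (asm) pos_divide_le_eq) auto
      ultimately show "- s * C + N * x \<le> ln (\<eta> / 2)" using Nx by (simp add: mult.commute[of s])
    qed
    also have "\<dots> = \<eta> / 2" using \<eta> by simp
    finally show ?case using first unfolding C_def x_def by simp
  qed
qed

lemma ev_detection_delay_ge:
  assumes \<epsilon>: "0 < \<epsilon>" "\<epsilon> < 1"
  shows "\<forall>\<^sub>F N in sequentially. ennreal (((1 - \<epsilon>) * (2 * \<rho> / \<mu>\<^sup>2) * ln (real N) - 1) * (1 - \<epsilon>))
     \<le> detection_delay N \<mu> (p N) (\<kappa> * ln (real N)) (T_Mei N m lam (p0 N) (b N))"
proof -
  define \<sigma> where "\<sigma> = (1 - \<epsilon>) * (2 * \<rho> / \<mu>\<^sup>2)"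
  have \<sigma>: "0 < \<sigma>" using \<epsilon> \<rho> \<mu> by (simp add: \<sigma>_def)
  define w where "w N = nat \<lfloor>\<sigma> * ln (real N)\<rfloor>" for N :: nat
  have w_le: "real (w N) \<le> \<sigma> * ln (real N)" if "1 \<le> N" for N
  proof -
    have "0 \<le> \<sigma> * ln (real N)" using \<sigma> that by simp
    then show ?thesis unfolding w_def by linarith
  qed
  have "\<forall>N\<ge>1. real (w N) \<le> (1 - \<epsilon>) * (2 * \<rho> / \<mu>\<^sup>2) * ln (real N)"
    using w_le unfolding \<sigma>_def by blast
  note ev_change = ev_change_of_measure[OF \<epsilon> \<epsilon>(1) this]
  show ?thesis
    using ev_change ev_ln_ge[OF \<sigma>, of 1]
      ev_ln_le[of 0 \<sigma>] ev_ln_le[of 1 \<kappa>] ev_poly_le_\<gamma>[of 3, simplified] ev ev_ge_1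
  proof eventually_elim
    case (elim N)
    have N: "1 \<le> N" and \<gamma>: "1 \<le> \<gamma> N" and p: "0 < p N" "p N < 1" using elim by auto
    interpret R: mei_rule N m lam "p0 N" "b N" using elim by (intro rule_locale) auto
    have arl: "ARL N R.T = ennreal (\<gamma> N)" using elim by auto
    have N2: "real N \<le> real N ^ 2" using N by (simp add: power2_eq_square)
    have w1: "1 \<le> w N" unfolding w_def using elim by linarith
    define i0 where "i0 = nat \<lceil>\<kappa> * ln (real N)\<rceil>"
    have "0 \<le> \<kappa> * ln (real N)" using \<kappa> N by simp
    then have i0: "\<kappa> * ln (real N) \<le> real i0" "real i0 \<le> \<kappa> * ln (real N) + 1" unfolding i0_def by linarith+
    have "\<exists>i\<ge>i0. 0 < R.tail i \<and> R.tail i - R.tail (i + w N) \<le> 2 * real (w N) / \<gamma> N * R.tail i"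
    proof (rule R.exists_slow_drop[OF arl w1])
      show "2 * real (w N) \<le> \<gamma> N" using w_le[OF N] elim N2 by linarith
      show "2 * real i0 < \<gamma> N" using i0 elim N2 N by linarith
    qed
    then obtain i where i: "i0 \<le> i" "0 < R.tail i" "R.tail i - R.tail (i + w N) \<le> 2 * real (w N) / \<gamma> N * R.tail i" by blast
    \<comment> \<open>The condition T \<ge> \<nu> means T > \<nu> - 1, so index i of
      \<open>tail\<close> belongs to \<nu> = i + 1.\<close>
    define \<nu> where "\<nu> = Suc i"
    have \<nu>: "1 \<le> \<nu>" "\<nu> - 1 = i" by (auto simp: \<nu>_def)
    have "ennreal (((1 - \<epsilon>) * (2 * \<rho> / \<mu>\<^sup>2) * ln (real N) - 1) * (1 - \<epsilon>)) \<le> ennreal (w N * (1 - \<epsilon>))"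
    proof (intro ennreal_leI mult_right_mono)
      show "(1 - \<epsilon>) * (2 * \<rho> / \<mu>\<^sup>2) * ln (real N) - 1 \<le> real (w N)"
        unfolding w_def \<sigma>_def by linarith
    qed (use \<epsilon> in auto)
    also have "\<dots> \<le> cond_delay N \<mu> (p N) R.T \<nu>"
    proof (rule R.cond_delay_ge[OF \<nu>(1) p s, where C="ln (\<gamma> N) / 2" and \<delta>="2 * real (w N) / \<gamma> N"])
      show "0 < R.tail (\<nu> - 1)" unfolding \<nu>(2) by (rule i(2))
      show "R.tail (\<nu> - 1) - R.tail (\<nu> - 1 + w N) \<le> 2 * real (w N) / \<gamma> N * R.tail (\<nu> - 1)"
        unfolding \<nu>(2) by (rule i(3))
    qed (use elim(1) \<epsilon> in auto)
    also have "\<dots> \<le> detection_delay N \<mu> (p N) (\<kappa> * ln (real N)) R.T"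
      unfolding detection_delay_def
    proof (rule SUP_upper, safe)
      show "\<kappa> * ln (real N) \<le> real \<nu>" using i0 i(1) by (simp add: \<nu>_def)
      show "0 < emeasure (P_change N \<mu> (p N) \<nu>) (late_event N \<mu> (p N) R.T \<nu>)"
        unfolding R.emeasure_late_event[OF \<nu>(1)] \<nu>(2) using i(2) by simp
    qed (rule \<nu>(1))
    finally show ?case .
  qed
qed

lemma detection_delay_LIMSEQ:
  "(\<lambda>N. detection_delay N \<mu> (p N) (\<kappa> * ln (real N)) (T_Mei N m lam (p0 N) (b N)) / ennreal (ln (real N)))
    \<longlonglongrightarrow> ennreal (2 / \<mu>\<^sup>2 * \<rho>)"
proof (rule order_tendstoI)
  let ?D = "\<lambda>N. detection_delay N \<mu> (p N) (\<kappa> * ln (real N)) (T_Mei N m lam (p0 N) (b N))"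
  define G where "G = 2 * \<rho> / \<mu>\<^sup>2"
  have G: "0 < G" using \<rho> \<mu> by (simp add: G_def)
  have Geq: "2 / \<mu>\<^sup>2 * \<rho> = G" by (simp add: G_def)
  fix y :: ennreal
  {
    assume "y < ennreal (2 / \<mu>\<^sup>2 * \<rho>)"
    then obtain x where y: "y = ennreal x" "0 \<le> x" "x < G"
      unfolding Geq by (cases y) (auto simp: ennreal_less_iff)
    \<comment> \<open>Then (1 - \<epsilon>)^2 G \<ge> (1 - 2 \<epsilon>) G = (G + x) / 2 > x; one
      factor 1 - \<epsilon> is the shortened window, the other the conditional survival
      probability.\<close>
    define \<epsilon> where "\<epsilon> = (G - x) / (4 * G)"
    have \<epsilon>: "0 < \<epsilon>" "\<epsilon> < 1" using y G by (auto simp: \<epsilon>_def field_simps)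
    have "x < G - (G - x) / 2" using y(3) by (simp add: field_simps)
    also have "\<dots> = G * (1 - 2 * \<epsilon>)" using G by (simp add: \<epsilon>_def field_simps)
    also have "\<dots> \<le> G * ((1 - \<epsilon>) * (1 - \<epsilon>))"
      using G by (intro mult_left_mono) (auto simp: algebra_simps)
    finally have "x < G * ((1 - \<epsilon>) * (1 - \<epsilon>))" .
    then have gap: "0 < (1 - \<epsilon>) * G * (1 - \<epsilon>) - x" by (simp add: mult_ac)
    show "\<forall>\<^sub>F N in sequentially. y < ?D N / ennreal (ln (real N))"
      using ev_detection_delay_ge[OF \<epsilon>] ev_ln_ge[OF gap, of 1] ev_ln_ge[OF zero_less_one, of 1]
    proof eventually_elim
      case (elim N)
      define L where "L = ln (real N)"
      have L: "1 \<le> L" using elim by (simp add: L_def)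
      have "x * L + 1 \<le> (1 - \<epsilon>) * G * (1 - \<epsilon>) * L" using elim by (simp add: L_def algebra_simps)
      then have "x * L < ((1 - \<epsilon>) * G * L - 1) * (1 - \<epsilon>)" using \<epsilon> by (simp add: algebra_simps)
      then have lt: "x < ((1 - \<epsilon>) * G * L - 1) * (1 - \<epsilon>) / L" using L by (simp add: pos_less_divide_eq)
      then have "y < ennreal (((1 - \<epsilon>) * G * L - 1) * (1 - \<epsilon>) / L)"
        unfolding y(1) using y(2) by (simp add: ennreal_less_iff)
      also have "\<dots> = ennreal (((1 - \<epsilon>) * G * L - 1) * (1 - \<epsilon>)) / ennreal L"
      proof -
        have "0 < ((1 - \<epsilon>) * G * L - 1) * (1 - \<epsilon>) / L" using lt y(2) by linarith
        then have "0 \<le> ((1 - \<epsilon>) * G * L - 1) * (1 - \<epsilon>)" using L by (simp add: zero_less_divide_iff)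
        then show ?thesis using L by (simp add: divide_ennreal)
      qed
      also have "\<dots> \<le> ?D N / ennreal L"
        by (rule divide_right_mono_ennreal) (use elim in \<open>simp only: L_def G_def\<close>)
      finally show ?case by (simp only: L_def)
    qed
  }
  {
    assume y: "ennreal (2 / \<mu>\<^sup>2 * \<rho>) < y"
    obtain x where x: "G < x" "ennreal x \<le> y"
    proof (cases y)
      case (real x)
      then show ?thesis using y that[of x] G unfolding Geq by (auto simp: ennreal_less_iff)
    next
      case top
      then show ?thesis using that[of "G + 1"] by simp
    qed
    \<comment> \<open>The second entry puts (1 + \<epsilon>) G at or below the midpoint of G and
      x.\<close>
    define \<epsilon> where "\<epsilon> = min s ((x - G) / (2 * G))"
    have \<epsilon>: "0 < \<epsilon>" "\<epsilon> \<le> s" using x G s by (auto simp: \<epsilon>_def)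
    have "G * \<epsilon> \<le> G * ((x - G) / (2 * G))" using G by (intro mult_left_mono) (auto simp: \<epsilon>_def)
    also have "\<dots> = (x - G) / 2" using G by simp
    finally have gap: "0 < x - (1 + \<epsilon>) * G" using x by (simp add: algebra_simps)
    show "\<forall>\<^sub>F N in sequentially. ?D N / ennreal (ln (real N)) < y"
      using ev_detection_delay_le[OF \<epsilon>] ev_ln_ge[OF gap, of 4] ev_ln_ge[OF zero_less_one, of 1]
    proof eventually_elim
      case (elim N)
      define L where "L = ln (real N)"
      have L: "1 \<le> L" using elim by (simp add: L_def)
      have t: "\<tau> \<epsilon> = (1 + \<epsilon>) * G" using \<tau>_def[OF \<epsilon>] by (simp add: G_def)
      have "(1 + \<epsilon>) * G * L + 3 < x * L" using elim by (simp add: L_def algebra_simps)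
      then have lt: "((1 + \<epsilon>) * G * L + 3) / L < x" using L by (simp add: pos_divide_less_eq)
      have "0 \<le> (1 + \<epsilon>) * G * L" using \<epsilon> G L by simp
      then have n: "0 \<le> (1 + \<epsilon>) * G * L + 3" by linarith
      have "?D N / ennreal L \<le> ennreal ((1 + \<epsilon>) * G * L + 3) / ennreal L"
        by (rule divide_right_mono_ennreal) (use elim t in \<open>simp add: L_def\<close>)
      also have "\<dots> = ennreal (((1 + \<epsilon>) * G * L + 3) / L)" using L n by (simp add: divide_ennreal)
      also have "\<dots> < ennreal x" using lt n L by (intro ennreal_lessI) (auto intro: le_less_trans[rotated])
      finally show ?case using x(2) by (simp add: L_def)
    qed
  }
qed

end

section \<open>The theorem\<close>

lemma mei_xi_eq_xi:
  assumes "n \<in> {1..N}"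
  shows "mei_xi N m n = xi m"
proof -
  interpret prob_space "P_inf N" by (rule prob_space_P_inf)
  have [measurable]: "(\<lambda>\<omega>. \<omega> i) \<in> borel_measurable (P_inf N)" for i
    unfolding P_inf_def by (rule measurable_component_stdn)
  have "(\<integral>\<omega>. exp (cusum m \<omega> n t / 2) \<partial>P_inf N) = xi_at m t" for t
  proof -
    have "(\<integral>\<^sup>+\<omega>. ennreal (exp (rcus m 0 (\<lambda>i. \<omega> (n, Suc i)) t / 2)) \<partial>P_inf N)
        = (\<integral>\<^sup>+x. ennreal (exp (rcus m 0 x t / 2)) \<partial>stream)"
      using nn_integral_P_inf_stream[OF assms, of "\<lambda>x. ennreal (exp (rcus m 0 x t / 2))" 0] by simp
    then show ?thesis
      unfolding xi_at_def cusum_eq_rcus by (subst (1 2) integral_eq_nn_integral) auto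
  qed
  then show ?thesis by (simp add: mei_xi_def xi_def fun_eq_iff cong: arg_cong[where f=lim])
qed

theorem theorem3:
  fixes \<mu> \<mu>0 lamM :: real
  assumes "0 < \<mu>" and "0 < \<mu>0" and "0 < lamM"
  shows
    "(\<forall>(N::nat) (n::nat) (p0::real) (b::real) (\<gamma>::real) (u::real).
        1 \<le> N \<and> n \<in> {1..N} \<and> 0 < p0 \<and> p0 \<le> 1 \<and>
        u = ln (1 + p0 * (lamM * mei_xi N \<mu>0 n - 1)) \<and>
        1 \<le> \<gamma> \<and> ARL N (T_Mei N \<mu>0 lamM p0 b) = ennreal \<gamma>
        \<longrightarrow> b \<le> real N * u + ln (4 * \<gamma>))
     \<and>
     (\<forall>(\<zeta>::real) (\<beta>::real) (c::real) (\<gamma>::nat \<Rightarrow> real) (p::nat \<Rightarrow> real)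
        (p0::nat \<Rightarrow> real) (b::nat \<Rightarrow> real).
        0 < \<zeta> \<and> \<zeta> < 1 \<and> 0 < \<beta> \<and> \<beta> < 1 \<and> 0 < c \<and>
        (\<lambda>N. ln (\<gamma> N)) \<sim>[sequentially] (\<lambda>N. real N powr \<zeta>) \<and>
        p \<sim>[sequentially] (\<lambda>N. real N powr (- \<beta>)) \<and>
        (\<forall>N. p0 N = c * sqrt (ln (\<gamma> N) / real N)) \<and>
        (\<forall>\<^sub>F N in sequentially. 1 \<le> \<gamma> N \<and> 0 < p N \<and> p N < 1 \<and> 0 < p0 N \<and> p0 N \<le> 1 \<and>
           ARL N (T_Mei N \<mu>0 lamM (p0 N) (b N)) = ennreal (\<gamma> N))
        \<longrightarrow>
        ((1 - \<zeta>) / 2 < \<beta> \<and> \<beta> \<le> 3 * (1 - \<zeta>) / 4 \<and> \<mu>0 = 2 * \<mu> \<longrightarrow>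
           (\<lambda>N. detection_delay N \<mu> (p N) (2 / \<mu>\<^sup>2 * (1 - \<zeta> - \<beta>) * ln (real N))
                  (T_Mei N \<mu>0 lamM (p0 N) (b N)) / ennreal (ln (real N)))
             \<longlonglongrightarrow> ennreal (2 / \<mu>\<^sup>2 * rho \<beta> \<zeta>))
        \<and>
        (3 * (1 - \<zeta>) / 4 < \<beta> \<and> \<beta> < 1 - \<zeta> \<and> \<mu>0 = \<mu> * sqrt ((1 - \<zeta>) / rho \<beta> \<zeta>) \<longrightarrow>
           (\<lambda>N. detection_delay N \<mu> (p N) (2 / \<mu>\<^sup>2 * rho \<beta> \<zeta> * ln (real N))
                  (T_Mei N \<mu>0 lamM (p0 N) (b N)) / ennreal (ln (real N)))
             \<longlonglongrightarrow> ennreal (2 / \<mu>\<^sup>2 * rho \<beta> \<zeta>)))"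
proof (intro conjI allI impI; elim conjE)
  fix N n :: nat and p0 b \<gamma> u :: real
  assume n: "n \<in> {1..N}" and p0: "0 < p0" "p0 \<le> 1"
    and u: "u = ln (1 + p0 * (lamM * mei_xi N \<mu>0 n - 1))"
    and \<gamma>: "1 \<le> \<gamma>" and arl: "ARL N (T_Mei N \<mu>0 lamM p0 b) = ennreal \<gamma>"
  interpret mei_rule N \<mu>0 lamM p0 b using assms p0 by unfold_locales
  show "b \<le> real N * u + ln (4 * \<gamma>)"
    using threshold_le[OF \<gamma> arl] unfolding u mei_xi_eq_xi[OF n] .
next
  fix \<zeta> \<beta> c :: real and \<gamma> p p0 b :: "nat \<Rightarrow> real"
  assume \<zeta>: "0 < \<zeta>" "\<zeta> < 1" and c: "0 < c"
    and asy: "(\<lambda>N. ln (\<gamma> N)) \<sim>[sequentially] (\<lambda>N. real N powr \<zeta>)"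
      "p \<sim>[sequentially] (\<lambda>N. real N powr (- \<beta>))" "\<forall>N. p0 N = c * sqrt (ln (\<gamma> N) / real N)"
      "\<forall>\<^sub>F N in sequentially. 1 \<le> \<gamma> N \<and> 0 < p N \<and> p N < 1 \<and> 0 < p0 N \<and> p0 N \<le> 1 \<and>
           ARL N (T_Mei N \<mu>0 lamM (p0 N) (b N)) = ennreal (\<gamma> N)"
    and \<beta>: "(1 - \<zeta>) / 2 < \<beta>" "\<beta> \<le> 3 * (1 - \<zeta>) / 4" and \<mu>0: "\<mu>0 = 2 * \<mu>"
  define \<rho> where "\<rho> = \<beta> - (1 - \<zeta>) / 2"
  have rho: "rho \<beta> \<zeta> = \<rho>" using \<beta> by (simp add: rho_def \<rho>_def)
  have \<kappa>: "2 / \<mu>\<^sup>2 * (1 - \<zeta> - \<beta>) = 4 * (1 - \<zeta>) / \<mu>0\<^sup>2 - 2 * \<rho> / \<mu>\<^sup>2"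
    using assms(1) by (simp add: \<mu>0 \<rho>_def power2_eq_square field_simps)
  \<comment> \<open>The boundary of the first regime is the condition \<open>tilt\<close> at s = 1:
    \<beta> \<le> 3 (1-\<zeta>)/4 says 4 \<rho> \<le> 1 - \<zeta>.\<close>
  have pars: "0 < \<rho>" "(1 + 1) * (\<beta> - 1 * \<rho>) = 1 - \<zeta>" "\<rho> * (1 + 1)\<^sup>2 \<le> 1 - \<zeta>" "(1 - \<zeta>) / 2 \<le> \<beta>"
    using \<beta> by (simp_all add: \<rho>_def field_simps)
  have "0 \<le> 1 - \<zeta> - \<beta>" using \<beta> \<zeta> by simp
  then have \<kappa>0: "0 \<le> 2 / \<mu>\<^sup>2 * (1 - \<zeta> - \<beta>)" by simp
  have \<mu>0': "\<mu>0 = (1 + 1) * \<mu>" using \<mu>0 by simp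
  have "mei_asymptotics \<mu> \<mu>0 lamM \<zeta> \<beta> c 1 \<rho> (2 / \<mu>\<^sup>2 * (1 - \<zeta> - \<beta>)) \<gamma> p p0 b"
    by (rule mei_asymptotics.intro[OF assms(1,3) \<zeta> c zero_less_one order_refl pars(1) \<mu>0' pars(2)
          disjI1[OF refl] pars(3,4) \<kappa>0 \<kappa> asy(1,2) asy(3)[rule_format] asy(4)])
  then interpret mei_asymptotics \<mu> \<mu>0 lamM \<zeta> \<beta> c 1 \<rho> "2 / \<mu>\<^sup>2 * (1 - \<zeta> - \<beta>)" \<gamma> p p0 b .
  show "(\<lambda>N. detection_delay N \<mu> (p N) (2 / \<mu>\<^sup>2 * (1 - \<zeta> - \<beta>) * ln (real N))
          (T_Mei N \<mu>0 lamM (p0 N) (b N)) / ennreal (ln (real N))) \<longlonglongrightarrow> ennreal (2 / \<mu>\<^sup>2 * rho \<beta> \<zeta>)"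
    unfolding rho by (rule detection_delay_LIMSEQ)
next
  fix \<zeta> \<beta> c :: real and \<gamma> p p0 b :: "nat \<Rightarrow> real"
  assume \<zeta>: "0 < \<zeta>" "\<zeta> < 1" and c: "0 < c"
    and asy: "(\<lambda>N. ln (\<gamma> N)) \<sim>[sequentially] (\<lambda>N. real N powr \<zeta>)"
      "p \<sim>[sequentially] (\<lambda>N. real N powr (- \<beta>))" "\<forall>N. p0 N = c * sqrt (ln (\<gamma> N) / real N)"
      "\<forall>\<^sub>F N in sequentially. 1 \<le> \<gamma> N \<and> 0 < p N \<and> p N < 1 \<and> 0 < p0 N \<and> p0 N \<le> 1 \<and>
           ARL N (T_Mei N \<mu>0 lamM (p0 N) (b N)) = ennreal (\<gamma> N)"
    and \<beta>: "3 * (1 - \<zeta>) / 4 < \<beta>" "\<beta> < 1 - \<zeta>" and \<mu>0: "\<mu>0 = \<mu> * sqrt ((1 - \<zeta>) / rho \<beta> \<zeta>)"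
  define z where "z = 1 - \<zeta>"
  define A where "A = sqrt z"
  define B where "B = sqrt (z - \<beta>)"
  define \<rho> where "\<rho> = (A - B)\<^sup>2"
  \<comment> \<open>This is 1 + s: with \<rho> = (A - B)^2 and 1 - \<zeta> = A^2, the equation
    \<rho> q^2 = 1 - \<zeta> has the positive solution A / (A - B).\<close>
  define q where "q = A / (A - B)"
  have z: "0 < z" "0 < z - \<beta>" "z - \<beta> < z / 4" using \<zeta> \<beta> by (auto simp: z_def)
  have A2: "A * A = z" and B2: "B * B = z - \<beta>" using z by (auto simp: A_def B_def)
  have B0: "0 < B" using z by (simp add: B_def)
  \<comment> \<open>The condition \<beta> > 3 (1-\<zeta>)/4 enters here: it says 4 B^2 < A^2, hence
    q \<le> 2 and s \<le> 1.\<close>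
  have "(2 * B) * (2 * B) < A * A" using A2 B2 z by simp
  then have "(2 * B)\<^sup>2 < A\<^sup>2" by (simp only: power2_eq_square)
  then have BA: "2 * B < A" by (rule power2_less_imp_less) (use z in \<open>simp add: A_def\<close>)
  have rho: "rho \<beta> \<zeta> = \<rho>" using \<beta> by (simp add: rho_def \<rho>_def A_def B_def z_def)
  have \<rho>0: "0 < \<rho>" using BA B0 by (simp add: \<rho>_def)
  have q: "1 < q" "q \<le> 2" using BA B0 by (simp_all add: q_def pos_less_divide_eq pos_divide_le_eq)
  have qAB: "q * (A - B) = A" using BA B0 by (simp add: q_def)
  have \<rho>q: "\<rho> * q\<^sup>2 = z"
  proof -
    have "\<rho> * q\<^sup>2 = (q * (A - B)) * (q * (A - B))" by (simp add: \<rho>_def power2_eq_square)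
    then show ?thesis unfolding qAB by (simp add: A2)
  qed
  have "sqrt ((1 - \<zeta>) / rho \<beta> \<zeta>) = sqrt (q\<^sup>2)"
    unfolding rho z_def[symmetric] \<rho>q[symmetric] using \<rho>0 by simp
  then have \<mu>0q: "\<mu>0 = q * \<mu>" using \<mu>0 q by simp
  have \<beta>_eq: "\<beta> = q * \<rho> + (q - 1) * \<rho>"
  proof -
    have "q * \<rho> = A * (A - B)"
      using qAB by (simp add: \<rho>_def power2_eq_square mult.assoc[symmetric])
    then have "q * \<rho> + (q - 1) * \<rho> = 2 * (A * (A - B)) - (A - B) * (A - B)"
      by (simp add: algebra_simps \<rho>_def power2_eq_square)
    also have "\<dots> = A * A - B * B" by (simp add: algebra_simps)
    finally show ?thesis by (simp add: A2 B2)
  qed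
  have ex: "(1 + (q - 1)) * (\<beta> - (q - 1) * \<rho>) = 1 - \<zeta>"
  proof -
    have "(1 + (q - 1)) * (\<beta> - (q - 1) * \<rho>) = \<rho> * q\<^sup>2" unfolding \<beta>_eq by (simp add: power2_eq_square)
    then show ?thesis by (simp add: \<rho>q z_def)
  qed
  have \<kappa>: "2 / \<mu>\<^sup>2 * \<rho> = 4 * (1 - \<zeta>) / \<mu>0\<^sup>2 - 2 * \<rho> / \<mu>\<^sup>2"
  proof -
    have "4 * (1 - \<zeta>) / \<mu>0\<^sup>2 = 4 * (\<rho> * q\<^sup>2) / (q\<^sup>2 * \<mu>\<^sup>2)" by (simp add: \<rho>q z_def \<mu>0q power_mult_distrib)
    also have "\<dots> = 4 * \<rho> / \<mu>\<^sup>2" using q by simp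
    finally show ?thesis by simp
  qed
  have half: "(1 - \<zeta>) / 2 \<le> \<beta>" using \<beta> \<zeta> by simp
  have \<kappa>0: "0 \<le> 2 / \<mu>\<^sup>2 * \<rho>" using \<rho>0 by simp
  have tilt: "\<rho> * (1 + (q - 1))\<^sup>2 = 1 - \<zeta>" using \<rho>q by (simp add: z_def)
  have s: "0 < q - 1" "q - 1 \<le> 1" and \<mu>0': "\<mu>0 = (1 + (q - 1)) * \<mu>" using q \<mu>0q by simp_all
  have "mei_asymptotics \<mu> \<mu>0 lamM \<zeta> \<beta> c (q - 1) \<rho> (2 / \<mu>\<^sup>2 * \<rho>) \<gamma> p p0 b"
    by (rule mei_asymptotics.intro[OF assms(1,3) \<zeta> c s \<rho>0 \<mu>0' ex
          disjI2[OF tilt] eq_refl[OF tilt] half \<kappa>0 \<kappa> asy(1,2) asy(3)[rule_format] asy(4)])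
  then interpret mei_asymptotics \<mu> \<mu>0 lamM \<zeta> \<beta> c "q - 1" \<rho> "2 / \<mu>\<^sup>2 * \<rho>" \<gamma> p p0 b .
  show "(\<lambda>N. detection_delay N \<mu> (p N) (2 / \<mu>\<^sup>2 * rho \<beta> \<zeta> * ln (real N))
          (T_Mei N \<mu>0 lamM (p0 N) (b N)) / ennreal (ln (real N))) \<longlonglongrightarrow> ennreal (2 / \<mu>\<^sup>2 * rho \<beta> \<zeta>)"
    unfolding rho by (rule detection_delay_LIMSEQ)
qed

end
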